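(* Let $\omega$ be a non-quasianalytic concave weight function. Then for every $d\ge1$ both rings ${}_d\mathcal{E}^{\{\omega\}}$ and ${}_d\mathcal{E}^{(\omega)}$ have property $(\mathscr{D})$.
   Context: A weight function is a continuous increasing $\omega:[0,\infty)\to[0,\infty)$ with $\omega(2t)=O(\omega(t))$, $\omega(t)=o(t)$, $\log t=o(\omega(t))$ as $t\to\infty$, and such that $\varphi_\omega(t):=\omega(e^t)$ is convex on $[0,\infty)$. It is non-quasianalytic if $\int_1^\infty\omega(t)t^{-2}\,dt<\infty$. Let $\varphi_\omega^*(s):=\sup_{t\ge0}(st-\varphi_\omega(t))$. For open $U\subseteq\mathbb{R}^d$ and $\rho>0$, $\mathcal{B}^\omega_\rho(U)$ is the set of $f\in C^\infty(U)$ with $\sup_{x\in U,\alpha\in\mathbb{N}^d}|\partial^\alpha f(x)|e^{-\varphi_\omega^*(\rho|\alpha|)/\rho}<\infty$. $\mathcal{E}^{\{\omega\}}(U)$ is the set of $f\in C^\infty(U)$ such that for every relatively compact open $V\subseteq U$ there is $n\in\mathbb{N}_{\ge1}$ with $f|_V\in\mathcal{B}^\omega_n(V)$; $\mathcal{E}^{(\omega)}(U)$ is the set of $f$ with $f|_V\in\mathcal{B}^\omega_{1/n}(V)$ for all such $V$ and all $n\ge1$. ${}_d\mathcal{E}^{\{\omega\}}$ (resp. ${}_d\mathcal{E}^{(\omega)}$) is the ring of germs at $0\in\mathbb{R}^d$ of complex valued functions of class $\mathcal{E}^{\{\omega\}}$ (resp. $\mathcal{E}^{(\omega)}$). A subring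 $\mathcal{S}$ of the ring of germs at $0\in\mathbb{R}^d$ of complex valued $C^\infty$ functions has property $(\mathscr{D})$ if for every complex valued function germ $f$ at $0$: if $f^j,f^{j+1}\in\mathcal{S}$ for some integer $j\ge1$, then $f\in\mathcal{S}$. *)

theory Defs
  imports "HOL-Analysis.Analysis" "HOL-Library.Landau_Symbols"
begin

definition weight_function :: "(real \<Rightarrow> real) \<Rightarrow> bool" where
  "weight_function \<omega> \<longleftrightarrow>
     continuous_on {0..} \<omega> \<and> mono_on {0..} \<omega> \<and> (\<forall>t\<ge>0. \<omega> t \<ge> 0) \<and>
     (\<lambda>t. \<omega> (2 * t)) \<in> O[at_top](\<omega>) \<and>
     \<omega> \<in> o[at_top](\<lambda>t. t) \<and>
     (\<lambda>t. ln t) \<in> o[at_top](\<omega>) \<and>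
     convex_on {0..} (\<lambda>t. \<omega> (exp t))"

definition non_quasianalytic :: "(real \<Rightarrow> real) \<Rightarrow> bool" where
  "non_quasianalytic \<omega> \<longleftrightarrow> (\<lambda>t. \<omega> t / t\<^sup>2) integrable_on {1..}"

definition phi_star :: "(real \<Rightarrow> real) \<Rightarrow> real \<Rightarrow> real" where
  "phi_star \<omega> s = (SUP t\<in>{0..}. s * t - \<omega> (exp t))"

definition partial :: "'n::finite \<Rightarrow> (real^'n \<Rightarrow> complex) \<Rightarrow> real^'n \<Rightarrow> complex" where
  "partial i f x = vector_derivative (\<lambda>t. f (x + t *\<^sub>R axis i 1)) (at 0)"

fun iter_partial :: "'n::finite list \<Rightarrow> (real^'n \<Rightarrow> complex) \<Rightarrow> real^'n \<Rightarrow> complex" where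
  "iter_partial [] f = f"
| "iter_partial (i # is) f = partial i (iter_partial is f)"

definition smooth_on :: "(real^'n::finite) set \<Rightarrow> (real^'n \<Rightarrow> complex) \<Rightarrow> bool" where
  "smooth_on U f \<longleftrightarrow> (\<forall>is. continuous_on U (iter_partial is f) \<and>
      (\<forall>i. \<forall>x\<in>U. (\<lambda>t. iter_partial is f (x + t *\<^sub>R axis i 1)) differentiable (at 0)))"

text \<open>A fixed enumeration of the coordinate indices (the order is irrelevant for smooth functions).\<close>
definition index_list :: "'n::finite list" where
  "index_list = (SOME xs. set xs = UNIV \<and> distinct xs)"

definition dpartial :: "('n::finite \<Rightarrow> nat) \<Rightarrow> (real^'n \<Rightarrow> complex) \<Rightarrow> real^'n \<Rightarrow> complex" where
  "dpartial \<alpha> f = iter_partial (concat (map (\<lambda>i. replicate (\<alpha> i) i) index_list)) f"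

definition mi_len :: "('n::finite \<Rightarrow> nat) \<Rightarrow> nat" where
  "mi_len \<alpha> = (\<Sum>i\<in>UNIV. \<alpha> i)"

definition B_class :: "(real \<Rightarrow> real) \<Rightarrow> real \<Rightarrow> (real^'n::finite) set \<Rightarrow> (real^'n \<Rightarrow> complex) \<Rightarrow> bool" where
  "B_class \<omega> \<rho> U f \<longleftrightarrow> smooth_on U f \<and>
     bdd_above {cmod (dpartial \<alpha> f x) * exp (- phi_star \<omega> (\<rho> * real (mi_len \<alpha>)) / \<rho>) | x \<alpha>. x \<in> U}"

definition rel_compact_in :: "(real^'n::finite) set \<Rightarrow> (real^'n) set \<Rightarrow> bool" where
  "rel_compact_in V U \<longleftrightarrow> open V \<and> compact (closure V) \<and> closure V \<subseteq> U"

definition E_Roumieu :: "(real \<Rightarrow> real) \<Rightarrow> (real^'n::finite) set \<Rightarrow> (real^'n \<Rightarrow> complex) \<Rightarrow> bool" where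
  "E_Roumieu \<omega> U f \<longleftrightarrow> smooth_on U f \<and>
     (\<forall>V. rel_compact_in V U \<longrightarrow> (\<exists>n::nat. n \<ge> 1 \<and> B_class \<omega> (real n) V f))"

definition E_Beurling :: "(real \<Rightarrow> real) \<Rightarrow> (real^'n::finite) set \<Rightarrow> (real^'n \<Rightarrow> complex) \<Rightarrow> bool" where
  "E_Beurling \<omega> U f \<longleftrightarrow> smooth_on U f \<and>
     (\<forall>V. rel_compact_in V U \<longrightarrow> (\<forall>n::nat. n \<ge> 1 \<longrightarrow> B_class \<omega> (1 / real n) V f))"

text \<open>A germ at 0 is represented by any function on R^d; it lies in the ring of germs of
  class E iff some representative restricted to some open neighbourhood of 0 is of class E.\<close>
definition germ_Roumieu :: "(real \<Rightarrow> real) \<Rightarrow> (real^'n::finite \<Rightarrow> complex) \<Rightarrow> bool" where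
  "germ_Roumieu \<omega> f \<longleftrightarrow> (\<exists>U. open U \<and> 0 \<in> U \<and> E_Roumieu \<omega> U f)"

definition germ_Beurling :: "(real \<Rightarrow> real) \<Rightarrow> (real^'n::finite \<Rightarrow> complex) \<Rightarrow> bool" where
  "germ_Beurling \<omega> f \<longleftrightarrow> (\<exists>U. open U \<and> 0 \<in> U \<and> E_Beurling \<omega> U f)"

definition property_D :: "((real^'n::finite \<Rightarrow> complex) \<Rightarrow> bool) \<Rightarrow> bool" where
  "property_D S \<longleftrightarrow> (\<forall>f j. j \<ge> (1::nat) \<and> S (\<lambda>x. f x ^ j) \<and> S (\<lambda>x. f x ^ (j + 1)) \<longrightarrow> S f)"

end

theory Submission
  imports Defs "HOL-Complex_Analysis.Complex_Analysis" "HOL-Real_Asymp.Real_Asymp"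
begin

text \<open>
  Along a segment let \<open>G\<close> and \<open>H\<close> be the Taylor polynomials of \<open>f ^ j\<close> and \<open>f ^ (j + 1)\<close> of
  order \<open>n = 4 * j * (j + 1) * k\<close>. Then \<open>G ^ (j + 1) - H ^ j\<close> vanishes to order \<open>n\<close> at 0, and
  \<open>f\<close> is close to \<open>H / G\<close> where \<open>G\<close> is not too small, and to 0 elsewhere. Cut a square into small
  cells and integrate the Cauchy kernel against \<open>H / G\<close> around the cells on which \<open>\<bar>G\<bar>\<close> is large. The
  edges between large and other cells contribute little: \<open>H / G\<close> is small on them, and every grid line
  carries only \<open>O(n)\<close> of them because \<open>\<bar>G\<bar>\<^sup>2\<close> is a polynomial on it. What remains is an integral over the boundary of the
  square, holomorphic inside, which approximates \<open>f\<close> at scale \<open>l\<close> up to \<open>(C * l\<^sup>2) ^ k\<close>. Telescoping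
  over dyadic scales bounds \<open>k\<close>-th divided differences of \<open>f\<close> on all segments of a suitable length.

  An identity of Kemperman converts these into mixed differences in the coordinate directions, and
  bounds on mixed differences of all orders force smoothness with the same bounds on the derivatives.
  The resulting factors \<open>C ^ k\<close> are absorbed by replacing \<open>\<rho>\<close> with \<open>L * \<rho>\<close>, where
  \<open>L\<close> does not depend on \<open>\<rho>\<close>; this serves the Roumieu and the Beurling class alike.
\<close>

section \<open>Weight functions\<close>

text \<open>Nothing is known about derivatives of \<open>f\<close>, and \<open>H / G\<close> has
  poles at the zeros of \<open>G\<close>. The threshold for \<open>\<bar>G\<bar>\<close> is
  \<open>r ^ j\<close>: since \<open>\<bar>f\<bar> ^ j\<close> is close to
  \<open>\<bar>G\<bar>\<close>, below it \<open>f\<close> and the admissible values of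
  \<open>H / G\<close> are only \<open>O(r)\<close>, so cutting the poles away costs no more than
  the approximation error.

  The square in \<open>(C * l\<^sup>2) ^ k\<close> is what makes telescoping converge. Two
  neighbouring approximations at scale \<open>l\<close> contribute to a divided difference with step
  \<open>\<alpha>\<close> about \<open>(C * l\<^sup>2) ^ k * (\<alpha> / l) ^ k = (C * \<alpha> * l)
  ^ k\<close>, and the surplus \<open>l ^ k\<close> sums geometrically over dyadic scales. An error
  \<open>(C * l) ^ k\<close> would leave one equal term for every scale.

  The Taylor order is \<open>N * k\<close> with \<open>N\<close> independent of \<open>k\<close>. If
  \<open>\<mu> ^ n\<close> is the weight of order \<open>n = N * k\<close>, the derivatives up to
  order \<open>n\<close> are bounded by powers of \<open>\<mu>\<close>, and the \<open>k\<close>-th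
  differences of \<open>f\<close> by \<open>\<mu> ^ k\<close>. In terms of \<open>phi_star\<close>
  this is the weight of order \<open>k\<close> for the parameter \<open>N * \<rho>\<close>, so the
  high Taylor order only multiplies \<open>\<rho>\<close> by a constant.\<close>

context
  fixes \<omega> :: "real \<Rightarrow> real"
  assumes \<omega>: "weight_function \<omega>"
begin

lemma weight_nonneg: "t \<ge> 0 \<Longrightarrow> \<omega> t \<ge> 0"
  using \<omega> by (auto simp: weight_function_def)

lemma weight_mono: "0 \<le> s \<Longrightarrow> s \<le> t \<Longrightarrow> \<omega> s \<le> \<omega> t"
  using \<omega> by (auto simp: weight_function_def mono_on_def)

text \<open>Little-o acts only beyond some \<open>T\<close>; below it monotonicity bounds
  \<open>\<omega>\<close> by a single value, which becomes \<open>K\<close>. The use is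
  \<open>\<epsilon> = \<rho>\<close> in the lower bound for the weights.\<close>

lemma weight_linear_bound:
  assumes "\<epsilon> > 0"
  shows "\<exists>K\<ge>0. \<forall>t\<ge>0. \<omega> t \<le> \<epsilon> * t + K"
proof -
  have "\<omega> \<in> o[at_top](\<lambda>t. t)"
    using \<omega> by (auto simp: weight_function_def)
  then have "eventually (\<lambda>t. norm (\<omega> t) \<le> \<epsilon> * norm t) at_top"
    using assms by (rule landau_o.smallD)
  then obtain T where T: "\<And>t. t \<ge> T \<Longrightarrow> \<bar>\<omega> t\<bar> \<le> \<epsilon> * \<bar>t\<bar>"
    by (auto simp: eventually_at_top_linorder)
  define T' where "T' = max 0 T"
  have "\<omega> t \<le> \<epsilon> * t + \<omega> T'" if "t \<ge> 0" for t
  proof (cases "t \<ge> T'")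
    case True
    then show ?thesis using T[of t] weight_nonneg[of T'] by (auto simp: T'_def)
  next
    case False
    then have "\<omega> t \<le> \<omega> T'" using weight_mono that by auto
    then show ?thesis using that assms by (auto intro: add_increasing)
  qed
  then show ?thesis using weight_nonneg[of T'] by (auto simp: T'_def)
qed

lemma weight_doubling: "\<exists>K\<ge>1. \<forall>t\<ge>0. \<omega> (2 * t) \<le> K * (\<omega> t + 1)"
proof -
  have "(\<lambda>t. \<omega> (2 * t)) \<in> O[at_top](\<omega>)"
    using \<omega> by (auto simp: weight_function_def)
  then obtain c where "c > 0" "eventually (\<lambda>t. norm (\<omega> (2 * t)) \<le> c * norm (\<omega> t)) at_top"
    by (rule landau_o.bigE)
  then obtain T where T: "\<And>t. t \<ge> T \<Longrightarrow> \<bar>\<omega> (2 * t)\<bar> \<le> c * \<bar>\<omega> t\<bar>"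
    by (auto simp: eventually_at_top_linorder)
  define T' where "T' = max 0 T"
  define K where "K = 1 + c + \<omega> (2 * T')"
  have nn: "\<omega> (2 * T') \<ge> 0" by (rule weight_nonneg) (simp add: T'_def)
  have "\<omega> (2 * t) \<le> K * (\<omega> t + 1)" if "t \<ge> 0" for t
  proof (cases "t \<ge> T'")
    case True
    have "\<omega> (2 * t) \<le> c * \<omega> t"
      using T[of t] True weight_nonneg[of t] that by (auto simp: T'_def)
    also have "\<dots> \<le> K * (\<omega> t + 1)"
      using \<open>c > 0\<close> nn weight_nonneg[OF that] by (intro mult_mono) (auto simp: K_def)
    finally show ?thesis .
  next
    case False
    then have "\<omega> (2 * t) \<le> \<omega> (2 * T')" using weight_mono that by auto
    also have "\<dots> \<le> K * 1" using \<open>c > 0\<close> by (simp add: K_def)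
    also have "\<dots> \<le> K * (\<omega> t + 1)"
      using weight_nonneg[OF that] nn \<open>c > 0\<close> by (intro mult_left_mono) (auto simp: K_def)
    finally show ?thesis .
  qed
  then show ?thesis using nn \<open>c > 0\<close> by (intro exI[of _ K]) (auto simp: K_def)
qed

lemma weight_dilation: "\<exists>L\<ge>1. \<forall>t\<ge>0. \<omega> (2 ^ m * t) \<le> L * (\<omega> t + 1)"
proof (induction m)
  case 0
  show ?case by (intro exI[of _ 1]) auto
next
  case (Suc m)
  then obtain L where L: "L \<ge> 1" "\<And>t. t \<ge> 0 \<Longrightarrow> \<omega> (2 ^ m * t) \<le> L * (\<omega> t + 1)" by blast
  obtain K where K: "K \<ge> 1" "\<And>t. t \<ge> 0 \<Longrightarrow> \<omega> (2 * t) \<le> K * (\<omega> t + 1)"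
    using weight_doubling by blast
  have "\<omega> (2 ^ Suc m * t) \<le> (K * (2 * L)) * (\<omega> t + 1)" if "t \<ge> 0" for t
  proof -
    have "\<omega> (2 ^ Suc m * t) \<le> K * (\<omega> (2 ^ m * t) + 1)"
      using K(2)[of "2 ^ m * t"] that by (simp add: mult.assoc)
    also have "\<dots> \<le> K * (L * (\<omega> t + 1) + L * (\<omega> t + 1))"
    proof (intro mult_left_mono add_mono)
      have "1 * 1 \<le> L * (\<omega> t + 1)"
        using L(1) weight_nonneg[OF that] by (intro mult_mono) auto
      then show "1 \<le> L * (\<omega> t + 1)" by simp
    qed (use K L that in auto)
    finally show ?thesis by (simp add: algebra_simps)
  qed
  moreover have "K * (2 * L) \<ge> 1"
    using mult_mono[of 1 K 1 "2 * L"] K(1) L(1) by auto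
  ultimately show ?case by blast
qed

text \<open>Since \<open>ln t\<close> is \<open>o(\<omega>)\<close>, the term \<open>s * t\<close>
  is eventually below \<open>\<omega> (exp t)\<close>. A \<open>SUP\<close> over an unbounded set of
  reals is an unspecified number, so every use of \<open>phi_star\<close> rests on this.\<close>

lemma phi_star_bdd: "bdd_above ((\<lambda>t. s * t - \<omega> (exp t)) ` {0..})"
proof -
  have "(\<lambda>t. ln t) \<in> o[at_top](\<omega>)"
    using \<omega> by (auto simp: weight_function_def)
  then have "eventually (\<lambda>t. norm (ln t) \<le> (1 / (\<bar>s\<bar> + 1)) * norm (\<omega> t)) at_top"
    by (rule landau_o.smallD) auto
  then obtain T where T: "\<And>t. t \<ge> T \<Longrightarrow> \<bar>ln t\<bar> \<le> (1 / (\<bar>s\<bar> + 1)) * \<bar>\<omega> t\<bar>"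
    by (auto simp: eventually_at_top_linorder)
  have "s * t - \<omega> (exp t) \<le> \<bar>s\<bar> * \<bar>T\<bar>" if "t \<ge> 0" for t
  proof (cases "t \<ge> T")
    case True
    have "t \<le> exp t" using exp_ge_add_one_self[of t] by linarith
    then have "\<bar>t\<bar> \<le> (1 / (\<bar>s\<bar> + 1)) * \<bar>\<omega> (exp t)\<bar>"
      using T[of "exp t"] True by simp
    then have "\<bar>t\<bar> * (\<bar>s\<bar> + 1) \<le> \<omega> (exp t)"
      using weight_nonneg[of "exp t"] by (simp add: field_simps)
    moreover have "s * t \<le> \<bar>t\<bar> * (\<bar>s\<bar> + 1)"
    proof -
      have "s * t \<le> \<bar>s\<bar> * \<bar>t\<bar>" by (metis abs_ge_self abs_mult)
      then show ?thesis by (simp add: algebra_simps)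
    qed
    moreover have "0 \<le> \<bar>s\<bar> * \<bar>T\<bar>" by simp
    ultimately show ?thesis by linarith
  next
    case False
    have "s * t \<le> \<bar>s\<bar> * \<bar>t\<bar>" by (metis abs_ge_self abs_mult)
    also have "\<dots> \<le> \<bar>s\<bar> * \<bar>T\<bar>" using False that by (intro mult_left_mono) auto
    finally show ?thesis using weight_nonneg[of "exp t"] by simp
  qed
  then show ?thesis by (auto intro!: bdd_aboveI)
qed

lemma phi_star_upper: "t \<ge> 0 \<Longrightarrow> s * t - \<omega> (exp t) \<le> phi_star \<omega> s"
  unfolding phi_star_def by (rule cSUP_upper[OF _ phi_star_bdd]) auto

lemma phi_star_least: "(\<And>t. t \<ge> 0 \<Longrightarrow> s * t - \<omega> (exp t) \<le> b) \<Longrightarrow> phi_star \<omega> s \<le> b"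
  unfolding phi_star_def by (rule cSUP_least) auto

text \<open>Holds because \<open>a * \<omega> \<le> \<omega>\<close>. This is the form of
  log-convexity of the weights that is needed: it compares the weights of orders
  \<open>m \<le> n\<close>, and those for two values of \<open>\<rho>\<close>.\<close>

lemma phi_star_scale:
  assumes "0 \<le> a" "a \<le> 1"
  shows "phi_star \<omega> (a * s) \<le> a * phi_star \<omega> s"
proof (rule phi_star_least)
  fix t :: real assume t: "t \<ge> 0"
  have "a * s * t - \<omega> (exp t) \<le> a * (s * t - \<omega> (exp t))"
    using mult_right_mono[OF assms(2) weight_nonneg[of "exp t"]] by (simp add: algebra_simps)
  also have "\<dots> \<le> a * phi_star \<omega> s"
    by (intro mult_left_mono phi_star_upper t assms)
  finally show "a * s * t - \<omega> (exp t) \<le> a * phi_star \<omega> s" .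
qed

lemma phi_star_div_mono:
  assumes "0 < \<rho>" "\<rho> \<le> \<rho>'"
  shows "phi_star \<omega> (\<rho> * s) / \<rho> \<le> phi_star \<omega> (\<rho>' * s) / \<rho>'"
proof -
  have "phi_star \<omega> (\<rho> / \<rho>' * (\<rho>' * s)) \<le> \<rho> / \<rho>' * phi_star \<omega> (\<rho>' * s)"
    using assms by (intro phi_star_scale) auto
  then show ?thesis using assms by (simp add: field_simps)
qed

text \<open>Shifting the variable of the supremum by \<open>m\<close> produces the term
  \<open>m * s\<close>, while \<open>\<omega>\<close> at the argument dilated by
  \<open>exp m \<le> 4 ^ m\<close> is at most \<open>L * (\<omega> + 1)\<close>. Dividing by
  \<open>L\<close> leaves the additive constant 1.\<close>

lemma phi_star_absorb:
  "\<exists>L\<ge>1. \<forall>s. real m * s + phi_star \<omega> s \<le> phi_star \<omega> (L * s) / L + 1"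
proof -
  obtain L where L: "L \<ge> 1" "\<And>t. t \<ge> 0 \<Longrightarrow> \<omega> (2 ^ (2 * m) * t) \<le> L * (\<omega> t + 1)"
    using weight_dilation by blast
  have e: "exp (real m) \<le> 2 ^ (2 * m)"
  proof -
    have "exp (real m) = exp 1 ^ m" by (simp flip: exp_of_nat_mult)
    also have "\<dots> \<le> (4::real) ^ m" using exp_le by (intro power_mono) auto
    finally show ?thesis by (simp add: power_mult)
  qed
  have "phi_star \<omega> s \<le> phi_star \<omega> (L * s) / L + 1 - real m * s" for s
  proof (rule phi_star_least)
    fix t :: real assume t: "t \<ge> 0"
    have "\<omega> (exp (t + m)) \<le> \<omega> (2 ^ (2 * m) * exp t)"
      by (rule weight_mono) (use e in \<open>auto simp: exp_add mult.commute\<close>)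
    also have "\<dots> \<le> L * (\<omega> (exp t) + 1)" by (rule L(2)) auto
    finally have "\<omega> (exp (t + m)) \<le> L * (\<omega> (exp t) + 1)" .
    moreover have "L * s * (t + m) - \<omega> (exp (t + m)) \<le> phi_star \<omega> (L * s)"
      by (rule phi_star_upper) (use t in auto)
    ultimately have "L * (s * t - \<omega> (exp t) + real m * s - 1) \<le> phi_star \<omega> (L * s)"
      by (simp add: algebra_simps)
    then have "s * t - \<omega> (exp t) + real m * s - 1 \<le> phi_star \<omega> (L * s) / L"
      using L(1) by (simp add: field_simps)
    then show "s * t - \<omega> (exp t) \<le> phi_star \<omega> (L * s) / L + 1 - real m * s" by linarith
  qed
  then show ?thesis using L(1) by (intro exI[of _ L]) (auto simp: algebra_simps)
qed

text \<open>\<open>L\<close> is chosen from \<open>C\<close> before \<open>\<rho>\<close>, and the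
  remaining loss \<open>exp (1 / \<rho>)\<close> does not depend on \<open>k\<close>. The Beurling
  case rests on this order of quantifiers.\<close>

lemma weight_sequence_absorb:
  assumes "C \<ge> 1"
  shows "\<exists>L\<ge>1. \<forall>\<rho>>0. \<forall>k. C ^ k * exp (phi_star \<omega> (\<rho> * real k) / \<rho>)
           \<le> exp (1 / \<rho>) * exp (phi_star \<omega> (L * \<rho> * real k) / (L * \<rho>))"
proof -
  obtain m :: nat where m: "ln C \<le> m" using real_arch_simple by blast
  obtain L where L: "L \<ge> 1" "\<And>s. real m * s + phi_star \<omega> s \<le> phi_star \<omega> (L * s) / L + 1"
    using phi_star_absorb[of m] by blast
  have "C ^ k * exp (phi_star \<omega> (\<rho> * real k) / \<rho>)
           \<le> exp (1 / \<rho>) * exp (phi_star \<omega> (L * \<rho> * real k) / (L * \<rho>))" if \<rho>: "\<rho> > 0" for \<rho> k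
  proof -
    have "C ^ k = exp (real k * ln C)" using assms by (simp add: exp_of_nat_mult)
    also have "\<dots> \<le> exp (real m * real k)"
      using mult_left_mono[OF m, of "real k"] by (simp add: mult.commute)
    finally have "C ^ k * exp (phi_star \<omega> (\<rho> * real k) / \<rho>) \<le>
        exp (real m * real k) * exp (phi_star \<omega> (\<rho> * real k) / \<rho>)"
      by (intro mult_right_mono) auto
    also have "\<dots> = exp (real m * real k + phi_star \<omega> (\<rho> * real k) / \<rho>)"
      by (simp add: exp_add)
    also have "\<dots> = exp ((real m * (\<rho> * real k) + phi_star \<omega> (\<rho> * real k)) / \<rho>)"
      using \<rho> by (simp add: add_divide_distrib)
    also have "\<dots> \<le> exp ((phi_star \<omega> (L * (\<rho> * real k)) / L + 1) / \<rho>)"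
      using L(2)[of "\<rho> * real k"] \<rho> by (simp add: divide_right_mono)
    also have "\<dots> = exp (1 / \<rho> + phi_star \<omega> (L * \<rho> * real k) / (L * \<rho>))"
      using \<rho> by (simp add: add_divide_distrib mult.assoc add.commute)
    finally show ?thesis by (simp add: exp_add)
  qed
  then show ?thesis using L(1) by blast
qed

text \<open>The supremum in \<open>phi_star\<close> is tested at \<open>t = ln n\<close>. That the
  weights dominate \<open>n ^ n\<close> up to a geometric factor later keeps the segments of the
  Taylor expansions bounded in length.\<close>

lemma weight_sequence_lower:
  assumes "\<rho> > 0"
  shows "\<exists>K\<ge>0. \<forall>n\<ge>1. real n ^ n \<le> exp (real n) * (exp K * exp (phi_star \<omega> (\<rho> * real n) / \<rho>))"
proof -
  obtain K where K: "K \<ge> 0" "\<And>t. t \<ge> 0 \<Longrightarrow> \<omega> t \<le> \<rho> * t + K"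
    using weight_linear_bound[OF assms] by blast
  have "real n ^ n \<le> exp (real n) * (exp (K / \<rho>) * exp (phi_star \<omega> (\<rho> * real n) / \<rho>))"
    if n: "n \<ge> 1" for n
  proof -
    have "\<rho> * real n * ln (real n) - \<omega> (exp (ln (real n))) \<le> phi_star \<omega> (\<rho> * real n)"
      by (rule phi_star_upper) (use n in auto)
    then have "\<rho> * real n * ln (real n) - \<rho> * real n - K \<le> phi_star \<omega> (\<rho> * real n)"
      using K(2)[of "real n"] n by simp
    then have "\<rho> * (real n * ln (real n)) \<le> \<rho> * real n + K + phi_star \<omega> (\<rho> * real n)"
      by (simp add: mult.assoc)
    then have "real n * ln (real n) \<le> (\<rho> * real n + K + phi_star \<omega> (\<rho> * real n)) / \<rho>"
      using assms by (simp add: field_simps)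
    then have "real n * ln (real n) \<le> real n + (K / \<rho> + phi_star \<omega> (\<rho> * real n) / \<rho>)"
      using assms by (simp add: add_divide_distrib)
    then have "exp (real n * ln (real n)) \<le> exp (real n + (K / \<rho> + phi_star \<omega> (\<rho> * real n) / \<rho>))"
      by simp
    then show ?thesis using n by (simp add: exp_of_nat_mult exp_add)
  qed
  then show ?thesis using K(1) assms by (intro exI[of _ "K / \<rho>"]) auto
qed

end

section \<open>Holomorphic approximation of a quotient of polynomials\<close>

text \<open>\<open>\<bar>q\<bar>\<^sup>2 - s\<^sup>2\<close> is a real polynomial of degree at most \<open>2 * n\<close> on the line.\<close>
lemma card_modulus_level_changes:
  fixes q :: "complex poly" and t :: "nat \<Rightarrow> real"
  assumes deg: "degree q \<le> n" and t: "strict_mono t" and s: "s \<ge> 0"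
  shows "card {i. i < N \<and> (cmod (poly q (of_real (t i))) \<le> s) \<noteq>
                            (cmod (poly q (of_real (t (Suc i)))) \<le> s)} \<le> 4 * n"
    (is "card ?S \<le> _")
proof -
  define g where "g x = (cmod (poly q (of_real x)))\<^sup>2 - s\<^sup>2" for x :: real
  define p where "p = q * map_poly cnj q - [:of_real (s\<^sup>2):]"
  have pg: "poly p (of_real x) = of_real (g x)" for x
  proof -
    have "poly (map_poly cnj q) (of_real x) = cnj (poly q (of_real x))"
      using poly_cnj[of q "of_real x"] by (simp only: complex_cnj_complex_of_real)
    then have "poly p (of_real x) =
        poly q (of_real x) * cnj (poly q (of_real x)) - of_real (s\<^sup>2)"
      unfolding p_def by (simp only: poly_mult poly_diff poly_pCons poly_0 mult_zero_right add_0_right)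
    also have "\<dots> = of_real (g x)"
      unfolding g_def by (simp only: of_real_diff complex_norm_square[symmetric])
    finally show ?thesis .
  qed
  have sel: "cmod (poly q (of_real x)) \<le> s \<longleftrightarrow> g x \<le> 0" for x
    unfolding g_def using s power_mono_iff[of "cmod (poly q (of_real x))" s 2] by simp
  have contg: "continuous_on X g" for X
    unfolding g_def by (intro continuous_intros)
  define S where "S = ?S"
  have "card S \<le> 4 * n"
  \<comment> \<open>If \<open>p = 0\<close>, the modulus equals \<open>s\<close> on the whole line
    and never changes side.\<close>
  proof (cases "p = 0")
    case True
    then have "g x = 0" for x using pg[of x] by simp
    then have "S = {}" by (simp add: S_def sel)
    then show "card S \<le> 4 * n" by simp
  next
    case False
    have "degree p \<le> 2 * n"
      unfolding p_def
    proof (intro degree_diff_le)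
      show "degree (q * map_poly cnj q) \<le> 2 * n"
        using degree_mult_le[of q "map_poly cnj q"] deg map_poly_degree_leq[of cnj q] by linarith
    qed auto
    then have card_roots: "card {x. poly p x = 0} \<le> 2 * n"
      using card_poly_roots_bound[OF False] by linarith
    have fin: "finite {x. poly p x = 0}" using False by (rule poly_roots_finite)
    have "\<exists>x. t i \<le> x \<and> x \<le> t (Suc i) \<and> g x = 0" if "i \<in> S" for i
    proof -
      have le: "t i \<le> t (Suc i)" using t by (simp add: strict_mono_less_eq)
      have "(g (t i) \<le> 0 \<and> 0 \<le> g (t (Suc i))) \<or> (g (t (Suc i)) \<le> 0 \<and> 0 \<le> g (t i))"
        using that unfolding S_def mem_Collect_eq sel by linarith
      then show ?thesis
      proof
        assume "g (t i) \<le> 0 \<and> 0 \<le> g (t (Suc i))"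
        then show ?thesis using IVT'[of g "t i" 0 "t (Suc i)", OF _ _ le contg] by auto
      next
        assume "g (t (Suc i)) \<le> 0 \<and> 0 \<le> g (t i)"
        then show ?thesis using IVT2'[of g "t (Suc i)" 0 "t i", OF _ _ le contg] by auto
      qed
    qed
    then have "\<forall>i\<in>S. \<exists>x. t i \<le> x \<and> x \<le> t (Suc i) \<and> g x = 0" by blast
    then obtain \<rho> where \<rho>: "\<And>i. i \<in> S \<Longrightarrow> t i \<le> \<rho> i \<and> \<rho> i \<le> t (Suc i) \<and> g (\<rho> i) = 0"
      using bchoice[of S "\<lambda>i x. t i \<le> x \<and> x \<le> t (Suc i) \<and> g x = 0"] by blast
    \<comment> \<open>A root belonging to two different intervals forces them to be neighbours.
      Within one parity class the chosen roots are therefore distinct, and treating the two classes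
      separately doubles \<open>2 * n\<close>.\<close>
    have close: "i' \<le> Suc i" if "i \<in> S" "i' \<in> S" "\<rho> i = \<rho> i'" for i i'
    proof -
      have "t i' \<le> t (Suc i)" using \<rho>[OF that(1)] \<rho>[OF that(2)] that(3) by linarith
      then show ?thesis using t by (simp add: strict_mono_less_eq)
    qed
    have part: "card {i \<in> S. Q i} \<le> 2 * n"
      if Q: "\<And>i i'. Q i \<Longrightarrow> Q i' \<Longrightarrow> i \<le> Suc i' \<Longrightarrow> i' \<le> Suc i \<Longrightarrow> i = i'" for Q
    proof -
      have "inj_on (\<lambda>i. complex_of_real (\<rho> i)) {i \<in> S. Q i}"
      proof (rule inj_onI)
        fix a b assume "a \<in> {i \<in> S. Q i}" "b \<in> {i \<in> S. Q i}"
          "complex_of_real (\<rho> a) = complex_of_real (\<rho> b)"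
        then show "a = b" using close[of a b] close[of b a] Q[of a b] by simp
      qed
      moreover have "(\<lambda>i. complex_of_real (\<rho> i)) ` {i \<in> S. Q i} \<subseteq> {x. poly p x = 0}"
        using \<rho> by (auto simp: pg)
      ultimately show ?thesis
        using card_inj_on_le[OF _ _ fin] card_roots le_trans by blast
    qed
    have "card S = card ({i \<in> S. even i} \<union> {i \<in> S. odd i})"
      by (rule arg_cong[of _ _ card]) blast
    also have "\<dots> \<le> card {i \<in> S. even i} + card {i \<in> S. odd i}"
      by (rule card_Un_le)
    also have "\<dots> \<le> 2 * n + 2 * n"
    proof (intro add_mono part)
      fix i i' :: nat
      assume "even i" "even i'" "i \<le> Suc i'" "i' \<le> Suc i"
      then show "i = i'" by presburger
    next
      fix i i' :: nat
      assume "odd i" "odd i'" "i \<le> Suc i'" "i' \<le> Suc i"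
      then show "i = i'" by presburger
    qed
    finally show "card S \<le> 4 * n" by simp
  qed
  then show ?thesis by (simp only: S_def)
qed

text \<open>Opposite sides are parametrised in the same direction, so that the edge shared by two
  adjacent cells gives both the same integral and only the sign differs.\<close>

lemma contour_integral_rectpath:
  assumes "continuous_on (path_image (rectpath a c)) f"
  shows "contour_integral (rectpath a c) f =
     contour_integral (linepath a (Complex (Re c) (Im a))) f
   + contour_integral (linepath (Complex (Re c) (Im a)) c) f
   - contour_integral (linepath (Complex (Re a) (Im c)) c) f
   - contour_integral (linepath a (Complex (Re a) (Im c))) f"
proof -
  define b where "b = Complex (Re c) (Im a)"
  define d where "d = Complex (Re a) (Im c)"
  have rp: "rectpath a c = linepath a b +++ linepath b c +++ linepath c d +++ linepath d a"
    by (simp add: rectpath_def Let_def b_def d_def)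
  have cont: "continuous_on (closed_segment a b) f" "continuous_on (closed_segment b c) f"
    "continuous_on (closed_segment c d) f" "continuous_on (closed_segment d a) f"
    using assms by (auto simp: rp path_image_join elim!: continuous_on_subset)
  note int = contour_integrable_continuous_linepath
  have "contour_integral (rectpath a c) f =
     contour_integral (linepath a b) f + contour_integral (linepath b c) f
   + contour_integral (linepath c d) f + contour_integral (linepath d a) f"
    using cont by (simp add: rp int)
  moreover have "contour_integral (linepath c d) f = - contour_integral (linepath d c) f"
    using contour_integral_reverse_linepath[of d c f] cont by (simp add: closed_segment_commute)
  moreover have "contour_integral (linepath d a) f = - contour_integral (linepath a d) f"
    using contour_integral_reverse_linepath[of a d f] cont by (simp add: closed_segment_commute)
  ultimately show ?thesis by (simp add: b_def d_def)
qed

text \<open>Abel summation; it moves the differences from the edge integrals to the indicators of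
  the large cells.\<close>

lemma sum_mult_diff_Suc:
  fixes u h :: "nat \<Rightarrow> 'a::comm_ring"
  shows "(\<Sum>k<Suc M. u k * (h k - h (Suc k))) =
         u 0 * h 0 - u M * h (Suc M) + (\<Sum>k<M. (u (Suc k) - u k) * h (Suc k))"
  by (induction M) (simp_all add: algebra_simps)

lemma harm_le_ln: "n \<ge> 1 \<Longrightarrow> harm n \<le> 1 + ln (real n)"
proof (induction n rule: dec_induct)
  case base
  show ?case by (simp add: harm_expand)
next
  case (step n)
  have "ln (1 + - (1 / (real n + 1))) \<le> - (1 / (real n + 1))"
    by (rule ln_add_one_self_le_self2) (use step in \<open>simp add: field_simps\<close>)
  moreover have "1 + - (1 / (real n + 1)) = real n / (real n + 1)" by (simp add: field_simps)
  ultimately have "ln (real n) - ln (real n + 1) \<le> - (1 / (real n + 1))"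
    using step by (simp add: ln_div)
  then have "1 / (real n + 1) \<le> ln (real (Suc n)) - ln (real n)" by (simp add: algebra_simps)
  then show ?case using step by (simp add: harm_Suc inverse_eq_divide algebra_simps)
qed

text \<open>Edges in row or column \<open>i\<close> are at distance about
  \<open>\<bar>i - m\<bar> / N\<close> from the point of evaluation. This sum is the source of the
  logarithm of \<open>N\<close> in the error.\<close>

lemma sum_inverse_distance:
  assumes "m < N"
  shows "(\<Sum>i<N. 1 / (1 + \<bar>real i - real m\<bar>)) \<le> 2 * (1 + ln (real N))"
proof -
  have split: "{..<N} = {..m} \<union> {m<..<N}" using assms by auto
  have "(\<Sum>i<N. 1 / (1 + \<bar>real i - real m\<bar>)) =
     (\<Sum>i\<le>m. 1 / (1 + \<bar>real i - real m\<bar>)) + (\<Sum>i\<in>{m<..<N}. 1 / (1 + \<bar>real i - real m\<bar>))"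
    unfolding split by (rule sum.union_disjoint) auto
  also have "(\<Sum>i\<le>m. 1 / (1 + \<bar>real i - real m\<bar>)) = (\<Sum>k<Suc m. inverse (real (Suc k)))"
    by (rule sum.reindex_bij_witness[of _ "\<lambda>k. m - k" "\<lambda>k. m - k"])
       (auto simp: of_nat_diff inverse_eq_divide)
  also have "(\<Sum>i\<in>{m<..<N}. 1 / (1 + \<bar>real i - real m\<bar>)) \<le> (\<Sum>k<N. inverse (real (Suc k)))"
  proof -
    have "(\<Sum>i\<in>{m<..<N}. 1 / (1 + \<bar>real i - real m\<bar>)) = (\<Sum>k\<in>{0<..<N-m}. inverse (real (Suc k)))"
      by (rule sum.reindex_bij_witness[of _ "\<lambda>k. k + m" "\<lambda>k. k - m"])
         (auto simp: of_nat_diff inverse_eq_divide)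
    also have "\<dots> \<le> (\<Sum>k<N. inverse (real (Suc k)))"
      by (rule sum_mono2) auto
    finally show ?thesis .
  qed
  also have "(\<Sum>k<Suc m. inverse (real (Suc k))) \<le> (\<Sum>k<N. inverse (real (Suc k)))"
    by (rule sum_mono2) (use assms in auto)
  finally have "(\<Sum>i<N. 1 / (1 + \<bar>real i - real m\<bar>)) \<le> 2 * harm N"
    by (simp add: harm_altdef)
  moreover have "harm N \<le> 1 + ln (real N)" by (rule harm_le_ln) (use assms in linarith)
  ultimately show ?thesis by (meson mult_left_mono order_trans zero_le_numeral)
qed

text \<open>The situation at unit scale, with one \<open>A\<close> for sup norms and Lipschitz
  constants. The threshold is \<open>s = r ^ j\<close> because \<open>\<bar>G\<bar>\<close> is
  comparable to the \<open>j\<close>-th power of the quotient. \<open>N\<close> is so large that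
  between the centre of a cell and its other points \<open>G\<close> varies by at most
  \<open>s / 4\<close>, and the quotient, where \<open>\<bar>G\<bar> \<ge> s / 2\<close>, by at most
  \<open>r\<close>.\<close>

locale grid_division =
  fixes G H :: "complex poly" and n j N :: nat and A r s :: real
  assumes deg: "degree G \<le> n" and n: "n \<ge> 1" and j: "j \<ge> 1" and A: "A \<ge> 1"
    and r: "0 < r" "r \<le> 1" and s_def: "s = r ^ j"
    and Gb: "\<And>z. cmod z \<le> 1 \<Longrightarrow> cmod (poly G z) \<le> A"
    and Hb: "\<And>z. cmod z \<le> 1 \<Longrightarrow> cmod (poly H z) \<le> A"
    and GL: "\<And>z w. cmod z \<le> 1 \<Longrightarrow> cmod w \<le> 1 \<Longrightarrow> cmod (poly G z - poly G w) \<le> A * cmod (z - w)"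
    and HL: "\<And>z w. cmod z \<le> 1 \<Longrightarrow> cmod w \<le> 1 \<Longrightarrow> cmod (poly H z - poly H w) \<le> A * cmod (z - w)"
    and GH: "\<And>z. cmod z \<le> 1 \<Longrightarrow> cmod (poly G z ^ (j + 1) - poly H z ^ j) \<le> r ^ (j * (j + 1))"
    and N: "64 * A\<^sup>2 / s ^ 3 \<le> real N"
begin

section \<open>The quotient on a grid of cells\<close>

definition quot :: "complex \<Rightarrow> complex" where "quot z = poly H z / poly G z"

definition node :: "nat \<Rightarrow> nat \<Rightarrow> complex" where
  "node i k = Complex (real i / real N - 1 / 2) (real k / real N - 1 / 2)"

definition centre :: "nat \<Rightarrow> nat \<Rightarrow> complex" where
  "centre i k = Complex ((real i + 1 / 2) / real N - 1 / 2) ((real k + 1 / 2) / real N - 1 / 2)"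

definition cell :: "nat \<Rightarrow> nat \<Rightarrow> complex set" where
  "cell i k = cbox (node i k) (node (Suc i) (Suc k))"

text \<open>Decided by the centre alone: the changes along a row or column of centres are then level
  changes of one polynomial on a line and can be counted.\<close>

definition large :: "nat \<Rightarrow> nat \<Rightarrow> bool" where
  "large i k \<longleftrightarrow> \<not> cmod (poly G (centre i k)) \<le> s"

lemma s_bounds: "0 < s" "s \<le> 1" "s \<le> r"
  using r j power_decreasing[of 1 j r] by (auto simp: s_def power_le_one)

lemma N_ge: "64 * A \<le> real N" "64 * A\<^sup>2 \<le> real N * s ^ 2" "64 * A\<^sup>2 \<le> real N * s" "real N \<ge> 64"
proof -
  have *: "64 * A\<^sup>2 \<le> real N * s ^ 3" using N s_bounds by (simp add: field_simps)
  have s3: "s ^ 3 \<le> s ^ 2" "s ^ 2 \<le> s ^ 1" using s_bounds by (intro power_decreasing; simp)+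
  have "real N * s ^ 3 \<le> real N * s ^ 2" using s3 by (intro mult_left_mono) auto
  with * show 1: "64 * A\<^sup>2 \<le> real N * s ^ 2" by linarith
  have "real N * s ^ 2 \<le> real N * s ^ 1" using s3 by (intro mult_left_mono) auto
  with 1 show 2: "64 * A\<^sup>2 \<le> real N * s" by simp
  have "real N * s \<le> real N" using s_bounds by (simp add: mult_left_le)
  moreover have "A \<le> A\<^sup>2" using A by (simp add: power2_eq_square)
  ultimately show "64 * A \<le> real N" using 2 by linarith
  then show "real N \<ge> 64" using A by linarith
qed

lemma N_pos: "N > 0" "real N > 0"
  using N_ge(4) by (auto intro: Nat.gr0I)

lemma in_cell:
  "z \<in> cell i k \<longleftrightarrow> real i / N - 1 / 2 \<le> Re z \<and> Re z \<le> (real i + 1) / N - 1 / 2 \<and>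
                     real k / N - 1 / 2 \<le> Im z \<and> Im z \<le> (real k + 1) / N - 1 / 2"
  by (auto simp: cell_def node_def in_cbox_complex_iff add.commute)

lemma half_step: "(real i + 1) / N = real i / N + 1 / N" "(real i + 1 / 2) / N = real i / N + 1 / N / 2"
  using N_pos by (auto simp: field_simps)

lemma centre_in_cell: "centre i k \<in> cell i k"
proof -
  define x y h where "x = real i / N" and "y = real k / N" and "h = 1 / real N"
  have "h > 0" using N_pos by (simp add: h_def)
  then show ?thesis
    unfolding in_cell centre_def half_step complex.sel x_def[symmetric] y_def[symmetric] h_def[symmetric]
    by linarith
qed

lemma dist_centre:
  assumes "z \<in> cell i k"
  shows "cmod (z - centre i k) \<le> 1 / N"
proof -
  define x y h where "x = real i / N" and "y = real k / N" and "h = 1 / real N"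
  have "h > 0" using N_pos by (simp add: h_def)
  have "\<bar>Re (z - centre i k)\<bar> \<le> h / 2" "\<bar>Im (z - centre i k)\<bar> \<le> h / 2"
    using assms
    unfolding in_cell centre_def half_step complex.sel minus_complex.sel x_def[symmetric] y_def[symmetric] h_def[symmetric]
    by linarith+
  then show ?thesis using cmod_le[of "z - centre i k"] by (simp add: h_def)
qed

lemma cell_norm:
  assumes "i < N" "k < N" "z \<in> cell i k"
  shows "\<bar>Re z\<bar> \<le> 1 / 2" "\<bar>Im z\<bar> \<le> 1 / 2" "cmod z \<le> 1"
proof -
  have *: "0 \<le> real i / N" "0 \<le> real k / N" "(real i + 1) / N \<le> 1" "(real k + 1) / N \<le> 1"
    using assms N_pos by (auto simp: field_simps)
  show 1: "\<bar>Re z\<bar> \<le> 1 / 2" and 2: "\<bar>Im z\<bar> \<le> 1 / 2"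
    using assms(3) * unfolding in_cell by linarith+
  show "cmod z \<le> 1" using cmod_le[of z] 1 2 by linarith
qed

lemma G_near_centre:
  assumes "i < N" "k < N" "z \<in> cell i k"
  shows "cmod (poly G z - poly G (centre i k)) \<le> s / 4"
proof -
  have "cmod (poly G z - poly G (centre i k)) \<le> A * (1 / N)"
    using GL[OF cell_norm(3)[OF assms] cell_norm(3)[OF assms(1,2) centre_in_cell]]
      dist_centre[OF assms(3)] A
    by (meson mult_left_mono order_trans zero_le_one)
  also have "\<dots> \<le> s / 4"
  proof -
    have "A \<le> A\<^sup>2" using A by (simp add: power2_eq_square)
    then have "4 * A \<le> real N * s" using N_ge(3) A by linarith
    then show ?thesis using N_pos by (simp add: field_simps)
  qed
  finally show ?thesis .
qed

lemma G_lower: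
  assumes "i < N" "k < N" "z \<in> cell i k" "large i k"
  shows "cmod (poly G z) \<ge> 3 / 4 * s" "poly G z \<noteq> 0"
proof -
  show "cmod (poly G z) \<ge> 3 / 4 * s"
    using G_near_centre[OF assms(1-3)] assms(4) norm_triangle_ineq2[of "poly G (centre i k)" "poly G z"]
    by (auto simp: large_def norm_minus_commute)
  then show "poly G z \<noteq> 0" using s_bounds by auto
qed

lemma G_upper:
  assumes "i < N" "k < N" "z \<in> cell i k" "\<not> large i k"
  shows "cmod (poly G z) \<le> 5 / 4 * s"
  using G_near_centre[OF assms(1-3)] assms(4) norm_triangle_ineq2[of "poly G z" "poly G (centre i k)"]
  by (auto simp: large_def)

text \<open>That \<open>G ^ (j + 1)\<close> is close to \<open>H ^ j\<close> says that the
  \<open>j\<close>-th power of \<open>H / G\<close> is close to \<open>G\<close>. The error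
  \<open>s ^ (j + 1)\<close>, divided by \<open>\<bar>G\<bar> ^ j\<close>, stays below
  \<open>2 ^ j * s\<close>.\<close>

lemma quot_power:
  assumes z: "cmod z \<le> 1" and G: "cmod (poly G z) \<ge> s / 2"
  shows "cmod (quot z) ^ j \<le> cmod (poly G z) + 2 ^ j * s"
proof -
  define a where "a = cmod (poly G z)"
  have a: "a > 0" "s \<le> 2 * a" using G s_bounds by (auto simp: a_def)
  have "cmod (poly H z) ^ j \<le> a ^ (j + 1) + r ^ (j * (j + 1))"
    using GH[OF z] norm_triangle_ineq3[of "poly G z ^ (j + 1)" "poly H z ^ j"]
    by (simp add: norm_power norm_mult a_def)
  then have "cmod (poly H z) ^ j \<le> a ^ (j + 1) + s ^ (j + 1)"
    by (simp only: s_def power_mult)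
  also have "s ^ (j + 1) \<le> (2 ^ j * s) * a ^ j"
  proof -
    have "s ^ j \<le> (2 * a) ^ j" using a s_bounds by (intro power_mono) auto
    then have "s * s ^ j \<le> s * (2 * a) ^ j" using s_bounds by (intro mult_left_mono) auto
    then show ?thesis by (simp add: power_mult_distrib algebra_simps)
  qed
  finally have "cmod (poly H z) ^ j \<le> (a + 2 ^ j * s) * a ^ j" by (simp add: algebra_simps)
  then have "cmod (poly H z) ^ j / a ^ j \<le> a + 2 ^ j * s" using a by (simp add: field_simps)
  then show ?thesis by (simp add: quot_def norm_divide power_divide a_def)
qed

text \<open>Brings the constants of \<open>quot_power\<close> below \<open>j\<close>-th powers, so
  that a \<open>j\<close>-th root can be taken.\<close>

lemma power_le_four: "1 + 2 ^ j \<le> (4::real) ^ j" "3 + 2 ^ j \<le> (8::real) ^ j"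
proof -
  have "1 + 2 ^ j \<le> (4::real) ^ j \<and> 3 + 2 ^ j \<le> (8::real) ^ j"
    using j
  proof (induction j rule: dec_induct)
    case (step m)
    have "(0::real) \<le> 4 ^ m" "(0::real) \<le> 8 ^ m" by simp_all
    with step show ?case unfolding power_Suc by linarith
  qed auto
  then show "1 + 2 ^ j \<le> (4::real) ^ j" "3 + 2 ^ j \<le> (8::real) ^ j" by auto
qed

lemma quot_bound:
  assumes z: "cmod z \<le> 1" and G: "cmod (poly G z) \<ge> s / 2"
  shows "cmod (quot z) \<le> 4 * A"
proof -
  have "cmod (quot z) ^ j \<le> A + 2 ^ j * A"
  proof (rule order_trans[OF quot_power[OF z G]], intro add_mono mult_left_mono)
    show "s \<le> A" using s_bounds A by linarith
  qed (use Gb[OF z] in auto)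
  also have "\<dots> = (1 + 2 ^ j) * A" by (simp add: algebra_simps)
  also have "\<dots> \<le> 4 ^ j * A ^ j"
  proof (intro mult_mono power_le_four)
    show "A \<le> A ^ j" using A j by (simp add: self_le_power)
  qed (use A in auto)
  finally have "cmod (quot z) ^ j \<le> (4 * A) ^ j" by (simp add: power_mult_distrib)
  then show ?thesis using A j power_mono_iff[of "cmod (quot z)" "4 * A" j] by simp
qed

text \<open>This makes it affordable to cut away the zeros of \<open>G\<close>: the cut runs along
  edges on which \<open>\<bar>G\<bar>\<close> is comparable to \<open>s\<close>.\<close>

lemma quot_small:
  assumes z: "cmod z \<le> 1" and G: "cmod (poly G z) \<ge> s / 2" "cmod (poly G z) \<le> 3 * s"
  shows "cmod (quot z) \<le> 8 * r"
proof -
  have "cmod (quot z) ^ j \<le> 3 * s + 2 ^ j * s" using quot_power[OF z G(1)] G(2) by linarith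
  also have "\<dots> = (3 + 2 ^ j) * s" by (simp add: algebra_simps)
  also have "\<dots> \<le> 8 ^ j * s" using s_bounds by (intro mult_right_mono power_le_four) auto
  finally have "cmod (quot z) ^ j \<le> (8 * r) ^ j" by (simp add: power_mult_distrib s_def)
  then show ?thesis using r j power_mono_iff[of "cmod (quot z)" "8 * r" j] by simp
qed

text \<open>The denominator contributes \<open>s\<^sup>2\<close>, and a further factor
  \<open>s \<le> r\<close> brings the bound below \<open>r\<close>; hence the cube of
  \<open>s\<close> in the lower bound for \<open>N\<close>.\<close>

lemma quot_lipschitz:
  assumes z: "cmod z \<le> 1" "cmod (poly G z) \<ge> s / 2" and w: "cmod w \<le> 1" "cmod (poly G w) \<ge> s / 2"
    and zw: "cmod (z - w) \<le> 1 / N"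
  shows "cmod (quot z - quot w) \<le> r"
proof -
  have nz: "poly G z \<noteq> 0" "poly G w \<noteq> 0" using z w s_bounds by auto
  have "quot z - quot w = (poly H z * poly G w - poly H w * poly G z) / (poly G z * poly G w)"
    using nz by (simp add: quot_def field_simps)
  also have "poly H z * poly G w - poly H w * poly G z =
     (poly H z - poly H w) * poly G w - poly H w * (poly G z - poly G w)" by (simp add: algebra_simps)
  finally have "cmod (quot z - quot w) = cmod ((poly H z - poly H w) * poly G w - poly H w * (poly G z - poly G w))
      / (cmod (poly G z) * cmod (poly G w))" by (simp add: norm_divide norm_mult)
  also have "\<dots> \<le> (A * (1 / N) * A + A * (A * (1 / N))) / ((s / 2) * (s / 2))"
  proof (rule frac_le)
    show "cmod ((poly H z - poly H w) * poly G w - poly H w * (poly G z - poly G w)) \<le> A * (1 / N) * A + A * (A * (1 / N))"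
    proof (rule order_trans[OF norm_triangle_ineq4], unfold norm_mult, intro add_mono mult_mono)
      show "cmod (poly H z - poly H w) \<le> A * (1 / N)"
        using HL[OF z(1) w(1)] zw A by (meson mult_left_mono order_trans zero_le_one)
      show "cmod (poly G z - poly G w) \<le> A * (1 / N)"
        using GL[OF z(1) w(1)] zw A by (meson mult_left_mono order_trans zero_le_one)
    qed (use Gb[OF w(1)] Hb[OF w(1)] A in auto)
    show "s / 2 * (s / 2) \<le> cmod (poly G z) * cmod (poly G w)"
      using z w s_bounds by (intro mult_mono) auto
  qed (use A s_bounds in auto)
  also have "\<dots> \<le> r"
  proof -
    have "64 * A\<^sup>2 \<le> real N * s ^ 3" using N s_bounds by (simp add: field_simps)
    also have "\<dots> \<le> real N * (r * s ^ 2)"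
      using s_bounds by (intro mult_left_mono) (auto simp: power3_eq_cube power2_eq_square)
    finally have "8 * A\<^sup>2 \<le> real N * (r * s ^ 2)" using zero_le_power2[of A] by linarith
    then show ?thesis using s_bounds N_pos by (simp add: field_simps power2_eq_square)
  qed
  finally show ?thesis .
qed

lemma cell_edges:
  "closed_segment (node i k) (node (Suc i) k) \<subseteq> cell i k"
  "closed_segment (node i k) (node i (Suc k)) \<subseteq> cell i k"
  "closed_segment (node i (Suc k)) (node (Suc i) (Suc k)) \<subseteq> cell i k"
  "closed_segment (node (Suc i) k) (node (Suc i) (Suc k)) \<subseteq> cell i k"
proof -
  have "node i k \<in> cell i k" "node (Suc i) k \<in> cell i k" "node i (Suc k) \<in> cell i k"
    "node (Suc i) (Suc k) \<in> cell i k"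
    using N_pos by (auto simp: in_cell node_def divide_right_mono add.commute)
  moreover have "convex (cell i k)" by (simp add: cell_def)
  ultimately show "closed_segment (node i k) (node (Suc i) k) \<subseteq> cell i k"
  "closed_segment (node i k) (node i (Suc k)) \<subseteq> cell i k"
  "closed_segment (node i (Suc k)) (node (Suc i) (Suc k)) \<subseteq> cell i k"
  "closed_segment (node (Suc i) k) (node (Suc i) (Suc k)) \<subseteq> cell i k"
    by (simp_all add: closed_segment_subset)
qed

lemma horizontal_edge:
  "z \<in> closed_segment (node i k) (node (Suc i) k) \<Longrightarrow>
     Im z = real k / N - 1 / 2 \<and> real i / N - 1 / 2 \<le> Re z \<and> Re z \<le> (real i + 1) / N - 1 / 2"
  using closed_segment_same_Im[of "node i k" "node (Suc i) k"] N_pos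
  by (auto simp: node_def closed_segment_eq_real_ivl divide_right_mono add.commute split: if_splits)

lemma vertical_edge:
  "z \<in> closed_segment (node i k) (node i (Suc k)) \<Longrightarrow>
     Re z = real i / N - 1 / 2 \<and> real k / N - 1 / 2 \<le> Im z \<and> Im z \<le> (real k + 1) / N - 1 / 2"
  using closed_segment_same_Re[of "node i k" "node i (Suc k)"] N_pos
  by (auto simp: node_def closed_segment_eq_real_ivl divide_right_mono add.commute split: if_splits)

lemma edge_length: "cmod (node (Suc i) k - node i k) = 1 / N" "cmod (node i (Suc k) - node i k) = 1 / N"
  using N_pos by (auto simp: node_def cmod_def complex_diff add_divide_distrib)

section \<open>Cauchy integrals over the boundaries of cells\<close>

definition hor :: "nat \<Rightarrow> nat \<Rightarrow> complex \<Rightarrow> complex" where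
  "hor i k c = contour_integral (linepath (node i k) (node (Suc i) k)) (\<lambda>\<zeta>. quot \<zeta> / (\<zeta> - c))"

definition ver :: "nat \<Rightarrow> nat \<Rightarrow> complex \<Rightarrow> complex" where
  "ver i k c = contour_integral (linepath (node i k) (node i (Suc k))) (\<lambda>\<zeta>. quot \<zeta> / (\<zeta> - c))"

lemma quot_holomorphic: "i < N \<Longrightarrow> k < N \<Longrightarrow> large i k \<Longrightarrow> quot holomorphic_on cell i k"
  unfolding quot_def using G_lower(2) by (intro holomorphic_intros) auto

lemma interior_cell:
  "z \<in> interior (cell i k) \<longleftrightarrow> real i / N - 1 / 2 < Re z \<and> Re z < (real i + 1) / N - 1 / 2 \<and>
                     real k / N - 1 / 2 < Im z \<and> Im z < (real k + 1) / N - 1 / 2"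
  by (auto simp: cell_def node_def in_box_complex_iff add.commute)

lemma centre_in_interior: "centre i k \<in> interior (cell i k)"
proof -
  define x y h where "x = real i / N" and "y = real k / N" and "h = 1 / real N"
  have "h > 0" using N_pos by (simp add: h_def)
  then show ?thesis
    unfolding interior_cell centre_def half_step complex.sel x_def[symmetric] y_def[symmetric] h_def[symmetric]
    by linarith
qed

lemma centre_in_cell_iff: "centre a b \<in> cell i k \<longleftrightarrow> a = i \<and> b = k"
proof
  assume "centre a b \<in> cell i k"
  then have "real i / N \<le> (real a + 1 / 2) / N" "(real a + 1 / 2) / N \<le> (real i + 1) / N"
    "real k / N \<le> (real b + 1 / 2) / N" "(real b + 1 / 2) / N \<le> (real k + 1) / N"
    by (auto simp: in_cell centre_def)
  then have "real i \<le> real a + 1 / 2" "real a + 1 / 2 \<le> real i + 1"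
    "real k \<le> real b + 1 / 2" "real b + 1 / 2 \<le> real k + 1"
    using N_pos by (auto simp: divide_le_cancel)
  then show "a = i \<and> b = k" by linarith
qed (use centre_in_cell in auto)

text \<open>Cauchy's formula if the pole is the centre of this very cell, Cauchy's theorem
  otherwise. Evaluating only at centres keeps the pole off all grid lines.\<close>

lemma cell_boundary_integral:
  assumes ik: "i < N" "k < N" "large i k"
  shows "hor i k (centre a b) - hor i (Suc k) (centre a b) + (ver (Suc i) k (centre a b) - ver i k (centre a b))
         = (if a = i \<and> b = k then 2 * pi * \<i> * quot (centre a b) else 0)"
proof -
  define c where "c = centre a b"
  define F where "F = (\<lambda>\<zeta>. quot \<zeta> / (\<zeta> - c))"
  define \<gamma> where "\<gamma> = rectpath (node i k) (node (Suc i) (Suc k))"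
  have le: "Re (node i k) \<le> Re (node (Suc i) (Suc k))" "Im (node i k) \<le> Im (node (Suc i) (Suc k))"
    using N_pos by (auto simp: node_def divide_right_mono)
  have lt: "Re (node i k) < Re (node (Suc i) (Suc k))" "Im (node i k) < Im (node (Suc i) (Suc k))"
    using N_pos by (auto simp: node_def divide_strict_right_mono)
  have sub: "path_image \<gamma> \<subseteq> cell i k"
    unfolding \<gamma>_def cell_def by (rule path_image_rectpath_subset_cbox[OF le])
  have holo: "quot holomorphic_on cell i k" using quot_holomorphic ik by blast
  have cnot: "c \<notin> path_image \<gamma>"
  proof
    assume "c \<in> path_image \<gamma>"
    then have "c \<in> cell i k" using sub by auto
    then have "c = centre i k" by (simp add: c_def centre_in_cell_iff)
    then have "c \<in> box (node i k) (node (Suc i) (Suc k))"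
      using centre_in_interior[of i k] by (simp add: cell_def)
    then show False
      using \<open>c \<in> path_image \<gamma>\<close> path_image_rectpath_cbox_minus_box[OF le] by (auto simp: \<gamma>_def)
  qed
  have hci: "(F has_contour_integral (if a = i \<and> b = k then 2 * pi * \<i> * quot c else 0)) \<gamma>"
  proof (cases "a = i \<and> b = k")
    case True
    then have "c \<in> interior (cell i k)" using centre_in_interior by (simp add: c_def)
    moreover have "winding_number \<gamma> c = 1"
      unfolding \<gamma>_def using \<open>c \<in> interior (cell i k)\<close>
      by (intro winding_number_rectpath) (auto simp: cell_def)
    moreover have "((\<lambda>w. quot w / (w - c)) has_contour_integral (2 * pi * \<i> * winding_number \<gamma> c * quot c)) \<gamma>"
      by (rule Cauchy_integral_formula_convex_simple[of "cell i k"])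
         (use calculation sub cnot holo in \<open>auto simp: cell_def \<gamma>_def\<close>)
    ultimately show ?thesis using True by (simp add: F_def)
  next
    case False
    then have "c \<notin> cell i k" by (simp add: c_def centre_in_cell_iff)
    then have "F holomorphic_on cell i k" unfolding F_def using holo by (intro holomorphic_intros) auto
    then have "(F has_contour_integral 0) \<gamma>"
      by (rule Cauchy_theorem_convex_simple) (use sub in \<open>auto simp: cell_def \<gamma>_def\<close>)
    then show ?thesis using False by (simp only: if_False)
  qed
  have "continuous_on (path_image \<gamma>) F"
    unfolding F_def using holomorphic_on_imp_continuous_on[OF holo] sub cnot
    by (intro continuous_intros) (auto elim: continuous_on_subset)
  note contour_integral_rectpath[OF this[unfolded \<gamma>_def]]
  then have "contour_integral \<gamma> F = hor i k c + ver (Suc i) k c - hor i (Suc k) c - ver i k c"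
    unfolding \<gamma>_def F_def hor_def ver_def by (simp add: node_def)
  then have "hor i k c - hor i (Suc k) c + (ver (Suc i) k c - ver i k c) = contour_integral \<gamma> F" by simp
  then show ?thesis using contour_integral_unique[OF hci] unfolding c_def by (rule trans)
qed

definition ind :: "nat \<Rightarrow> nat \<Rightarrow> complex" where "ind i k = (if large i k then 1 else 0)"

text \<open>In the sum of the Cauchy integrals over the boundaries of all large cells the inner edges carry differences
  of indicators; \<open>outer\<close> keeps only the edges on the boundary of the square.\<close>
definition outer :: "complex \<Rightarrow> complex" where
  "outer z = (\<Sum>i<N. ind i 0 * hor i 0 z - ind i (N - 1) * hor i N z)
           + (\<Sum>k<N. ind (N - 1) k * ver N k z - ind 0 k * ver 0 k z)"

text \<open>The cell identities are added over all large cells, and Abel summation is applied in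
  \<open>k\<close> to the horizontal and in \<open>i\<close> to the vertical edges.\<close>

lemma outer_at_centre:
  assumes ab: "a < N" "b < N"
  shows "outer (centre a b) =
     (if large a b then 2 * pi * \<i> * quot (centre a b) else 0)
     - (\<Sum>i<N. \<Sum>k<N-1. (ind i (Suc k) - ind i k) * hor i (Suc k) (centre a b))
     + (\<Sum>k<N. \<Sum>i<N-1. (ind (Suc i) k - ind i k) * ver (Suc i) k (centre a b))"
proof -
  define c where "c = centre a b"
  define M where "M = N - 1"
  have NM: "N = Suc M" using N_pos by (simp add: M_def)
  have "(\<Sum>i<N. \<Sum>k<N. ind i k * (hor i k c - hor i (Suc k) c))
      + (\<Sum>k<N. \<Sum>i<N. ind i k * (ver (Suc i) k c - ver i k c))
      = (\<Sum>i<N. \<Sum>k<N. ind i k * (hor i k c - hor i (Suc k) c + (ver (Suc i) k c - ver i k c)))"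
    by (subst (2) sum.swap) (simp add: sum.distrib[symmetric] distrib_left)
  also have "\<dots> = (\<Sum>i<N. \<Sum>k<N. if i = a \<and> k = b then ind i k * (2 * pi * \<i> * quot c) else 0)"
    by (intro sum.cong refl) (auto simp: ind_def cell_boundary_integral c_def)
  also have "\<dots> = (\<Sum>i<N. if i = a then ind i b * (2 * pi * \<i> * quot c) else 0)"
  proof (intro sum.cong refl)
    fix i
    show "(\<Sum>k<N. if i = a \<and> k = b then ind i k * (2 * pi * \<i> * quot c) else 0) =
          (if i = a then ind i b * (2 * pi * \<i> * quot c) else 0)"
      using ab by (cases "i = a") auto
  qed
  also have "\<dots> = (if large a b then 2 * pi * \<i> * quot c else 0)"
    using ab by (auto simp: ind_def)
  finally have total: "(\<Sum>i<N. \<Sum>k<N. ind i k * (hor i k c - hor i (Suc k) c))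
      + (\<Sum>k<N. \<Sum>i<N. ind i k * (ver (Suc i) k c - ver i k c))
      = (if large a b then 2 * pi * \<i> * quot c else 0)" .
  have h: "(\<Sum>k<N. ind i k * (hor i k c - hor i (Suc k) c)) =
     ind i 0 * hor i 0 c - ind i M * hor i N c + (\<Sum>k<M. (ind i (Suc k) - ind i k) * hor i (Suc k) c)" for i
    unfolding NM by (rule sum_mult_diff_Suc)
  \<comment> \<open>For vertical edges the higher index carries the plus sign, the reverse of the
    horizontal case, so Abel summation is applied to the negative.\<close>
  have v: "(\<Sum>i<N. ind i k * (ver (Suc i) k c - ver i k c)) =
     - (ind 0 k * ver 0 k c - ind M k * ver N k c + (\<Sum>i<M. (ind (Suc i) k - ind i k) * ver (Suc i) k c))" for k
  proof -
    have "(\<Sum>i<N. ind i k * (ver (Suc i) k c - ver i k c)) = - (\<Sum>i<Suc M. ind i k * (ver i k c - ver (Suc i) k c))"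
      unfolding sum_negf[symmetric] by (intro sum.cong) (simp_all add: algebra_simps NM[symmetric])
    also have "\<dots> = - (ind 0 k * ver 0 k c - ind M k * ver (Suc M) k c + (\<Sum>i<M. (ind (Suc i) k - ind i k) * ver (Suc i) k c))"
      by (subst sum_mult_diff_Suc) (rule refl)
    finally show ?thesis by (simp only: NM[symmetric])
  qed
  have "(\<Sum>i<N. ind i 0 * hor i 0 c - ind i M * hor i N c) + (\<Sum>i<N. \<Sum>k<M. (ind i (Suc k) - ind i k) * hor i (Suc k) c)
      + ((\<Sum>k<N. ind M k * ver N k c - ind 0 k * ver 0 k c) - (\<Sum>k<N. \<Sum>i<M. (ind (Suc i) k - ind i k) * ver (Suc i) k c))
      = (if large a b then 2 * pi * \<i> * quot c else 0)"
  proof -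
    have neg: "- (x - y + z) = (y - x) - z" for x y z :: complex by simp
    show ?thesis using total unfolding h v neg sum.distrib sum_subtractf .
  qed
  then have "outer c + X - Y = R"
    if "X = (\<Sum>i<N. \<Sum>k<M. (ind i (Suc k) - ind i k) * hor i (Suc k) c)"
      "Y = (\<Sum>k<N. \<Sum>i<M. (ind (Suc i) k - ind i k) * ver (Suc i) k c)"
      "R = (if large a b then 2 * pi * \<i> * quot c else 0)" for X Y R
    unfolding outer_def M_def[symmetric] that by (simp only: algebra_simps)
  from this[OF refl refl refl] show ?thesis unfolding c_def[symmetric] M_def[symmetric]
    by (simp only: algebra_simps)
qed

text \<open>Composing \<open>G\<close> with an affine polynomial parametrises the line through the
  centres without raising the degree. The bound is independent of the number of cells, so the grid
  may be refined at will.\<close>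

lemma card_changes:
  "card {k. k < M \<and> large i (Suc k) \<noteq> large i k} \<le> 4 * n"
  "card {i. i < M \<and> large (Suc i) k \<noteq> large i k} \<le> 4 * n"
proof -
  define t where "t k = (real k + 1 / 2) / N - 1 / 2" for k
  have t: "strict_mono t" by (rule strict_monoI) (use N_pos in \<open>simp add: t_def divide_strict_right_mono\<close>)
  have c: "centre i k = Complex (t i) (t k)" for i k by (simp add: centre_def t_def)
  have "degree (pcompose G [:Complex (t i) 0, \<i>:]) \<le> n" using deg by (simp add: degree_pcompose)
  note 1 = card_modulus_level_changes[OF this t, of s M]
  have "poly (pcompose G [:Complex (t i) 0, \<i>:]) (of_real (t k)) = poly G (centre i k)" for k
  proof -
    have "Complex (t i) 0 + of_real (t k) * \<i> = centre i k" by (simp add: c complex_eq_iff)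
    then show ?thesis by (simp add: poly_pcompose)
  qed
  then have "{k. k < M \<and> large i (Suc k) \<noteq> large i k} =
    {k. k < M \<and> (cmod (poly (pcompose G [:Complex (t i) 0, \<i>:]) (of_real (t k))) \<le> s) \<noteq>
                (cmod (poly (pcompose G [:Complex (t i) 0, \<i>:]) (of_real (t (Suc k)))) \<le> s)}"
    by (intro Collect_cong) (auto simp: large_def)
  with 1 s_bounds show "card {k. k < M \<and> large i (Suc k) \<noteq> large i k} \<le> 4 * n" by simp
  have "degree (pcompose G [:Complex 0 (t k), 1:]) \<le> n" using deg by (simp add: degree_pcompose)
  note 2 = card_modulus_level_changes[OF this t, of s M]
  have "poly (pcompose G [:Complex 0 (t k), 1:]) (of_real (t i)) = poly G (centre i k)" for i
  proof -
    have "Complex 0 (t k) + of_real (t i) = centre i k" by (simp add: c complex_eq_iff)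
    then show ?thesis by (simp add: poly_pcompose)
  qed
  then have "{i. i < M \<and> large (Suc i) k \<noteq> large i k} =
    {i. i < M \<and> (cmod (poly (pcompose G [:Complex 0 (t k), 1:]) (of_real (t i))) \<le> s) \<noteq>
                (cmod (poly (pcompose G [:Complex 0 (t k), 1:]) (of_real (t (Suc i)))) \<le> s)}"
    by (intro Collect_cong) (auto simp: large_def)
  with 2 s_bounds show "card {i. i < M \<and> large (Suc i) k \<noteq> large i k} \<le> 4 * n" by simp
qed


section \<open>Edges between large and other cells\<close>

definition edge :: "complex \<Rightarrow> complex \<Rightarrow> complex \<Rightarrow> complex" where
  "edge p q z = contour_integral (linepath p q) (\<lambda>\<zeta>. quot \<zeta> / (\<zeta> - z))"

lemma hor_eq_edge: "hor i k = edge (node i k) (node (Suc i) k)"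
  and ver_eq_edge: "ver i k = edge (node i k) (node i (Suc k))"
  by (auto simp: hor_def ver_def edge_def)

lemma edge_integrable:
  assumes "i < N" "k < N" "large i k" "closed_segment p q \<subseteq> cell i k" "z \<notin> closed_segment p q"
  shows "(\<lambda>\<zeta>. quot \<zeta> / (\<zeta> - z)) contour_integrable_on linepath p q"
  using assms
  by (intro contour_integrable_continuous_linepath continuous_intros)
     (auto intro: continuous_on_subset[OF holomorphic_on_imp_continuous_on[OF quot_holomorphic]])

lemma edge_bound:
  assumes ik: "i < N" "k < N" "large i k" "closed_segment p q \<subseteq> cell i k"
    and len: "cmod (q - p) = 1 / N" and \<delta>: "\<delta> > 0"
    and dist: "\<And>\<zeta>. \<zeta> \<in> closed_segment p q \<Longrightarrow> \<delta> \<le> cmod (\<zeta> - z)"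
    and bnd: "\<And>\<zeta>. \<zeta> \<in> closed_segment p q \<Longrightarrow> cmod (quot \<zeta>) \<le> B" "0 \<le> B"
  shows "cmod (edge p q z) \<le> B / \<delta> / N"
proof -
  have "cmod (edge p q z) \<le> B / \<delta> * cmod (q - p)"
    unfolding edge_def
  proof (rule contour_integral_bound_linepath)
    show "(\<lambda>\<zeta>. quot \<zeta> / (\<zeta> - z)) contour_integrable_on linepath p q"
      using dist[of z] \<delta> by (intro edge_integrable[OF ik]) auto
    show "0 \<le> B / \<delta>" using bnd \<delta> by simp
    show "cmod (quot \<zeta> / (\<zeta> - z)) \<le> B / \<delta>" if "\<zeta> \<in> closed_segment p q" for \<zeta>
      unfolding norm_divide using dist[OF that] bnd(1)[OF that] bnd(2) \<delta> by (intro frac_le) auto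
  qed
  then show ?thesis by (simp add: len)
qed

text \<open>The edge lies in a large cell and in one that is not large, so both bounds on
  \<open>\<bar>G\<bar>\<close> required by \<open>quot_small\<close> hold on it. Its length
  \<open>1 / N\<close> cancels the \<open>N\<close> in the distance.\<close>

lemma edge_inner_bound:
  assumes ik: "i < N" "k < N" "i' < N" "k' < N" "large i k" "\<not> large i' k'"
    and sub: "closed_segment p q \<subseteq> cell i k" "closed_segment p q \<subseteq> cell i' k'"
    and len: "cmod (q - p) = 1 / N" and m: "m \<ge> 0"
    and dist: "\<And>\<zeta>. \<zeta> \<in> closed_segment p q \<Longrightarrow> (1 + m) / (4 * N) \<le> cmod (\<zeta> - z)"
  shows "cmod (edge p q z) \<le> 32 * r * (1 / (1 + m))"
proof -
  have "cmod (edge p q z) \<le> 8 * r / ((1 + m) / (4 * N)) / N"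
  proof (rule edge_bound[OF ik(1,2,5) sub(1) len])
    show "0 < (1 + m) / (4 * N)" using m N_pos by simp
    show "cmod (quot \<zeta>) \<le> 8 * r" if "\<zeta> \<in> closed_segment p q" for \<zeta>
    proof (rule quot_small)
      show "cmod \<zeta> \<le> 1" using cell_norm(3)[OF ik(1,2)] sub that by auto
      show "s / 2 \<le> cmod (poly G \<zeta>)" using G_lower(1)[OF ik(1,2) _ ik(5)] sub that s_bounds by fastforce
      show "cmod (poly G \<zeta>) \<le> 3 * s" using G_upper[OF ik(3,4) _ ik(6)] sub that s_bounds by fastforce
    qed
  qed (use dist r in auto)
  also have "\<dots> = 32 * r * (1 / (1 + m))"
  proof -
    have "1 + m \<noteq> 0" using m by linarith
    then show ?thesis using N_pos by (simp add: divide_simps)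
  qed
  finally show ?thesis .
qed

text \<open>In units of the grid the centre sits at \<open>a + 1 / 2\<close>. With
  \<open>D = \<bar>i - a\<bar>\<close> the distance is at least \<open>D - 1 / 2\<close>, which is
  at least \<open>(1 + D) / 4\<close> once \<open>D \<ge> 1\<close>.\<close>

lemma distance_aux:
  fixes x :: real and i a :: nat
  assumes "real i \<le> x" "x \<le> real i + 1" "i \<noteq> a"
  shows "(1 + \<bar>real i - real a\<bar>) / 4 \<le> \<bar>x - (real a + 1 / 2)\<bar>"
proof -
  have "\<bar>real i - real a\<bar> \<ge> 1" using assms(3) by linarith
  then show ?thesis using assms(1,2) by (auto simp: abs_if split: if_splits)
qed

lemma scale_down:
  fixes D Y :: real
  assumes "D / 4 \<le> \<bar>N * Y\<bar>"
  shows "D / (4 * N) \<le> \<bar>Y\<bar>"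
  using assms N_pos by (simp add: abs_mult pos_divide_le_eq mult_ac)

lemma scaled_distance:
  assumes "i \<noteq> a" "real i / N - 1 / 2 \<le> x" "x \<le> (real i + 1) / N - 1 / 2"
  shows "(1 + \<bar>real i - real a\<bar>) / (4 * N) \<le> \<bar>x - ((real a + 1 / 2) / N - 1 / 2)\<bar>"
proof -
  have "(1 + \<bar>real i - real a\<bar>) / 4 \<le> \<bar>N * (x + 1 / 2) - (real a + 1 / 2)\<bar>"
    using assms N_pos by (intro distance_aux) (auto simp: field_simps)
  also have "N * (x + 1 / 2) - (real a + 1 / 2) = N * (x - ((real a + 1 / 2) / N - 1 / 2))"
    using N_pos by (simp add: field_simps)
  finally show ?thesis using scale_down by blast
qed

text \<open>Serves the edges in the same column or row as the centre, where the distance is measured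
  across the edge instead of along it.\<close>

lemma scaled_distance': "1 / (4 * N) \<le> \<bar>(real k / N - 1 / 2) - ((real b + 1 / 2) / N - 1 / 2)\<bar>"
proof -
  have "1 / 4 \<le> \<bar>real k - (real b + 1 / 2)\<bar>"
  proof (cases "k \<le> b")
    case False
    then have "real k \<ge> real b + 1" by simp
    then show ?thesis by linarith
  qed linarith
  also have "real k - (real b + 1 / 2) = N * ((real k / N - 1 / 2) - ((real b + 1 / 2) / N - 1 / 2))"
    using N_pos by (simp add: field_simps)
  finally show ?thesis using scale_down by blast
qed

text \<open>The bound depends on the column only, so all changes within one column count alike and
  their number suffices.\<close>

lemma hor_inner:
  assumes ik: "i < N" "Suc k < N" and ch: "large i (Suc k) \<noteq> large i k"
  shows "cmod (hor i (Suc k) (centre a b)) \<le> 32 * r * (1 / (1 + \<bar>real i - real a\<bar>))"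
proof -
  have d: "(1 + \<bar>real i - real a\<bar>) / (4 * N) \<le> cmod (\<zeta> - centre a b)"
    if "\<zeta> \<in> closed_segment (node i (Suc k)) (node (Suc i) (Suc k))" for \<zeta>
  proof (cases "i = a")
    case True
    then show ?thesis
      using scaled_distance'[of "Suc k" b] abs_Im_le_cmod[of "\<zeta> - centre a b"] horizontal_edge[OF that]
      by (simp add: centre_def)
  next
    case False
    then show ?thesis
      using scaled_distance[of i a "Re \<zeta>"] abs_Re_le_cmod[of "\<zeta> - centre a b"] horizontal_edge[OF that]
      by (simp add: centre_def)
  qed
  note sub = cell_edges(3)[of i k] cell_edges(1)[of i "Suc k"]
  show ?thesis
  proof (cases "large i k")
    case True
    then show ?thesis unfolding hor_eq_edge
      using ik ch d by (intro edge_inner_bound[of i k i "Suc k"] sub edge_length) auto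
  next
    case False
    then show ?thesis unfolding hor_eq_edge
      using ik ch d by (intro edge_inner_bound[of i "Suc k" i k] sub edge_length) auto
  qed
qed

lemma ver_inner:
  assumes ik: "Suc i < N" "k < N" and ch: "large (Suc i) k \<noteq> large i k"
  shows "cmod (ver (Suc i) k (centre a b)) \<le> 32 * r * (1 / (1 + \<bar>real k - real b\<bar>))"
proof -
  have d: "(1 + \<bar>real k - real b\<bar>) / (4 * N) \<le> cmod (\<zeta> - centre a b)"
    if "\<zeta> \<in> closed_segment (node (Suc i) k) (node (Suc i) (Suc k))" for \<zeta>
  proof (cases "k = b")
    case True
    then show ?thesis
      using scaled_distance'[of "Suc i" a] abs_Re_le_cmod[of "\<zeta> - centre a b"] vertical_edge[OF that]
      by (simp add: centre_def)
  next
    case False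
    then show ?thesis
      using scaled_distance[of k b "Im \<zeta>"] abs_Im_le_cmod[of "\<zeta> - centre a b"] vertical_edge[OF that]
      by (simp add: centre_def)
  qed
  note sub = cell_edges(4)[of i k] cell_edges(2)[of "Suc i" k]
  show ?thesis
  proof (cases "large i k")
    case True
    then show ?thesis unfolding ver_eq_edge
      using ik ch d by (intro edge_inner_bound[of i k "Suc i" k] sub edge_length) auto
  next
    case False
    then show ?thesis unfolding ver_eq_edge
      using ik ch d by (intro edge_inner_bound[of "Suc i" k i k] sub edge_length) auto
  qed
qed

lemma sum_changes_bound:
  fixes u e :: "nat \<Rightarrow> complex" and L :: "nat \<Rightarrow> bool"
  assumes u: "\<And>k. u k = (if L k then 1 else 0)"
    and e: "\<And>k. k < M \<Longrightarrow> L (Suc k) \<noteq> L k \<Longrightarrow> cmod (e k) \<le> B"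
    and c: "card {k. k < M \<and> L (Suc k) \<noteq> L k} \<le> c"
    and B: "0 \<le> B"
  shows "cmod (\<Sum>k<M. (u (Suc k) - u k) * e k) \<le> real c * B"
proof -
  have "cmod (\<Sum>k<M. (u (Suc k) - u k) * e k) \<le> (\<Sum>k<M. cmod ((u (Suc k) - u k) * e k))"
    by (rule norm_sum)
  also have "\<dots> \<le> (\<Sum>k<M. if L (Suc k) \<noteq> L k then B else 0)"
    using e by (intro sum_mono) (auto simp: u)
  also have "\<dots> = (\<Sum>k\<in>{k. k < M \<and> L (Suc k) \<noteq> L k}. B)"
    by (simp add: sum.If_cases Int_def)
  also have "\<dots> = real (card {k. k < M \<and> L (Suc k) \<noteq> L k}) * B" by simp
  also have "\<dots> \<le> real c * B" using c B by (intro mult_right_mono) auto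
  finally show ?thesis .
qed

text \<open>Each column has at most \<open>4 * n\<close> changes of size
  \<open>32 * r / (1 + \<bar>i - a\<bar>)\<close>, and the reciprocals of the distances add up to
  \<open>2 * (1 + ln N)\<close>. This gives 256, doubled by the vertical edges.\<close>

lemma outer_error:
  assumes ab: "a < N" "b < N"
  shows "cmod (outer (centre a b) - (if large a b then 2 * pi * \<i> * quot (centre a b) else 0))
           \<le> 512 * n * r * (1 + ln N)"
proof -
  have h: "cmod (\<Sum>i<N. \<Sum>k<N-1. (ind i (Suc k) - ind i k) * hor i (Suc k) (centre a b))
     \<le> 256 * n * r * (1 + ln N)"
  proof -
    have "cmod (\<Sum>i<N. \<Sum>k<N-1. (ind i (Suc k) - ind i k) * hor i (Suc k) (centre a b))
      \<le> (\<Sum>i<N. real (4 * n) * (32 * r * (1 / (1 + \<bar>real i - real a\<bar>))))"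
    proof (rule sum_norm_le)
      fix i assume i: "i \<in> {..<N}"
      show "cmod (\<Sum>k<N-1. (ind i (Suc k) - ind i k) * hor i (Suc k) (centre a b))
         \<le> real (4 * n) * (32 * r * (1 / (1 + \<bar>real i - real a\<bar>)))"
      proof (rule sum_changes_bound[where L = "large i"])
        show "cmod (hor i (Suc k) (centre a b)) \<le> 32 * r * (1 / (1 + \<bar>real i - real a\<bar>))" if "k < N - 1" "large i (Suc k) \<noteq> large i k" for k
          using i that by (intro hor_inner) auto
      qed (use r in \<open>auto simp: ind_def intro: card_changes[simplified]\<close>)
    qed
    also have "\<dots> = 128 * n * r * (\<Sum>i<N. 1 / (1 + \<bar>real i - real a\<bar>))"
      by (simp add: sum_distrib_left mult_ac)
    also have "\<dots> \<le> 128 * n * r * (2 * (1 + ln N))"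
      using r by (intro mult_left_mono sum_inverse_distance ab) auto
    also have "\<dots> = 256 * n * r * (1 + ln N)" by (simp add: algebra_simps)
    finally show ?thesis .
  qed
  have v: "cmod (\<Sum>k<N. \<Sum>i<N-1. (ind (Suc i) k - ind i k) * ver (Suc i) k (centre a b))
     \<le> 256 * n * r * (1 + ln N)"
  proof -
    have "cmod (\<Sum>k<N. \<Sum>i<N-1. (ind (Suc i) k - ind i k) * ver (Suc i) k (centre a b))
      \<le> (\<Sum>k<N. real (4 * n) * (32 * r * (1 / (1 + \<bar>real k - real b\<bar>))))"
    proof (rule sum_norm_le)
      fix k assume k: "k \<in> {..<N}"
      show "cmod (\<Sum>i<N-1. (ind (Suc i) k - ind i k) * ver (Suc i) k (centre a b))
         \<le> real (4 * n) * (32 * r * (1 / (1 + \<bar>real k - real b\<bar>)))"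
      proof (rule sum_changes_bound[where L = "\<lambda>i. large i k"])
        show "cmod (ver (Suc i) k (centre a b)) \<le> 32 * r * (1 / (1 + \<bar>real k - real b\<bar>))" if "i < N - 1" "large (Suc i) k \<noteq> large i k" for i
          using k that by (intro ver_inner) auto
      qed (use r in \<open>auto simp: ind_def intro: card_changes[simplified]\<close>)
    qed
    also have "\<dots> = 128 * n * r * (\<Sum>k<N. 1 / (1 + \<bar>real k - real b\<bar>))"
      by (simp add: sum_distrib_left mult_ac)
    also have "\<dots> \<le> 128 * n * r * (2 * (1 + ln N))"
      using r by (intro mult_left_mono sum_inverse_distance ab) auto
    also have "\<dots> = 256 * n * r * (1 + ln N)" by (simp add: algebra_simps)
    finally show ?thesis .
  qed
  have "cmod (x - y + z - x) \<le> cmod y + cmod z" for x y z :: complex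
    using norm_triangle_ineq4[of z y] by (simp add: algebra_simps)
  from order_trans[OF this add_mono[OF h v]]
  have "cmod (outer (centre a b) - (if large a b then 2 * pi * \<i> * quot (centre a b) else 0))
    \<le> 256 * n * r * (1 + ln N) + 256 * n * r * (1 + ln N)"
    unfolding outer_at_centre[OF ab] .
  then show ?thesis by linarith
qed


section \<open>Edges on the boundary of the square\<close>

definition outer_edge :: "complex \<Rightarrow> complex \<Rightarrow> bool" where
  "outer_edge p q \<longleftrightarrow> cmod (q - p) = 1 / N \<and>
     (\<exists>i<N. \<exists>k<N. large i k \<and> closed_segment p q \<subseteq> cell i k) \<and>
     (\<forall>\<zeta>\<in>closed_segment p q. 1 / 2 \<le> cmod \<zeta>)"

lemma outer_edgeI:
  assumes "i < N" "k < N" "large i k" "closed_segment p q \<subseteq> cell i k" "cmod (q - p) = 1 / N"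
    and "\<And>\<zeta>. \<zeta> \<in> closed_segment p q \<Longrightarrow> \<bar>Im \<zeta>\<bar> = 1 / 2 \<or> \<bar>Re \<zeta>\<bar> = 1 / 2"
  shows "outer_edge p q"
  unfolding outer_edge_def
proof (intro conjI ballI)
  fix \<zeta> assume "\<zeta> \<in> closed_segment p q"
  from assms(6)[OF this] show "1 / 2 \<le> cmod \<zeta>"
    using abs_Im_le_cmod[of \<zeta>] abs_Re_le_cmod[of \<zeta>] by linarith
qed (use assms in blast)+

lemma outer_edges:
  "i < N \<Longrightarrow> large i 0 \<Longrightarrow> outer_edge (node i 0) (node (Suc i) 0)"
  "i < N \<Longrightarrow> large i (N - 1) \<Longrightarrow> outer_edge (node i N) (node (Suc i) N)"
  "k < N \<Longrightarrow> large 0 k \<Longrightarrow> outer_edge (node 0 k) (node 0 (Suc k))"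
  "k < N \<Longrightarrow> large (N - 1) k \<Longrightarrow> outer_edge (node N k) (node N (Suc k))"
proof -
  have N: "N - 1 < N" "Suc (N - 1) = N" using N_pos by auto
  show "outer_edge (node i 0) (node (Suc i) 0)" if "i < N" "large i 0"
    by (rule outer_edgeI[OF that(1) N_pos(1) that(2) cell_edges(1) edge_length(1)])
       (auto dest!: horizontal_edge)
  show "outer_edge (node i N) (node (Suc i) N)" if "i < N" "large i (N - 1)"
    using cell_edges(3)[of i "N - 1"]
    by (intro outer_edgeI[OF that(1) N(1) that(2) _ edge_length(1)])
       (use N N_pos in \<open>auto dest!: horizontal_edge\<close>)
  show "outer_edge (node 0 k) (node 0 (Suc k))" if "k < N" "large 0 k"
    by (rule outer_edgeI[OF N_pos(1) that(1) that(2) cell_edges(2) edge_length(2)])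
       (auto dest!: vertical_edge)
  show "outer_edge (node N k) (node N (Suc k))" if "k < N" "large (N - 1) k"
    using cell_edges(4)[of "N - 1" k]
    by (intro outer_edgeI[OF N(1) that(1) that(2) _ edge_length(2)])
       (use N N_pos in \<open>auto dest!: vertical_edge\<close>)
qed

lemma outer_edge_quot:
  assumes "outer_edge p q"
  obtains i k where "i < N" "k < N" "large i k" "closed_segment p q \<subseteq> cell i k"
    "cmod (q - p) = 1 / N" "\<And>\<zeta>. \<zeta> \<in> closed_segment p q \<Longrightarrow> 1 / 2 \<le> cmod \<zeta>"
    "\<And>\<zeta>. \<zeta> \<in> closed_segment p q \<Longrightarrow> cmod (quot \<zeta>) \<le> 4 * A"
proof -
  from assms obtain i k where ik: "i < N" "k < N" "large i k" "closed_segment p q \<subseteq> cell i k"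
    by (auto simp: outer_edge_def)
  moreover have "cmod (quot \<zeta>) \<le> 4 * A" if "\<zeta> \<in> closed_segment p q" for \<zeta>
  proof (rule quot_bound)
    show "cmod \<zeta> \<le> 1" using cell_norm(3)[OF ik(1,2)] ik(4) that by auto
    show "s / 2 \<le> cmod (poly G \<zeta>)" using G_lower(1)[OF ik(1,2) _ ik(3)] ik(4) that s_bounds by fastforce
  qed
  ultimately show ?thesis using assms that by (auto simp: outer_edge_def)
qed

lemma outer_edge_distance:
  assumes "1 / 2 \<le> cmod \<zeta>" "cmod z \<le> 1 / 4"
  shows "1 / 4 \<le> cmod (\<zeta> - z)"
  using assms norm_triangle_ineq2[of \<zeta> z] by linarith

lemma outer_edge_bound:
  assumes "outer_edge p q" "cmod z \<le> 1 / 4"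
  shows "cmod (edge p q z) \<le> 16 * A / N"
proof -
  obtain i k where ik: "i < N" "k < N" "large i k" "closed_segment p q \<subseteq> cell i k"
    "cmod (q - p) = 1 / N" "\<And>\<zeta>. \<zeta> \<in> closed_segment p q \<Longrightarrow> 1 / 2 \<le> cmod \<zeta>"
    "\<And>\<zeta>. \<zeta> \<in> closed_segment p q \<Longrightarrow> cmod (quot \<zeta>) \<le> 4 * A"
    using outer_edge_quot[OF assms(1)] by blast
  have "cmod (edge p q z) \<le> 4 * A / (1 / 4) / N"
    by (rule edge_bound[OF ik(1-5)]) (use ik assms A outer_edge_distance in auto)
  then show ?thesis by simp
qed

lemma outer_edge_lipschitz:
  assumes "outer_edge p q" "cmod z \<le> 1 / 4" "cmod w \<le> 1 / 4"
  shows "cmod (edge p q z - edge p q w) \<le> 64 * A * cmod (z - w) / N"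
proof -
  obtain i k where ik: "i < N" "k < N" "large i k" "closed_segment p q \<subseteq> cell i k"
    and len: "cmod (q - p) = 1 / N" and far: "\<And>\<zeta>. \<zeta> \<in> closed_segment p q \<Longrightarrow> 1 / 2 \<le> cmod \<zeta>"
    and q: "\<And>\<zeta>. \<zeta> \<in> closed_segment p q \<Longrightarrow> cmod (quot \<zeta>) \<le> 4 * A"
    using outer_edge_quot[OF assms(1)] by blast
  have notin: "z \<notin> closed_segment p q" "w \<notin> closed_segment p q"
    using far assms by fastforce+
  note int = edge_integrable[OF ik notin(1)] edge_integrable[OF ik notin(2)]
  have "cmod (contour_integral (linepath p q) (\<lambda>\<zeta>. quot \<zeta> / (\<zeta> - z) - quot \<zeta> / (\<zeta> - w)))
     \<le> (64 * A * cmod (z - w)) * cmod (q - p)"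
  proof (rule contour_integral_bound_linepath)
    show "(\<lambda>\<zeta>. quot \<zeta> / (\<zeta> - z) - quot \<zeta> / (\<zeta> - w)) contour_integrable_on linepath p q"
      using int by (rule contour_integrable_diff)
    show "0 \<le> 64 * A * cmod (z - w)" using A by simp
    fix \<zeta> assume \<zeta>: "\<zeta> \<in> closed_segment p q"
    have d: "1 / 4 \<le> cmod (\<zeta> - z)" "1 / 4 \<le> cmod (\<zeta> - w)"
      using outer_edge_distance far[OF \<zeta>] assms by auto
    then have nz: "\<zeta> - z \<noteq> 0" "\<zeta> - w \<noteq> 0" by fastforce+
    have "quot \<zeta> / (\<zeta> - z) - quot \<zeta> / (\<zeta> - w) = quot \<zeta> * (z - w) / ((\<zeta> - z) * (\<zeta> - w))"
      using nz by (simp add: divide_simps) (simp add: algebra_simps)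
    then have "cmod (quot \<zeta> / (\<zeta> - z) - quot \<zeta> / (\<zeta> - w)) =
        cmod (quot \<zeta>) * cmod (z - w) / (cmod (\<zeta> - z) * cmod (\<zeta> - w))"
      by (simp add: norm_mult norm_divide)
    also have "\<dots> \<le> (4 * A * cmod (z - w)) / (1 / 4 * (1 / 4))"
      using d q[OF \<zeta>] A by (intro frac_le mult_mono) auto
    finally show "cmod (quot \<zeta> / (\<zeta> - z) - quot \<zeta> / (\<zeta> - w)) \<le> 64 * A * cmod (z - w)" by simp
  qed
  then show ?thesis using contour_integral_diff[OF int] by (simp add: edge_def len)
qed

text \<open>A Cauchy integral with continuous density is holomorphic off its path, and these edges
  stay outside \<open>ball 0 (1 / 2)\<close>.\<close>

lemma outer_edge_holomorphic:
  assumes "outer_edge p q"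
  shows "edge p q holomorphic_on ball 0 (1 / 2)"
proof -
  obtain i k where ik: "i < N" "k < N" "large i k" "closed_segment p q \<subseteq> cell i k"
    and "cmod (q - p) = 1 / N" and far: "\<And>\<zeta>. \<zeta> \<in> closed_segment p q \<Longrightarrow> 1 / 2 \<le> cmod \<zeta>"
    and "\<And>\<zeta>. \<zeta> \<in> closed_segment p q \<Longrightarrow> cmod (quot \<zeta>) \<le> 4 * A"
    using outer_edge_quot[OF assms] by blast
  have disj: "ball 0 (1 / 2) - path_image (linepath p q) = ball 0 (1 / 2)"
  proof -
    have "x \<notin> closed_segment p q" if "x \<in> ball 0 (1 / 2)" for x
      using far[of x] that by (auto simp del: norm_le_zero_iff)
    then show ?thesis by (simp only: path_image_linepath) blast
  qed
  have "\<exists>d. (edge p q has_field_derivative d) (at w)" if w: "w \<in> ball 0 (1 / 2)" for w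
  proof -
    have "(edge p q has_field_derivative
        (of_nat 1 * contour_integral (linepath p q) (\<lambda>u. quot u / (u - w) ^ Suc 1))) (at w)"
    proof (rule Cauchy_next_derivative(2)[where S = "ball 0 (1 / 2)" and B = "cmod (q - p)" and k = 1 and f' = quot and f = "edge p q" and \<gamma> = "linepath p q" and w = w])
      show "continuous_on (path_image (linepath p q)) quot"
        using continuous_on_subset[OF holomorphic_on_imp_continuous_on[OF quot_holomorphic[OF ik(1-3)]] ik(4)]
        by (simp only: path_image_linepath)
      show "((\<lambda>u. quot u / (u - w) ^ 1) has_contour_integral edge p q w) (linepath p q)"
        if "w \<in> ball 0 (1 / 2) - path_image (linepath p q)" for w
      proof -
        have "w \<notin> closed_segment p q" using that by (simp only: path_image_linepath) blast
        from has_contour_integral_integral[OF edge_integrable[OF ik this]]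
        show ?thesis by (simp only: edge_def power_one_right)
      qed
      show "w \<in> ball 0 (1 / 2) - path_image (linepath p q)" unfolding disj by (rule w)
      show "norm (vector_derivative (linepath p q) (at t)) \<le> cmod (q - p)" for t
        by (simp add: vector_derivative_linepath_at)
    qed simp_all
    then show ?thesis by blast
  qed
  then show ?thesis unfolding holomorphic_on_open[OF open_ball] by blast
qed

lemma outer_eq:
  "outer z = (\<Sum>i<N. (if large i 0 then hor i 0 z else 0) - (if large i (N - 1) then hor i N z else 0))
           + (\<Sum>k<N. (if large (N - 1) k then ver N k z else 0) - (if large 0 k then ver 0 k z else 0))"
  unfolding outer_def by (intro arg_cong2[where f = "(+)"] sum.cong refl) (auto simp: ind_def)

lemma outer_holomorphic: "outer holomorphic_on ball 0 (1 / 2)"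
proof -
  have *: "(\<lambda>z. if b then f z else (0::complex)) holomorphic_on S" if "b \<Longrightarrow> f holomorphic_on S" for b f S
    using that by (cases b) auto
  have "(\<lambda>z. if large i 0 then hor i 0 z else 0) holomorphic_on ball 0 (1 / 2)"
    "(\<lambda>z. if large i (N - 1) then hor i N z else 0) holomorphic_on ball 0 (1 / 2)"
    "(\<lambda>z. if large (N - 1) i then ver N i z else 0) holomorphic_on ball 0 (1 / 2)"
    "(\<lambda>z. if large 0 i then ver 0 i z else 0) holomorphic_on ball 0 (1 / 2)" if "i < N" for i
    unfolding hor_eq_edge ver_eq_edge using that
    by (rule_tac [!] *, rule_tac [!] outer_edge_holomorphic) (rule outer_edges; assumption)+
  then show ?thesis unfolding outer_eq[abs_def]
    by (intro holomorphic_on_add holomorphic_on_sum holomorphic_on_diff) auto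
qed

text \<open>\<open>c = 0\<close> yields the sup bound and \<open>c = 1\<close> the Lipschitz bound.
  The boundary of the square consists of \<open>4 * N\<close> edges.\<close>

lemma outer_norm_le:
  assumes "\<And>p q. outer_edge p q \<Longrightarrow> cmod (edge p q z - c * edge p q w) \<le> B / N" "0 \<le> B"
  shows "cmod (outer z - c * outer w) \<le> 4 * B"
proof -
  have *: "cmod ((if b then f z else 0) - (if b' then f' z else 0) - c * ((if b then f w else 0) - (if b' then f' w else 0)))
     \<le> B / N + B / N"
    if "b \<Longrightarrow> cmod (f z - c * f w) \<le> B / N" "b' \<Longrightarrow> cmod (f' z - c * f' w) \<le> B / N" for b b' f f'
  proof -
    have "(if b then f z else 0) - (if b' then f' z else 0) - c * ((if b then f w else 0) - (if b' then f' w else 0))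
      = (if b then f z - c * f w else 0) - (if b' then f' z - c * f' w else 0)"
      by (simp add: algebra_simps)
    also have "cmod \<dots> \<le> B / N + B / N"
      by (rule order_trans[OF norm_triangle_ineq4], rule add_mono) (use that assms(2) in auto)
    finally show ?thesis .
  qed
  define X where "X i = (if large i 0 then hor i 0 z else 0) - (if large i (N - 1) then hor i N z else 0)
         - c * ((if large i 0 then hor i 0 w else 0) - (if large i (N - 1) then hor i N w else 0))" for i
  define Y where "Y k = (if large (N - 1) k then ver N k z else 0) - (if large 0 k then ver 0 k z else 0)
         - c * ((if large (N - 1) k then ver N k w else 0) - (if large 0 k then ver 0 k w else 0))" for k
  have "cmod (X i) \<le> B / N + B / N" "cmod (Y i) \<le> B / N + B / N" if i: "i < N" for i
    unfolding X_def Y_def hor_eq_edge ver_eq_edge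
    by (rule *; rule assms(1); rule outer_edges; (assumption | rule i))+
  then have "cmod ((\<Sum>i<N. X i) + (\<Sum>k<N. Y k)) \<le> (\<Sum>i<N. B / N + B / N) + (\<Sum>k<N. B / N + B / N)"
    by (intro order_trans[OF norm_triangle_ineq] add_mono sum_norm_le) auto
  moreover have "outer z - c * outer w = (\<Sum>i<N. X i) + (\<Sum>k<N. Y k)"
    unfolding outer_eq X_def Y_def sum_subtractf sum_distrib_left[symmetric] by (simp add: algebra_simps)
  moreover have "real N * (B / N) = B" using N_pos(2) by simp
  then have "(\<Sum>i<N. B / N + B / N) + (\<Sum>k<N. B / N + B / N) = 4 * B"
    by (simp only: sum_constant card_lessThan distrib_left)
  ultimately show ?thesis by (simp only:)
qed

lemma outer_bound: "cmod z \<le> 1 / 4 \<Longrightarrow> cmod (outer z) \<le> 64 * A"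
  using outer_norm_le[of z 0 0 "16 * A"] outer_edge_bound A by auto

lemma outer_lipschitz: "cmod z \<le> 1 / 4 \<Longrightarrow> cmod w \<le> 1 / 4 \<Longrightarrow> cmod (outer z - outer w) \<le> 256 * A * cmod (z - w)"
  using outer_norm_le[of z 1 w "64 * A * cmod (z - w)"] outer_edge_lipschitz A by auto

section \<open>The holomorphic approximation at unit scale\<close>

definition approx :: "complex \<Rightarrow> complex" where "approx z = outer z / (2 * pi * \<i>)"

lemma norm_two_pi_i: "cmod (2 * of_real pi * \<i>) = 2 * pi" "6 \<le> 2 * pi"
  using pi_gt3 by (auto simp: norm_mult)

lemma approx_holomorphic: "approx holomorphic_on ball 0 (1 / 2)"
  unfolding approx_def using outer_holomorphic by (intro holomorphic_intros) auto

lemma norm_approx_le: "cmod x \<le> B \<Longrightarrow> cmod (x / (2 * pi * \<i>)) \<le> B / 6"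
  unfolding norm_divide using norm_two_pi_i order_trans[OF norm_ge_zero] by (intro frac_le) auto

lemma approx_bound: "cmod z \<le> 1 / 4 \<Longrightarrow> cmod (approx z) \<le> 16 * A"
  using norm_approx_le[OF outer_bound[of z]] A by (simp add: approx_def)

lemma approx_lipschitz:
  assumes "cmod z \<le> 1 / 4" "cmod w \<le> 1 / 4"
  shows "cmod (approx z - approx w) \<le> 64 * A * cmod (z - w)"
proof -
  have "cmod (approx z - approx w) \<le> 256 * A * cmod (z - w) / 6"
    using norm_approx_le[OF outer_lipschitz[OF assms]]
    unfolding approx_def diff_divide_distrib[symmetric] .
  moreover have "0 \<le> A * cmod (z - w)" using A by simp
  ultimately show ?thesis by linarith
qed

lemma approx_at_centre:
  assumes "a < N" "b < N"
  shows "cmod (approx (centre a b) - (if large a b then quot (centre a b) else 0)) \<le> 90 * n * r * (1 + ln N)"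
proof -
  have "approx (centre a b) - (if large a b then quot (centre a b) else 0) =
    (outer (centre a b) - (if large a b then 2 * pi * \<i> * quot (centre a b) else 0)) / (2 * pi * \<i>)"
    by (simp add: approx_def diff_divide_distrib)
  also have "cmod \<dots> \<le> 512 * n * r * (1 + ln N) / 6"
    by (rule norm_approx_le[OF outer_error[OF assms]])
  also have "\<dots> \<le> 90 * n * r * (1 + ln N)"
  proof -
    have "0 \<le> n * r * (1 + ln N)" using r N_ge(4) by simp
    then show ?thesis by linarith
  qed
  finally show ?thesis .
qed

lemma cell_exists:
  assumes "cmod z \<le> 1 / 8"
  obtains a b where "a < N" "b < N" "z \<in> cell a b"
proof -
  have *: "nat \<lfloor>(x + 1 / 2) * N\<rfloor> < N \<and> real (nat \<lfloor>(x + 1 / 2) * N\<rfloor>) / N - 1 / 2 \<le> x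
      \<and> x \<le> (real (nat \<lfloor>(x + 1 / 2) * N\<rfloor>) + 1) / N - 1 / 2"
    if "\<bar>x\<bar> \<le> 1 / 8" for x :: real
  proof -
    have 0: "0 \<le> (x + 1 / 2) * N" using that by (intro mult_nonneg_nonneg) auto
    have 1: "(x + 1 / 2) * real N < 1 * real N" using that N_pos by (intro mult_strict_right_mono) auto
    have f: "real (nat \<lfloor>(x + 1 / 2) * N\<rfloor>) = of_int \<lfloor>(x + 1 / 2) * N\<rfloor>" using 0 by simp
    have "real (nat \<lfloor>(x + 1 / 2) * N\<rfloor>) \<le> (x + 1 / 2) * N"
      "(x + 1 / 2) * N \<le> real (nat \<lfloor>(x + 1 / 2) * N\<rfloor>) + 1"
      unfolding f by linarith+
    moreover from this 1 have "nat \<lfloor>(x + 1 / 2) * N\<rfloor> < N" by linarith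
    ultimately show ?thesis using N_pos by (auto simp: field_simps)
  qed
  have "\<bar>Re z\<bar> \<le> 1 / 8" "\<bar>Im z\<bar> \<le> 1 / 8"
    using assms abs_Re_le_cmod[of z] abs_Im_le_cmod[of z] by linarith+
  from *[OF this(1)] *[OF this(2)] show ?thesis
    by (intro that[of "nat \<lfloor>(Re z + 1 / 2) * N\<rfloor>" "nat \<lfloor>(Im z + 1 / 2) * N\<rfloor>"]) (auto simp: in_cell)
qed

text \<open>The estimate at the centre is carried to the other points of the cell by the Lipschitz
  bounds, which cost multiples of \<open>r\<close>. Near the threshold the centre may be classified
  differently from \<open>z\<close>, but there the quotient is \<open>O(r)\<close>, so comparing
  with 0 and comparing with the quotient are equally good.\<close>

lemma approx_main:
  assumes z: "cmod z \<le> 1 / 8"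
  shows "cmod (poly G z) \<le> 2 * s \<Longrightarrow> cmod (approx z) \<le> 100 * n * r * (1 + ln N)"
    and "s / 2 \<le> cmod (poly G z) \<Longrightarrow> cmod (approx z - quot z) \<le> 100 * n * r * (1 + ln N)"
proof -
  obtain a b where ab: "a < N" "b < N" "z \<in> cell a b" using cell_exists[OF z] by blast
  define c where "c = centre a b"
  have zc: "cmod (z - c) \<le> 1 / N" using dist_centre[OF ab(3)] by (simp add: c_def)
  have N64: "1 / real N \<le> 1 / 64" using N_ge(4) by (simp add: field_simps)
  have c4: "cmod c \<le> 1 / 4"
    using norm_triangle_ineq2[of c z] zc z N64 by (simp add: norm_minus_commute)
  have z1: "cmod z \<le> 1" and c1: "cmod c \<le> 1" using z c4 by auto
  have lip: "cmod (approx z - approx c) \<le> r"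
  proof -
    have "cmod (approx z - approx c) \<le> 64 * A * cmod (z - c)" using z c4 by (intro approx_lipschitz) auto
    also have "\<dots> \<le> 64 * A * (1 / N)" using zc A by (intro mult_left_mono) auto
    also have "\<dots> \<le> s"
    proof -
      have "A \<le> A\<^sup>2" using A by (simp add: power2_eq_square)
      then have "64 * A \<le> real N * s" using N_ge(3) by linarith
      then show ?thesis using N_pos by (simp add: field_simps)
    qed
    finally show ?thesis using s_bounds by linarith
  qed
  note centre_est = approx_at_centre[OF ab(1,2), folded c_def]
  have Gd: "cmod (poly G z - poly G c) \<le> s / 4" using G_near_centre[OF ab] by (simp add: c_def)
  have Gc: "cmod (poly G c) \<le> cmod (poly G z) + s / 4"
    using Gd norm_triangle_ineq2[of "poly G c" "poly G z"] by (simp add: norm_minus_commute)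
  have slack: "90 * n * r * (1 + ln N) + 10 * r \<le> 100 * n * r * (1 + ln N)"
  proof -
    have "1 * r * 1 \<le> n * r * (1 + ln N)" using n r N_ge(4) by (intro mult_mono) auto
    then show ?thesis by linarith
  qed
  have tri: "cmod x \<le> cmod (x - y) + cmod (y - w) + cmod w" for x y w :: complex
    using norm_triangle_ineq[of "x - y" y] norm_triangle_ineq[of "y - w" w] by simp
  have small: "cmod (approx z) \<le> 90 * n * r * (1 + ln N) + 9 * r" if "cmod (poly G z) \<le> 2 * s"
  proof (cases "large a b")
    case True
    have "s / 2 \<le> cmod (poly G c)" using True s_bounds by (simp add: large_def c_def)
    then have "cmod (quot c) \<le> 8 * r" using Gc that s_bounds by (intro quot_small c1) auto
    then show ?thesis using tri[of "approx z" "approx c" "quot c"] lip centre_est True by simp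
  next
    case False
    then show ?thesis using tri[of "approx z" "approx c" 0] lip centre_est r by simp
  qed
  show "cmod (approx z) \<le> 100 * n * r * (1 + ln N)" if "cmod (poly G z) \<le> 2 * s"
    using small[OF that] slack r by linarith
  show "cmod (approx z - quot z) \<le> 100 * n * r * (1 + ln N)" if G: "s / 2 \<le> cmod (poly G z)"
  proof (cases "large a b")
    case True
    have "s / 2 \<le> cmod (poly G c)" using True s_bounds by (simp add: large_def c_def)
    then have "cmod (quot c - quot z) \<le> r"
      using quot_lipschitz[OF z1 G c1] zc by (simp add: norm_minus_commute)
    moreover have "cmod (approx c - quot c) \<le> 90 * n * r * (1 + ln N)" using centre_est True by simp
    moreover have "cmod (approx z - quot z) \<le> cmod (approx z - approx c) + cmod (approx c - quot c) + cmod (quot c - quot z)"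
      using tri[of "approx z - quot z" "approx c - quot z" "quot c - quot z"] by simp
    ultimately show ?thesis using lip slack r by linarith
  next
    case False
    \<comment> \<open>\<open>z\<close> passes the test but the centre does not: then the quotient at
      \<open>z\<close> is itself small, and so is \<open>approx\<close>.\<close>
    then have le: "cmod (poly G z) \<le> 5 / 4 * s" using G_upper[OF ab] by simp
    have "cmod (quot z) \<le> 8 * r" using G le s_bounds by (intro quot_small z1) auto
    moreover have "cmod (approx z) \<le> 90 * n * r * (1 + ln N) + r"
      using tri[of "approx z" "approx c" 0] lip centre_est False by simp
    ultimately show ?thesis using norm_triangle_ineq4[of "approx z" "quot z"] slack r by linarith
  qed
qed

end

text \<open>Of the grid only the logarithm of \<open>N\<close> remains. As
  \<open>A\<^sup>2 / (r ^ j) ^ 3 \<ge> 1\<close>, rounding \<open>N\<close> up to an integer merely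
  turns 64 into 65.\<close>

lemma approximate_quotient_unit:
  fixes G H :: "complex poly" and n j :: nat and A r :: real
  assumes "degree G \<le> n" "n \<ge> 1" "j \<ge> 1" "A \<ge> 1" "0 < r" "r \<le> 1"
    and "\<And>z. cmod z \<le> 1 \<Longrightarrow> cmod (poly G z) \<le> A"
    and "\<And>z. cmod z \<le> 1 \<Longrightarrow> cmod (poly H z) \<le> A"
    and "\<And>z w. cmod z \<le> 1 \<Longrightarrow> cmod w \<le> 1 \<Longrightarrow> cmod (poly G z - poly G w) \<le> A * cmod (z - w)"
    and "\<And>z w. cmod z \<le> 1 \<Longrightarrow> cmod w \<le> 1 \<Longrightarrow> cmod (poly H z - poly H w) \<le> A * cmod (z - w)"
    and "\<And>z. cmod z \<le> 1 \<Longrightarrow> cmod (poly G z ^ (j + 1) - poly H z ^ j) \<le> r ^ (j * (j + 1))"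
  obtains P where "P holomorphic_on ball 0 (1 / 2)"
    "\<And>z. cmod z \<le> 1 / 4 \<Longrightarrow> cmod (P z) \<le> 16 * A"
    "\<And>z. cmod z \<le> 1 / 8 \<Longrightarrow> cmod (poly G z) \<le> 2 * r ^ j \<Longrightarrow>
       cmod (P z) \<le> 100 * n * r * (1 + ln (65 * A\<^sup>2 / (r ^ j) ^ 3))"
    "\<And>z. cmod z \<le> 1 / 8 \<Longrightarrow> r ^ j / 2 \<le> cmod (poly G z) \<Longrightarrow>
       cmod (P z - poly H z / poly G z) \<le> 100 * n * r * (1 + ln (65 * A\<^sup>2 / (r ^ j) ^ 3))"
proof -
  define N where "N = nat \<lceil>64 * A\<^sup>2 / (r ^ j) ^ 3\<rceil>"
  have N: "64 * A\<^sup>2 / (r ^ j) ^ 3 \<le> real N" unfolding N_def by linarith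
  interpret grid_division G H n j N A r "r ^ j"
    by unfold_locales (use assms N in auto)
  have "1 \<le> A\<^sup>2 / (r ^ j) ^ 3"
  proof -
    have "(r ^ j) ^ 3 \<le> 1" "1 \<le> A\<^sup>2" using assms by (auto simp: power_le_one one_le_power)
    then show ?thesis using s_bounds by (simp add: field_simps)
  qed
  moreover have "real N \<le> 64 * A\<^sup>2 / (r ^ j) ^ 3 + 1"
  proof -
    have "0 \<le> 64 * A\<^sup>2 / (r ^ j) ^ 3" using s_bounds by simp
    then show ?thesis unfolding N_def by linarith
  qed
  ultimately have "real N \<le> 65 * A\<^sup>2 / (r ^ j) ^ 3" by linarith
  then have "ln (real N) \<le> ln (65 * A\<^sup>2 / (r ^ j) ^ 3)" using N_pos by simp
  then have le: "100 * n * r * (1 + ln (real N)) \<le> 100 * n * r * (1 + ln (65 * A\<^sup>2 / (r ^ j) ^ 3))"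
    using assms(5) by (intro mult_left_mono) auto
  show ?thesis
    by (rule that[of approx])
       (use approx_holomorphic approx_bound order_trans[OF approx_main(1) le] order_trans[OF approx_main(2)[unfolded quot_def] le] in auto)
qed

section \<open>Divided differences along segments\<close>

lemma power_div_fact_sum_le: "x \<ge> 0 \<Longrightarrow> (\<Sum>m<n. x ^ m / fact m) \<le> exp (x::real)"
proof -
  assume x: "x \<ge> 0"
  have s: "(\<lambda>m. x ^ m / fact m) sums exp x"
    using exp_converges[of x] by (simp add: divide_inverse mult.commute)
  have "(\<Sum>m<n. x ^ m / fact m) \<le> (\<Sum>m. x ^ m / fact m)"
    using x by (intro sum_le_suminf sums_summable[OF s]) auto
  then show ?thesis using s by (simp add: sums_iff)
qed

lemma power_div_fact_le: "x \<ge> 0 \<Longrightarrow> x ^ m / fact m \<le> exp (x::real)"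
proof -
  assume x: "x \<ge> 0"
  have "x ^ m / fact m \<le> (\<Sum>m<Suc m. x ^ m / fact m)"
    using x by (simp add: sum_nonneg)
  then show ?thesis using power_div_fact_sum_le[OF x, of "Suc m"] by linarith
qed

text \<open>The bound on the \<open>n\<close>-th derivative is integrated \<open>p\<close> times
  from 0, where all lower derivatives vanish; hence the index \<open>n - p\<close>.\<close>

lemma taylor_remainder_bound:
  fixes R :: "nat \<Rightarrow> real \<Rightarrow> complex"
  assumes d: "\<And>m x. m < n \<Longrightarrow> x \<in> {0..1} \<Longrightarrow> (R m has_vector_derivative R (Suc m) x) (at x within {0..1})"
    and z: "\<And>m. m < n \<Longrightarrow> R m 0 = 0"
    and b: "\<And>x. x \<in> {0..1} \<Longrightarrow> cmod (R n x) \<le> B"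
  shows "p \<le> n \<Longrightarrow> x \<in> {0..1} \<Longrightarrow> cmod (R (n - p) x) \<le> B * x ^ p / fact p"
proof (induction p arbitrary: x)
  case 0
  then show ?case using b by simp
next
  case (Suc p)
  define m where "m = n - Suc p"
  have m: "m < n" "Suc m = n - p" using Suc.prems by (auto simp: m_def)
  show ?case
  proof (cases "x = 0")
    case True
    then show ?thesis using z[OF m(1)] by (simp add: m_def)
  next
    case False
    then have x: "0 < x" "x \<le> 1" using Suc.prems by auto
    have "continuous_on {0..1} (R m)"
      unfolding continuous_on_eq_continuous_within
      using has_vector_derivative_continuous[OF d[OF m(1)]] by blast
    then have cont: "continuous_on {0..x} (R m)"
      by (rule continuous_on_subset) (use x in auto)
    have "cmod (R m x - R m 0) \<le> B * x ^ Suc p / fact (Suc p) - B * 0 ^ Suc p / fact (Suc p)"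
    proof (rule differentiable_bound_general[OF x(1) cont, where f' = "R (Suc m)" and \<phi>' = "\<lambda>t. B * t ^ p / fact p"])
      show "continuous_on {0..x} (\<lambda>t. B * t ^ Suc p / fact (Suc p))"
        by (intro continuous_intros) auto
      fix t assume t: "0 < t" "t < x"
      show "(R m has_vector_derivative R (Suc m) t) (at t)"
      proof -
        have "(R m has_vector_derivative R (Suc m) t) (at t within {0..1})" by (rule d[OF m(1)]) (use t x in auto)
        then have "(R m has_vector_derivative R (Suc m) t) (at t within {0<..<1})"
          by (rule has_vector_derivative_within_subset) auto
        moreover have "at t within {0<..<1} = at t" using t x by (intro at_within_open) auto
        ultimately show ?thesis by (simp only:)
      qed
      have "((\<lambda>t. t ^ Suc p) has_real_derivative real (Suc p) * t ^ p) (at t)"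
        using DERIV_pow[of "Suc p" t] by simp
      then have "((\<lambda>t. B * t ^ Suc p / fact (Suc p)) has_real_derivative B * (real (Suc p) * t ^ p) / fact (Suc p)) (at t)"
        by (intro DERIV_cdivide DERIV_cmult)
      also have "B * (real (Suc p) * t ^ p) / fact (Suc p) = B * t ^ p / fact p"
        by (simp add: divide_simps del: of_nat_Suc)
      finally show "((\<lambda>t. B * t ^ Suc p / fact (Suc p)) has_vector_derivative B * t ^ p / fact p) (at t)"
        by (simp add: has_real_derivative_iff_has_vector_derivative)
      show "cmod (R (Suc m) t) \<le> B * t ^ p / fact p"
        unfolding m(2) using Suc.prems t x by (intro Suc.IH) auto
    qed
    then show ?thesis using z[OF m(1)] by (simp add: m_def)
  qed
qed

text \<open>Decay along the segment forces a zero of order \<open>n\<close> at 0: in each step the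
  remaining factor tends to 0 there and gives up one factor \<open>x\<close>.\<close>

lemma poly_monom_factor:
  fixes p :: "complex poly"
  assumes "\<And>x. 0 < x \<Longrightarrow> x \<le> 1 \<Longrightarrow> cmod (poly p (of_real x)) \<le> K * x ^ n"
  shows "\<exists>q. p = monom 1 n * q"
  using assms
proof (induction n)
  case 0
  then show ?case by (intro exI[of _ p]) (simp add: monom_0)
next
  case (Suc n)
  have "0 \<le> K" using order_trans[OF norm_ge_zero Suc.prems[of 1]] by simp
  have "cmod (poly p (of_real x)) \<le> K * x ^ n" if "0 < x" "x \<le> 1" for x
  proof -
    have "K * x ^ Suc n \<le> K * x ^ n"
      using that \<open>0 \<le> K\<close> by (intro mult_left_mono) (auto simp: mult_left_le_one_le)
    then show ?thesis using Suc.prems[OF that] by linarith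
  qed
  then obtain q where q: "p = monom 1 n * q" using Suc.IH by blast
  have bound: "cmod (poly q (of_real x)) \<le> K * x" if "0 < x" "x \<le> 1" for x
  proof -
    have "x ^ n * cmod (poly q (of_real x)) \<le> x ^ n * (K * x)"
      using Suc.prems[OF that] that by (simp add: q poly_monom norm_mult norm_power mult_ac)
    then show ?thesis using that by simp
  qed
  have "((\<lambda>x. cmod (poly q (of_real x))) \<longlongrightarrow> cmod (poly q (of_real 0))) (at_right 0)"
    by (intro tendsto_intros)
  moreover have "((\<lambda>x. K * x) \<longlongrightarrow> K * 0) (at_right (0::real))" by (intro tendsto_intros)
  moreover have "eventually (\<lambda>x. cmod (poly q (of_real x)) \<le> K * x) (at_right 0)"
    unfolding eventually_at_right_field using bound by (intro exI[of _ 1]) auto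
  ultimately have "cmod (poly q (of_real 0)) \<le> K * 0"
    by (intro tendsto_le[OF trivial_limit_at_right_real]) 
  then have "poly q 0 = 0" by simp
  then obtain q' where "q = [:0, 1:] * q'" by (auto simp: poly_eq_0_iff_dvd elim: dvdE)
  then have "p = monom 1 (Suc n) * q'" by (simp add: q monom_Suc mult_ac)
  then show ?case by blast
qed

text \<open>Schwarz lemma: the maximum principle for the quotient by \<open>z ^ n\<close>. Of the
  bound on the segment only the order of vanishing survives; \<open>K\<close> does not enter the
  conclusion.\<close>

lemma poly_vanishing_bound:
  fixes p :: "complex poly"
  assumes "\<And>x. 0 < x \<Longrightarrow> x \<le> 1 \<Longrightarrow> cmod (poly p (of_real x)) \<le> K * x ^ n"
    and B: "\<And>z. cmod z = 1 \<Longrightarrow> cmod (poly p z) \<le> B"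
    and z: "cmod z \<le> 1"
  shows "cmod (poly p z) \<le> B * cmod z ^ n"
proof -
  obtain q where q: "p = monom 1 n * q" using poly_monom_factor assms(1) by blast
  have "cmod (poly q z) \<le> B"
  proof (rule maximum_modulus_frontier[of "poly q" "cball 0 1"])
    show "cmod (poly q w) \<le> B" if "w \<in> frontier (cball 0 1)" for w
      using B[of w] that by (simp add: q poly_monom norm_mult norm_power)
  qed (use z in \<open>auto intro!: holomorphic_intros continuous_intros\<close>)
  then have "cmod z ^ n * cmod (poly q z) \<le> cmod z ^ n * B" by (rule mult_left_mono) simp
  then show ?thesis by (simp add: q poly_monom norm_mult norm_power mult.commute)
qed

definition taylor_poly :: "nat \<Rightarrow> (nat \<Rightarrow> complex) \<Rightarrow> complex poly" where
  "taylor_poly n c = (\<Sum>m<n. monom (c m / fact m) m)"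

lemma poly_taylor_poly: "poly (taylor_poly n c) z = (\<Sum>m<n. c m / fact m * z ^ m)"
  by (simp add: taylor_poly_def poly_sum poly_monom)

lemma coeff_taylor_poly: "coeff (taylor_poly n c) m = (if m < n then c m / fact m else 0)"
  by (auto simp: taylor_poly_def coeff_sum)

lemma degree_taylor_poly: "degree (taylor_poly n c) \<le> n"
  by (rule degree_le) (simp add: coeff_taylor_poly)

text \<open>With derivatives bounded by \<open>n ^ m\<close>, the coefficients are dominated by
  those of \<open>exp (n * x)\<close>.\<close>

lemma taylor_poly_norm_bound:
  assumes c: "\<And>m. m < n \<Longrightarrow> cmod (c m) \<le> real n ^ m" and z: "cmod z \<le> 1"
  shows "cmod (poly (taylor_poly n c) z) \<le> exp n"
proof -
  have "cmod (poly (taylor_poly n c) z) \<le> (\<Sum>m<n. real n ^ m / fact m)"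
    unfolding poly_taylor_poly
  proof (rule sum_norm_le)
    fix m assume m: "m \<in> {..<n}"
    have "cmod (c m / fact m * z ^ m) = cmod (c m) / fact m * cmod z ^ m"
      by (simp add: norm_mult norm_divide norm_power)
    also have "\<dots> \<le> real n ^ m / fact m * 1"
      using c m z by (intro mult_mono divide_right_mono power_le_one) auto
    finally show "cmod (c m / fact m * z ^ m) \<le> real n ^ m / fact m" by simp
  qed
  also have "\<dots> \<le> exp n" by (rule power_div_fact_sum_le) simp
  finally show ?thesis .
qed

lemma taylor_poly_lipschitz:
  assumes c: "\<And>m. m < n \<Longrightarrow> cmod (c m) \<le> real n ^ m" and z: "cmod z \<le> 1" and w: "cmod w \<le> 1"
  shows "cmod (poly (taylor_poly n c) z - poly (taylor_poly n c) w) \<le> exp (2 * n) * cmod (z - w)"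
proof -
  have "cmod (poly (taylor_poly n c) z - poly (taylor_poly n c) w) =
     cmod (\<Sum>m<n. c m / fact m * (z ^ m - w ^ m))"
    by (simp add: poly_taylor_poly sum_subtractf right_diff_distrib)
  also have "\<dots> \<le> (\<Sum>m<n. real n ^ m / fact m * (n * cmod (z - w)))"
  proof (rule sum_norm_le)
    fix m assume m: "m \<in> {..<n}"
    have "cmod (c m / fact m * (z ^ m - w ^ m)) = cmod (c m) / fact m * cmod (z ^ m - w ^ m)"
      by (simp add: norm_mult norm_divide)
    also have "\<dots> \<le> real n ^ m / fact m * (n * cmod (z - w))"
    proof (intro mult_mono divide_right_mono)
      have "cmod (z ^ m - w ^ m) \<le> m * cmod (z - w)" by (rule norm_power_diff[OF z w])
      also have "\<dots> \<le> n * cmod (z - w)" using m by (intro mult_right_mono) auto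
      finally show "cmod (z ^ m - w ^ m) \<le> n * cmod (z - w)" .
    qed (use c m in auto)
    finally show "cmod (c m / fact m * (z ^ m - w ^ m)) \<le> real n ^ m / fact m * (n * cmod (z - w))" .
  qed
  also have "\<dots> = (\<Sum>m<n. real n ^ m / fact m) * (n * cmod (z - w))" by (simp add: sum_distrib_right)
  also have "\<dots> \<le> exp n * (exp n * cmod (z - w))"
  proof (intro mult_mono power_div_fact_sum_le mult_right_mono)
    show "real n \<le> exp (real n)" using exp_ge_add_one_self[of "real n"] by linarith
  qed (auto intro: sum_nonneg)
  also have "\<dots> = exp (2 * real n) * cmod (z - w)" by (simp add: mult_exp_exp flip: mult.assoc)
  finally show ?thesis .
qed

lemma taylor_poly_remainder:
  fixes \<gamma> :: "nat \<Rightarrow> real \<Rightarrow> complex"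
  assumes d: "\<And>m x. m < n \<Longrightarrow> x \<in> {0..1} \<Longrightarrow> (\<gamma> m has_vector_derivative \<gamma> (Suc m) x) (at x within {0..1})"
    and b: "\<And>x. x \<in> {0..1} \<Longrightarrow> cmod (\<gamma> n x) \<le> real n ^ n"
    and x: "x \<in> {0..1}"
  shows "cmod (\<gamma> 0 x - poly (taylor_poly n (\<lambda>m. \<gamma> m 0)) (of_real x)) \<le> exp n * x ^ n"
proof -
  define G where "G = taylor_poly n (\<lambda>m. \<gamma> m 0)"
  define R where "R m x = \<gamma> m x - poly ((pderiv ^^ m) G) (of_real x)" for m and x :: real
  have "cmod (R (n - n) x) \<le> real n ^ n * x ^ n / fact n"
  proof (rule taylor_remainder_bound[where R = R])
    show "(R m has_vector_derivative R (Suc m) x) (at x within {0..1})" if "m < n" "x \<in> {0..1}" for m x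
      unfolding R_def
      by (intro has_vector_derivative_diff d that has_vector_derivative_real_field)
         (auto intro!: derivative_eq_intros poly_DERIV)
    show "R m 0 = 0" if "m < n" for m
    proof -
      have "poly ((pderiv ^^ m) G) 0 = fact m * coeff G m"
        by (simp add: poly_0_coeff_0 coeff_higher_pderiv pochhammer_fact)
      then show ?thesis using that by (simp add: R_def G_def coeff_taylor_poly)
    qed
    show "cmod (R n x) \<le> real n ^ n" if "x \<in> {0..1}" for x
    proof -
      have "(pderiv ^^ n) G = 0"
        by (rule poly_eqI) (simp add: coeff_higher_pderiv G_def coeff_taylor_poly)
      then show ?thesis using b[OF that] by (simp add: R_def)
    qed
  qed (use x in auto)
  also have "\<dots> = (real n ^ n / fact n) * x ^ n" by simp
  also have "\<dots> \<le> exp n * x ^ n" using x by (intro mult_right_mono power_div_fact_le) auto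
  finally show ?thesis by (simp add: R_def G_def)
qed


section \<open>Approximating the root of two powers at scale \<open>l\<close>\<close>

definition rate :: "nat \<Rightarrow> real" where "rate j = exp (real j + 2)"

text \<open>At scale \<open>l\<close> the approximation is used with \<open>r = (rate j * l) ^ (4 * k)\<close>. Half of this exponent pays for
  the factor \<open>n * ln (1 / r)\<close>; the other half leaves \<open>(C * l\<^sup>2) ^ k\<close>.\<close>
definition jet_order :: "nat \<Rightarrow> nat \<Rightarrow> nat" where "jet_order j k = 4 * j * (j + 1) * k"

lemma rate_ge: "rate j \<ge> 1" "rate j > 0" "ln (rate j) = real j + 2"
  by (auto simp: rate_def)

text \<open>What the approximation needs of the Taylor polynomials of \<open>f ^ j\<close> and
  \<open>f ^ (j + 1)\<close>. Since \<open>f\<close> itself does not occur, it can be stated for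
  complex arguments.\<close>

definition power_pair :: "nat \<Rightarrow> nat \<Rightarrow> complex poly \<Rightarrow> complex poly \<Rightarrow> bool" where
  "power_pair j k G H \<longleftrightarrow> degree G \<le> jet_order j k \<and>
     (\<forall>z. cmod z \<le> 1 \<longrightarrow> cmod (poly G z) \<le> rate j ^ jet_order j k \<and>
        cmod (poly H z) \<le> rate j ^ jet_order j k \<and>
        cmod (poly G z ^ (j + 1) - poly H z ^ j) \<le> (rate j * cmod z) ^ jet_order j k) \<and>
     (\<forall>z w. cmod z \<le> 1 \<longrightarrow> cmod w \<le> 1 \<longrightarrow>
        cmod (poly G z - poly G w) \<le> rate j ^ jet_order j k * cmod (z - w) \<and>
        cmod (poly H z - poly H w) \<le> rate j ^ jet_order j k * cmod (z - w))"

text \<open>Here \<open>r = \<rho>\<^sup>2\<close>. One factor \<open>\<rho>\<close> absorbs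
  \<open>- ln \<rho> \<le> 1 / \<rho>\<close> and the other remains. The polynomial loss
  \<open>k\<^sup>2\<close> is at most \<open>4 ^ k\<close>.\<close>

lemma error_estimate:
  fixes j k :: nat and \<rho> :: real
  assumes j: "j \<ge> 1" and k: "k \<ge> 1" and \<rho>: "0 < \<rho>" "\<rho> \<le> 1"
  defines "a \<equiv> real (4 * j * (j + 1))"
  shows "100 * real (jet_order j k) * \<rho>\<^sup>2 * (1 + ln (65 * (rate j ^ jet_order j k)\<^sup>2 / ((\<rho>\<^sup>2) ^ j) ^ 3))
     \<le> (4 * (100 * a * (65 + 2 * a * (real j + 2) + 6 * real j))) ^ k * \<rho>"
proof -
  define n where "n = real (jet_order j k)"
  define c where "c = 100 * a * (65 + 2 * a * (real j + 2) + 6 * real j)"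
  have "1 \<le> 4 * j * (j + 1)" using j by simp
  then have a: "a \<ge> 1" unfolding a_def by linarith
  have n: "n = a * real k" by (simp add: n_def jet_order_def a_def)
  have c: "c \<ge> 1"
  proof -
    have "1 * 1 \<le> (100 * a) * (65 + 2 * a * (real j + 2) + 6 * real j)"
      using a by (intro mult_mono) auto
    then show ?thesis by (simp add: c_def)
  qed
  have "ln (65 * (rate j ^ jet_order j k)\<^sup>2 / ((\<rho>\<^sup>2) ^ j) ^ 3)
      = ln 65 + 2 * (n * (real j + 2)) - 6 * real j * ln \<rho>"
    using \<rho> rate_ge[of j] by (simp add: ln_div ln_mult ln_realpow n_def)
  also have "\<dots> \<le> 64 + 2 * (n * (real j + 2)) + 6 * real j * (1 / \<rho>)"
  proof -
    have "ln (65::real) \<le> 64" using ln_le_minus_one[of "65::real"] by simp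
    moreover have "- ln \<rho> \<le> 1 / \<rho>"
      using ln_le_minus_one[of "1 / \<rho>"] \<rho> by (simp add: ln_div)
    then have "6 * real j * (- ln \<rho>) \<le> 6 * real j * (1 / \<rho>)" by (intro mult_left_mono) auto
    ultimately show ?thesis by simp
  qed
  finally have "\<rho>\<^sup>2 * (1 + ln (65 * (rate j ^ jet_order j k)\<^sup>2 / ((\<rho>\<^sup>2) ^ j) ^ 3))
      \<le> \<rho>\<^sup>2 * (65 + 2 * (n * (real j + 2)) + 6 * real j * (1 / \<rho>))"
    by (intro mult_left_mono) auto
  also have "\<dots> = \<rho> * (\<rho> * (65 + 2 * (n * (real j + 2))) + 6 * real j)"
    using \<rho> by (simp add: power2_eq_square field_simps)
  also have "\<dots> \<le> \<rho> * (1 * (65 + 2 * (n * (real j + 2))) + 6 * real j)"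
    using \<rho> a by (intro mult_left_mono add_mono mult_right_mono) (auto simp: n)
  also have "\<dots> \<le> \<rho> * (real k * (65 + 2 * a * (real j + 2) + 6 * real j))"
  proof (rule mult_left_mono)
    have "65 + 6 * real j \<le> real k * (65 + 6 * real j)"
      using k mult_right_mono[of 1 "real k" "65 + 6 * real j"] by simp
    then show "1 * (65 + 2 * (n * (real j + 2))) + 6 * real j \<le> real k * (65 + 2 * a * (real j + 2) + 6 * real j)"
      by (simp add: n algebra_simps)
  qed (use \<rho> in auto)
  finally have "100 * n * (\<rho>\<^sup>2 * (1 + ln (65 * (rate j ^ jet_order j k)\<^sup>2 / ((\<rho>\<^sup>2) ^ j) ^ 3)))
      \<le> 100 * n * (\<rho> * (real k * (65 + 2 * a * (real j + 2) + 6 * real j)))"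
    using a by (intro mult_left_mono) (auto simp: n)
  also have "\<dots> = (real k * real k) * c * \<rho>" by (simp add: n c_def algebra_simps)
  also have "\<dots> \<le> (2 ^ k * 2 ^ k) * c ^ k * \<rho>"
  proof -
    have "real k \<le> 2 ^ k" using of_nat_less_two_power[of k, where 'a = real] by simp
    moreover have "c \<le> c ^ k" using c k by (simp add: self_le_power)
    ultimately show ?thesis using \<rho> c by (intro mult_right_mono mult_mono) auto
  qed
  also have "\<dots> = (4 * c) ^ k * \<rho>"
  proof -
    have "(2::real) ^ k * 2 ^ k = (2 * 2) ^ k" by (simp only: power_mult_distrib)
    then show ?thesis by (simp add: power_mult_distrib)
  qed
  finally show ?thesis by (simp add: n_def c_def mult.assoc)
qed

text \<open>The result at unit scale for \<open>G\<close> and \<open>H\<close> at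
  \<open>l * z\<close>, with \<open>r = (rate j * l) ^ (4 * k)\<close>. Then
  \<open>r ^ (j * (j + 1))\<close> is exactly the bound for \<open>G ^ (j + 1) - H ^ j\<close> on
  the disc of radius \<open>l\<close>.\<close>

lemma approximate_quotient:
  assumes j: "j \<ge> 1"
  shows "\<exists>C\<ge>1. \<forall>k\<ge>1. \<forall>G H l. power_pair j k G H \<longrightarrow> 0 < l \<longrightarrow> rate j * l \<le> 1 \<longrightarrow>
    (\<exists>P. P holomorphic_on ball 0 (l / 2) \<and> (\<forall>z. cmod z \<le> l / 4 \<longrightarrow> cmod (P z) \<le> C ^ k) \<and>
       (\<forall>z. cmod z \<le> l / 8 \<longrightarrow>
          (cmod (poly G z) \<le> 2 * (rate j * l) ^ (4 * j * k) \<longrightarrow> cmod (P z) \<le> (C * l\<^sup>2) ^ k) \<and>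
          ((rate j * l) ^ (4 * j * k) / 2 \<le> cmod (poly G z) \<longrightarrow>
             cmod (P z - poly H z / poly G z) \<le> (C * l\<^sup>2) ^ k)))"
proof -
  define a where "a = 4 * j * (j + 1)"
  define D where "D = rate j"
  define c where "c = 4 * (100 * real a * (65 + 2 * real a * (real j + 2) + 6 * real j))"
  \<comment> \<open>The first summand serves the error estimate, the second the sup bound
    \<open>16 * D ^ n\<close> with \<open>n = a * k\<close>.\<close>
  define C where "C = c * D\<^sup>2 + 16 * D ^ a"
  have D: "D \<ge> 1" by (simp add: D_def rate_ge)
  have c: "c \<ge> 0" by (simp add: c_def)
  have C: "C \<ge> 1" "C \<ge> 16 * D ^ a" "C \<ge> c * D\<^sup>2"
  proof -
    have "D ^ a \<ge> 1" "0 \<le> c * D\<^sup>2" using D c by (auto simp: one_le_power)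
    then show "C \<ge> 1" "C \<ge> 16 * D ^ a" "C \<ge> c * D\<^sup>2" unfolding C_def by linarith+
  qed
  have "\<exists>P. P holomorphic_on ball 0 (l / 2) \<and> (\<forall>z. cmod z \<le> l / 4 \<longrightarrow> cmod (P z) \<le> C ^ k) \<and>
       (\<forall>z. cmod z \<le> l / 8 \<longrightarrow>
          (cmod (poly G z) \<le> 2 * (rate j * l) ^ (4 * j * k) \<longrightarrow> cmod (P z) \<le> (C * l\<^sup>2) ^ k) \<and>
          ((rate j * l) ^ (4 * j * k) / 2 \<le> cmod (poly G z) \<longrightarrow>
             cmod (P z - poly H z / poly G z) \<le> (C * l\<^sup>2) ^ k))"
    if k: "k \<ge> 1" and GH: "power_pair j k G H" and l: "0 < l" "rate j * l \<le> 1" for k G H l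
  proof -
    define n where "n = jet_order j k"
    have n: "n = a * k" by (simp add: n_def jet_order_def a_def)
    have n1: "n \<ge> 1" using k j by (simp add: n a_def)
    define \<rho> where "\<rho> = (D * l) ^ (2 * k)"
    have \<rho>: "0 < \<rho>" "\<rho> \<le> 1" using l D by (auto simp: \<rho>_def D_def power_le_one)
    have l1: "l \<le> 1" using l D mult_right_mono[of 1 D l] unfolding D_def by linarith
    have lz: "cmod (of_real l * z) \<le> 1" if "cmod z \<le> 1" for z
      using that l l1 by (simp add: norm_mult mult_le_one)
    have GHD: "degree G \<le> n" "\<And>z. cmod z \<le> 1 \<Longrightarrow> cmod (poly G z) \<le> D ^ n"
        "\<And>z. cmod z \<le> 1 \<Longrightarrow> cmod (poly H z) \<le> D ^ n"
        "\<And>z. cmod z \<le> 1 \<Longrightarrow> cmod (poly G z ^ (j + 1) - poly H z ^ j) \<le> (D * cmod z) ^ n"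
        "\<And>z w. cmod z \<le> 1 \<Longrightarrow> cmod w \<le> 1 \<Longrightarrow> cmod (poly G z - poly G w) \<le> D ^ n * cmod (z - w)"
        "\<And>z w. cmod z \<le> 1 \<Longrightarrow> cmod w \<le> 1 \<Longrightarrow> cmod (poly H z - poly H w) \<le> D ^ n * cmod (z - w)"
      using GH unfolding power_pair_def n_def D_def by blast+
    define G' where "G' = pcompose G [:0, of_real l:]"
    define H' where "H' = pcompose H [:0, of_real l:]"
    have p': "poly G' z = poly G (of_real l * z)" "poly H' z = poly H (of_real l * z)" for z
      by (auto simp: G'_def H'_def poly_pcompose mult.commute)
    have lip: "D ^ n * cmod (of_real l * z - of_real l * w) \<le> D ^ n * cmod (z - w)" for z w :: complex
    proof -
      have "cmod (of_real l * z - of_real l * w) = l * cmod (z - w)"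
        using l by (simp add: norm_mult flip: right_diff_distrib)
      also have "\<dots> \<le> cmod (z - w)" using l1 l by (simp add: mult_left_le_one_le)
      finally show ?thesis using D by (intro mult_left_mono) auto
    qed
    obtain P where P: "P holomorphic_on ball 0 (1 / 2)"
      "\<And>z. cmod z \<le> 1 / 4 \<Longrightarrow> cmod (P z) \<le> 16 * D ^ n"
      "\<And>z. cmod z \<le> 1 / 8 \<Longrightarrow> cmod (poly G' z) \<le> 2 * (\<rho>\<^sup>2) ^ j \<Longrightarrow>
         cmod (P z) \<le> 100 * n * \<rho>\<^sup>2 * (1 + ln (65 * (D ^ n)\<^sup>2 / ((\<rho>\<^sup>2) ^ j) ^ 3))"
      "\<And>z. cmod z \<le> 1 / 8 \<Longrightarrow> (\<rho>\<^sup>2) ^ j / 2 \<le> cmod (poly G' z) \<Longrightarrow>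
         cmod (P z - poly H' z / poly G' z) \<le> 100 * n * \<rho>\<^sup>2 * (1 + ln (65 * (D ^ n)\<^sup>2 / ((\<rho>\<^sup>2) ^ j) ^ 3))"
    proof (rule approximate_quotient_unit[of G' n j "D ^ n" "\<rho>\<^sup>2" H'])
      show "degree G' \<le> n" using GHD(1) by (simp add: G'_def degree_pcompose)
      show "cmod (poly G' z ^ (j + 1) - poly H' z ^ j) \<le> (\<rho>\<^sup>2) ^ (j * (j + 1))" if "cmod z \<le> 1" for z
      proof -
        have "cmod (poly G' z ^ (j + 1) - poly H' z ^ j) \<le> (D * cmod (of_real l * z)) ^ n"
          unfolding p' by (rule GHD(4)[OF lz[OF that]])
        also have "\<dots> \<le> (D * l) ^ n"
          using that l D by (intro power_mono mult_left_mono) (auto simp: norm_mult mult_left_le)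
        also have "\<dots> = (\<rho>\<^sup>2) ^ (j * (j + 1))"
          by (simp add: \<rho>_def n a_def flip: power_mult) (simp add: algebra_simps)
        finally show ?thesis .
      qed
      show "cmod (poly G' z - poly G' w) \<le> D ^ n * cmod (z - w)" if "cmod z \<le> 1" "cmod w \<le> 1" for z w
        unfolding p' using GHD(5)[OF lz lz, OF that] lip order_trans by blast
      show "cmod (poly H' z - poly H' w) \<le> D ^ n * cmod (z - w)" if "cmod z \<le> 1" "cmod w \<le> 1" for z w
        unfolding p' using GHD(6)[OF lz lz, OF that] lip order_trans by blast
    qed (use n1 j D \<rho> GHD lz p' in \<open>auto simp: power_le_one one_le_power\<close>)
    have err: "100 * n * \<rho>\<^sup>2 * (1 + ln (65 * (D ^ n)\<^sup>2 / ((\<rho>\<^sup>2) ^ j) ^ 3)) \<le> (C * l\<^sup>2) ^ k"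
    proof -
      have "100 * n * \<rho>\<^sup>2 * (1 + ln (65 * (D ^ n)\<^sup>2 / ((\<rho>\<^sup>2) ^ j) ^ 3)) \<le> c ^ k * \<rho>"
        using error_estimate[OF j k \<rho>] unfolding c_def D_def n_def a_def
        by (simp only: of_nat_mult of_nat_numeral)
      also have "\<dots> = (c * D\<^sup>2 * l\<^sup>2) ^ k" by (simp add: \<rho>_def power_mult power_mult_distrib)
      also have "\<dots> \<le> (C * l\<^sup>2) ^ k" using C c by (intro power_mono mult_right_mono) auto
      finally show ?thesis .
    qed
    define P' where "P' z = P (z / of_real l)" for z
    have sc: "cmod (z / of_real l) \<le> t" if "cmod z \<le> l * t" for z t
      using that l by (simp add: norm_divide field_simps)
    have hol: "P' holomorphic_on ball 0 (l / 2)"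
    proof -
      have "(P \<circ> (\<lambda>z. z / of_real l)) holomorphic_on ball 0 (l / 2)"
      proof (rule holomorphic_on_compose_gen[OF _ P(1)])
        show "(\<lambda>z. z / of_real l) holomorphic_on ball 0 (l / 2)"
          using l by (intro holomorphic_intros) auto
        show "(\<lambda>z::complex. z / of_real l) ` ball 0 (l / 2) \<subseteq> ball 0 (1 / 2)"
        proof (rule image_subsetI)
          fix z :: complex assume "z \<in> ball 0 (l / 2)"
          then have "cmod z < l / 2" by (simp add: dist_norm)
          then have "cmod (z / of_real l) < 1 / 2" using l by (simp add: norm_divide field_simps)
          then show "z / of_real l \<in> ball 0 (1 / 2)" by (simp add: dist_norm)
        qed
      qed
      then show ?thesis by (simp add: P'_def[abs_def] o_def)
    qed
    have bnd: "cmod (P' z) \<le> C ^ k" if "cmod z \<le> l / 4" for z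
    proof -
      have "cmod (P' z) \<le> 16 * D ^ n" unfolding P'_def by (rule P(2)) (use sc[of z "1 / 4"] that in simp)
      also have "\<dots> \<le> 16 ^ k * (D ^ a) ^ k"
        using k D by (simp add: n power_mult self_le_power)
      also have "\<dots> = (16 * D ^ a) ^ k" by (simp add: power_mult_distrib)
      also have "\<dots> \<le> C ^ k" using C D by (intro power_mono) auto
      finally show ?thesis .
    qed
    have thr: "(rate j * l) ^ (4 * j * k) = (\<rho>\<^sup>2) ^ j"
      by (simp add: \<rho>_def D_def flip: power_mult) (simp add: algebra_simps)
    have unscale: "poly G' (z / of_real l) = poly G z" "poly H' (z / of_real l) = poly H z" for z
      using l by (auto simp: p')
    show ?thesis
    proof (intro exI[of _ P'] conjI allI impI hol bnd)
      fix z assume z: "cmod z \<le> l / 8"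
      then have z8: "cmod (z / of_real l) \<le> 1 / 8" using sc[of z "1 / 8"] by simp
      show "cmod (P' z) \<le> (C * l\<^sup>2) ^ k" if "cmod (poly G z) \<le> 2 * (rate j * l) ^ (4 * j * k)"
        using P(3)[OF z8] that err unfolding unscale thr P'_def by linarith
      show "cmod (P' z - poly H z / poly G z) \<le> (C * l\<^sup>2) ^ k"
        if "(rate j * l) ^ (4 * j * k) / 2 \<le> cmod (poly G z)"
        using P(4)[OF z8] that err unfolding unscale thr P'_def by linarith
    qed
  qed
  then show ?thesis using C(1) by blast
qed

text \<open>The point is that \<open>u\<close> is chosen before \<open>l\<close>. It links the
  approximations of different scales on a complex disc, where \<open>f\<close> cannot do so because
  it lives on the real segment only.\<close>

lemma approximate_power_root:
  assumes j: "j \<ge> 1"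
  shows "\<exists>C\<ge>1. \<forall>k\<ge>1. \<forall>G H. \<forall>f :: real \<Rightarrow> complex. power_pair j k G H \<longrightarrow>
    (\<forall>x\<in>{0..1}. cmod (f x) \<le> 1 \<and> cmod (f x ^ j - poly G (of_real x)) \<le> (rate j * x) ^ jet_order j k \<and>
        cmod (f x ^ (j + 1) - poly H (of_real x)) \<le> (rate j * x) ^ jet_order j k) \<longrightarrow>
    (\<exists>u. \<forall>l. 0 < l \<longrightarrow> rate j * l \<le> 1 \<longrightarrow>
      (\<exists>P. P holomorphic_on ball 0 (l / 2) \<and> (\<forall>z. cmod z \<le> l / 4 \<longrightarrow> cmod (P z) \<le> C ^ k) \<and>
       (\<forall>z. cmod z \<le> l / 8 \<longrightarrow> cmod (P z - u z) \<le> (C * l\<^sup>2) ^ k) \<and>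
       (\<forall>x. 0 \<le> x \<longrightarrow> x \<le> l / 8 \<longrightarrow> cmod (f x - P (of_real x)) \<le> (C * l\<^sup>2) ^ k)))"
proof -
  define D where "D = rate j"
  have D: "D \<ge> 1" by (simp add: D_def rate_ge)
  obtain C0 where C0: "C0 \<ge> 1" and AQ: "\<And>k G H l. k \<ge> 1 \<Longrightarrow> power_pair j k G H \<Longrightarrow> 0 < l \<Longrightarrow> D * l \<le> 1 \<Longrightarrow>
    (\<exists>P. P holomorphic_on ball 0 (l / 2) \<and> (\<forall>z. cmod z \<le> l / 4 \<longrightarrow> cmod (P z) \<le> C0 ^ k) \<and>
       (\<forall>z. cmod z \<le> l / 8 \<longrightarrow>
          (cmod (poly G z) \<le> 2 * (D * l) ^ (4 * j * k) \<longrightarrow> cmod (P z) \<le> (C0 * l\<^sup>2) ^ k) \<and>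
          ((D * l) ^ (4 * j * k) / 2 \<le> cmod (poly G z) \<longrightarrow>
             cmod (P z - poly H z / poly G z) \<le> (C0 * l\<^sup>2) ^ k)))"
    using approximate_quotient[OF j] unfolding D_def by blast
  \<comment> \<open>5 = 3 + 2, from comparing \<open>P\<close> with \<open>u\<close> and
    \<open>u\<close> with \<open>f\<close>; since \<open>k \<ge> 1\<close> the factor may go inside
    the power.\<close>
  define C where "C = 5 * (C0 + D\<^sup>2)"
  have C: "C \<ge> 1" 
  proof -
    have "5 * (1 + 0) \<le> 5 * (C0 + D\<^sup>2)" using C0 by (intro mult_left_mono add_mono) auto
    then show ?thesis unfolding C_def by simp
  qed
  show ?thesis
  proof (rule exI[of _ C], rule conjI[OF C], intro allI impI)
    fix k :: nat and G H and f :: "real \<Rightarrow> complex"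
    assume k: "k \<ge> 1" and GH: "power_pair j k G H"
      and f: "\<forall>x\<in>{0..1}. cmod (f x) \<le> 1 \<and> cmod (f x ^ j - poly G (of_real x)) \<le> (rate j * x) ^ jet_order j k \<and>
        cmod (f x ^ (j + 1) - poly H (of_real x)) \<le> (rate j * x) ^ jet_order j k"
    define n where "n = jet_order j k"
    \<comment> \<open>The threshold depends on the modulus of \<open>z\<close> and not on
      \<open>l\<close>, which makes \<open>u\<close> common to all scales. For
      \<open>cmod z \<le> l / 8\<close> it does not exceed the threshold \<open>s\<close> of scale
      \<open>l\<close>.\<close>
    define u where "u z = (if (D * cmod z) ^ (4 * j * k) \<le> cmod (poly G z) then poly H z / poly G z else 0)" for z
    show "\<exists>u. \<forall>l. 0 < l \<longrightarrow> rate j * l \<le> 1 \<longrightarrow>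
      (\<exists>P. P holomorphic_on ball 0 (l / 2) \<and> (\<forall>z. cmod z \<le> l / 4 \<longrightarrow> cmod (P z) \<le> C ^ k) \<and>
       (\<forall>z. cmod z \<le> l / 8 \<longrightarrow> cmod (P z - u z) \<le> (C * l\<^sup>2) ^ k) \<and>
       (\<forall>x. 0 \<le> x \<longrightarrow> x \<le> l / 8 \<longrightarrow> cmod (f x - P (of_real x)) \<le> (C * l\<^sup>2) ^ k))"
    proof (rule exI[of _ u], intro allI impI)
      fix l assume l: "0 < l" "rate j * l \<le> 1"
      define T where "T = D * l"
      have T: "0 < T" "T \<le> 1" using l D by (auto simp: T_def D_def)
      have l1: "l \<le> 1" using l D mult_right_mono[of 1 D l] unfolding D_def by linarith
      define s where "s = T ^ (4 * j * k)"
      define r where "r = T ^ (4 * k)"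
      have s: "0 < s" "s \<le> 1" using T by (auto simp: s_def power_le_one)
      have r: "0 < r" "r \<le> T ^ (2 * k)" using T by (auto simp: r_def intro: power_decreasing)
      have sr: "s = r ^ j" by (simp add: s_def r_def flip: power_mult) (simp add: algebra_simps)
      have two: "2 * s \<le> (2 * r) ^ j"
        using r(1) j mult_right_mono[of 2 "2 ^ j" s] self_le_power[of "2::real" j] s
        by (simp add: sr power_mult_distrib)
      define X where "X = ((C0 + D\<^sup>2) * l\<^sup>2) ^ k"
      have X0: "(C0 * l\<^sup>2) ^ k \<le> X" unfolding X_def using C0 by (intro power_mono mult_right_mono) auto
      have XT: "T ^ (2 * k) \<le> X"
      proof -
        have "T ^ (2 * k) = (D\<^sup>2 * l\<^sup>2) ^ k" by (simp add: T_def power_mult power_mult_distrib)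
        also have "\<dots> \<le> X" unfolding X_def using C0 by (intro power_mono mult_right_mono) auto
        finally show ?thesis .
      qed
      have X: "0 \<le> X" using order_trans[OF _ XT] T by simp
      have CX: "5 * X \<le> (C * l\<^sup>2) ^ k"
      proof -
        have "5 * X \<le> 5 ^ k * X" using k X by (intro mult_right_mono) (auto simp: self_le_power)
        also have "\<dots> = (C * l\<^sup>2) ^ k" by (simp only: X_def C_def power_mult_distrib mult.assoc)
        finally show ?thesis .
      qed
      obtain P where P: "P holomorphic_on ball 0 (l / 2)" "\<And>z. cmod z \<le> l / 4 \<Longrightarrow> cmod (P z) \<le> C0 ^ k"
        "\<And>z. cmod z \<le> l / 8 \<Longrightarrow> cmod (poly G z) \<le> 2 * s \<Longrightarrow> cmod (P z) \<le> X"
        "\<And>z. cmod z \<le> l / 8 \<Longrightarrow> s / 2 \<le> cmod (poly G z) \<Longrightarrow> cmod (P z - poly H z / poly G z) \<le> X"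
        using AQ[OF k GH l(1) l(2)[folded D_def]] order_trans[OF _ X0] unfolding s_def T_def by blast
      have small_root: "cmod w \<le> 2 * T ^ (2 * k)" if "cmod w ^ j \<le> 2 * s" for w
      proof -
        have "cmod w ^ j \<le> (2 * r) ^ j" using that two by linarith
        then have "cmod w \<le> 2 * r" using j r(1) power_mono_iff[of "cmod w" "2 * r" j] by simp
        then show ?thesis using r by linarith
      qed
      have thr: "(D * t) ^ (4 * j * k) \<le> s" "(D * t) ^ n = ((D * t) ^ (4 * j * k)) ^ (j + 1)"
        if "0 \<le> t" "t \<le> l / 8" for t
      proof -
        show "(D * t) ^ (4 * j * k) \<le> s"
          unfolding s_def T_def using that D l by (intro power_mono mult_left_mono) auto
        show "(D * t) ^ n = ((D * t) ^ (4 * j * k)) ^ (j + 1)"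
          by (simp only: n_def jet_order_def power_mult[symmetric]) (simp add: algebra_simps)
      qed
      have main: "cmod (P z - u z) \<le> 3 * X" if z: "cmod z \<le> l / 8" for z
      proof -
        define q where "q = (D * cmod z) ^ (4 * j * k)"
        have q: "q \<le> s" "(D * cmod z) ^ n = q ^ (j + 1)" "0 \<le> q"
          using thr[OF norm_ge_zero z] D by (auto simp: q_def)
        have z1: "cmod z \<le> 1" using z l1 by linarith
        \<comment> \<open>In case \<open>mid\<close>, between the threshold of \<open>u\<close> and
          that of scale \<open>l\<close>, \<open>u\<close> is the quotient although \<open>P\<close>
          need not follow it; there both are small.\<close>
        consider (big) "q \<le> cmod (poly G z)" "s / 2 \<le> cmod (poly G z)"
          | (mid) "q \<le> cmod (poly G z)" "cmod (poly G z) < s / 2"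
          | (low) "cmod (poly G z) < q" by linarith
        then show ?thesis
        proof cases
          case big
          then have *: "u z = poly H z / poly G z" by (simp add: u_def q_def)
          show ?thesis unfolding * using P(4)[OF z big(2)] X by linarith
        next
          case mid
          have "cmod (u z) \<le> 2 * T ^ (2 * k)"
          proof (rule small_root)
            define a where "a = cmod (poly G z)"
            show "cmod (u z) ^ j \<le> 2 * s"
            proof (cases "a = 0")
              case True
              \<comment> \<open>Division by 0 makes \<open>u z = 0\<close> here.\<close>
              then show ?thesis using j s by (simp add: u_def a_def zero_power)
            next
              case False
              then have a: "a > 0" by (simp add: a_def)
              have "cmod (poly G z ^ (j + 1) - poly H z ^ j) \<le> q ^ (j + 1)"
                using GH z1 unfolding power_pair_def D_def[symmetric] n_def[symmetric] q(2) [symmetric] by blast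
              then have "cmod (poly H z) ^ j \<le> a ^ (j + 1) + q ^ (j + 1)"
                using norm_triangle_ineq3[of "poly G z ^ (j + 1)" "poly H z ^ j"]
                by (simp add: norm_power norm_mult a_def)
              also have "q ^ (j + 1) \<le> q * a ^ j"
                using mid(1) q(3) by (simp add: a_def mult_left_mono power_mono)
              finally have "cmod (poly H z) ^ j \<le> (a + q) * a ^ j" by (simp add: algebra_simps)
              then have "cmod (poly H z) ^ j / a ^ j \<le> a + q" using a by (simp add: field_simps)
              moreover have "u z = poly H z / poly G z" using mid by (simp add: u_def q_def)
              ultimately have "cmod (u z) ^ j \<le> a + q" by (simp add: norm_divide power_divide a_def)
              then show ?thesis using mid(2) q(1) s unfolding a_def by linarith
            qed
          qed
          moreover have "cmod (P z) \<le> X" using mid s by (intro P(3) z) auto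
          ultimately show ?thesis using norm_triangle_ineq4[of "P z" "u z"] XT by linarith
        next
          case low
          then have "u z = 0" by (simp add: u_def q_def)
          moreover have "cmod (P z) \<le> X" using low q s by (intro P(3) z) auto
          ultimately show ?thesis using X by simp
        qed
      qed
      have real: "cmod (f x - u (of_real x)) \<le> 2 * X" if x: "0 \<le> x" "x \<le> l / 8" for x
      proof -
        define q where "q = (D * x) ^ (4 * j * k)"
        define z where "z = complex_of_real x"
        have q: "q \<le> s" "(D * x) ^ n = q ^ (j + 1)" "0 \<le> q" "q \<le> 1"
          using thr[OF x] D x s by (auto simp: q_def)
        have x1: "x \<in> {0..1}" using x l1 by simp
        have fx: "cmod (f x) \<le> 1" "cmod (f x ^ j - poly G z) \<le> q ^ (j + 1)"
          "cmod (f x ^ (j + 1) - poly H z) \<le> q ^ (j + 1)"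
          using bspec[OF f x1] unfolding D_def[symmetric] n_def[symmetric] z_def[symmetric] q(2)[symmetric] by blast+
        have qz: "(D * cmod z) ^ (4 * j * k) = q" using x by (simp add: z_def q_def)
        have "cmod (f x - u z) \<le> 2 * T ^ (2 * k)"
        proof (cases "q \<le> cmod (poly G z) \<and> poly G z \<noteq> 0")
          case True
          define a where "a = cmod (poly G z)"
          have a: "a > 0" "q \<le> a" using True by (auto simp: a_def)
          have "u z = poly H z / poly G z" using True by (simp add: u_def qz)
          \<comment> \<open>\<open>f * G - H\<close> combines the two Taylor errors. Dividing by
            \<open>a \<ge> q\<close> lowers their bound from the order \<open>q ^ (j + 1)\<close> to
            \<open>q ^ j\<close>.\<close>
          then have "cmod (f x - u z) * a = cmod (f x * poly G z - poly H z)"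
            using True by (simp add: a_def field_simps flip: norm_mult)
          also have "f x * poly G z - poly H z = (f x ^ (j + 1) - poly H z) - f x * (f x ^ j - poly G z)"
            by (simp add: algebra_simps)
          also have "cmod \<dots> \<le> q ^ (j + 1) + 1 * q ^ (j + 1)"
            unfolding norm_mult[symmetric]
            by (rule order_trans[OF norm_triangle_ineq4], unfold norm_mult, intro add_mono mult_mono fx) auto
          also have "\<dots> = 2 * (q ^ j * q)" by simp
          also have "\<dots> \<le> 2 * (q ^ j * a)" using a q by (intro mult_left_mono) auto
          finally have "cmod (f x - u z) * a \<le> (2 * q ^ j) * a" by (simp add: mult.assoc)
          then have "cmod (f x - u z) \<le> 2 * q ^ j" using a by simp
          also have "q ^ j \<le> q ^ 1" using q j by (intro power_decreasing) auto
          also have "q ^ 1 \<le> s" using q by simp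
          also have "s \<le> T ^ (2 * k)"
            unfolding s_def using T j by (intro power_decreasing) (auto simp: mult_le_mono)
          finally show ?thesis by simp
        next
          case False
          \<comment> \<open>Where \<open>G\<close> is at most the threshold, \<open>f ^ j\<close> is
            so up to a factor 2, and comparing \<open>f\<close> with 0 is enough.\<close>
          then have le: "cmod (poly G z) \<le> q" and u0: "u z = 0" using q by (auto simp: u_def qz)
          have "q ^ (j + 1) \<le> q ^ 1" using q by (intro power_decreasing) auto
          then have "cmod (f x) ^ j \<le> 2 * s"
            using norm_triangle_ineq2[of "f x ^ j" "poly G z"] fx(2) le q(1) by (simp add: norm_power)
          then show ?thesis using small_root u0 by simp
        qed
        then show ?thesis using XT by (simp add: z_def)
      qed
      show "\<exists>P. P holomorphic_on ball 0 (l / 2) \<and> (\<forall>z. cmod z \<le> l / 4 \<longrightarrow> cmod (P z) \<le> C ^ k) \<and>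
       (\<forall>z. cmod z \<le> l / 8 \<longrightarrow> cmod (P z - u z) \<le> (C * l\<^sup>2) ^ k) \<and>
       (\<forall>x. 0 \<le> x \<longrightarrow> x \<le> l / 8 \<longrightarrow> cmod (f x - P (of_real x)) \<le> (C * l\<^sup>2) ^ k)"
      proof (intro exI[of _ P] conjI allI impI P(1))
        show "cmod (P z) \<le> C ^ k" if "cmod z \<le> l / 4" for z
        proof -
          have "C0 ^ k \<le> C ^ k" using C0 zero_le_power2[of D] by (intro power_mono) (auto simp: C_def)
          then show ?thesis using P(2)[OF that] by linarith
        qed
        show "cmod (P z - u z) \<le> (C * l\<^sup>2) ^ k" if "cmod z \<le> l / 8" for z
          using main[OF that] CX X by linarith
        show "cmod (f x - P (of_real x)) \<le> (C * l\<^sup>2) ^ k" if x: "0 \<le> x" "x \<le> l / 8" for x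
        proof -
          have "cmod (P (of_real x) - u (of_real x)) \<le> 3 * X" by (rule main) (use x in simp)
          moreover have "f x - P (of_real x) = (f x - u (of_real x)) - (P (of_real x) - u (of_real x))" by simp
          ultimately show ?thesis
            using real[OF x] norm_triangle_ineq4[of "f x - u (of_real x)" "P (of_real x) - u (of_real x)"] CX
            by simp
        qed
      qed
    qed
  qed
qed

section \<open>Divided differences and their contour integrals\<close>

lemma partial_fractions:
  fixes x :: "'i \<Rightarrow> complex"
  assumes I: "finite I" "I \<noteq> {}" "inj_on x I" and \<zeta>: "\<zeta> \<notin> x ` I"
  shows "(\<Sum>m\<in>I. (1 / (\<Prod>l\<in>I-{m}. x m - x l)) / (\<zeta> - x m)) = 1 / (\<Prod>l\<in>I. \<zeta> - x l)"
proof -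
  define c where "c m = 1 / (\<Prod>l\<in>I-{m}. x m - x l)" for m
  \<comment> \<open>Lagrange interpolation of the constant 1: \<open>p\<close> has degree less than
    \<open>card I\<close> and equals 1 at every node.\<close>
  define p where "p = (\<Sum>m\<in>I. smult (c m) (\<Prod>l\<in>I-{m}. [:- x l, 1:]))"
  have pp: "poly p z = (\<Sum>m\<in>I. c m * (\<Prod>l\<in>I-{m}. z - x l))" for z
    by (simp add: p_def poly_sum poly_prod)
  have card: "card I > 0" using I by (simp add: card_gt_0_iff)
  have "p = 1"
  proof (rule poly_eqI_degree[of "x ` I"])
    fix z assume "z \<in> x ` I"
    then obtain m where m: "m \<in> I" "z = x m" by auto
    have "poly p z = (\<Sum>m'\<in>I. if m' = m then 1 else 0)"
      unfolding pp
    proof (rule sum.cong[OF refl])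
      fix m' assume m': "m' \<in> I"
      show "c m' * (\<Prod>l\<in>I-{m'}. z - x l) = (if m' = m then 1 else 0)"
      proof (cases "m' = m")
        case True
        have "(\<Prod>l\<in>I-{m}. x m - x l) \<noteq> 0"
          using I m by (auto simp: inj_on_def)
        then show ?thesis using True m by (simp add: c_def)
      next
        case False
        then have "(\<Prod>l\<in>I-{m'}. z - x l) = 0" using I m by (intro prod_zero) auto
        then show ?thesis using False by simp
      qed
    qed
    then show "poly p z = poly 1 z" using I m by simp
  next
    have "degree p \<le> card I - 1"
      unfolding p_def
    proof (rule degree_sum_le)
      fix m assume m: "m \<in> I"
      have "degree (\<Prod>l\<in>I-{m}. [:- x l, 1:]) \<le> card I - 1"
        using degree_prod_sum_le[of "I - {m}" "\<lambda>l. [:- x l, 1:]"] m I by (simp add: o_def)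
      then show "degree (smult (c m) (\<Prod>l\<in>I-{m}. [:- x l, 1:])) \<le> card I - 1"
        using degree_smult_le[of "c m" "\<Prod>l\<in>I-{m}. [:- x l, 1:]"] by linarith
    qed (use I in auto)
    then show "card (x ` I) > degree p" using card I by (simp add: card_image)
    show "card (x ` I) > degree 1" using card I by (simp add: card_image)
  qed
  then have one: "(\<Sum>m\<in>I. c m * (\<Prod>l\<in>I-{m}. \<zeta> - x l)) = 1" using pp[of \<zeta>] by simp
  have nz: "(\<Prod>l\<in>I. \<zeta> - x l) \<noteq> 0" using I \<zeta> by auto
  have "(\<Sum>m\<in>I. c m / (\<zeta> - x m)) = (\<Sum>m\<in>I. c m * (\<Prod>l\<in>I-{m}. \<zeta> - x l) / (\<Prod>l\<in>I. \<zeta> - x l))"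
  proof (rule sum.cong[OF refl])
    fix m assume m: "m \<in> I"
    have "(\<Prod>l\<in>I. \<zeta> - x l) = (\<zeta> - x m) * (\<Prod>l\<in>I-{m}. \<zeta> - x l)"
      using I m by (intro prod.remove)
    then show "c m / (\<zeta> - x m) = c m * (\<Prod>l\<in>I-{m}. \<zeta> - x l) / (\<Prod>l\<in>I. \<zeta> - x l)"
      using nz by auto
  qed
  also have "\<dots> = 1 / (\<Prod>l\<in>I. \<zeta> - x l)" using one by (simp flip: sum_divide_distrib)
  finally show ?thesis by (simp add: c_def)
qed

text \<open>All nodes but the first lie in \<open>[1, 2]\<close>, so that one can divide by them in Kemperman's identity.\<close>
definition dd_node :: "nat \<Rightarrow> nat \<Rightarrow> real" where
  "dd_node k m = (if m = 0 then 0 else 1 + real m / real k)"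

text \<open>The coefficient of \<open>f (dd_node k m)\<close> in the divided difference of
  \<open>f\<close> of order \<open>k\<close> at these nodes.\<close>

definition dd_weight :: "nat \<Rightarrow> nat \<Rightarrow> real" where
  "dd_weight k m = 1 / (\<Prod>l\<in>{..k}-{m}. dd_node k m - dd_node k l)"

lemma dd_node_bounds: "m \<le> k \<Longrightarrow> 0 \<le> dd_node k m \<and> dd_node k m \<le> 2"
  by (cases "k = 0") (auto simp: dd_node_def field_simps)

lemma dd_node_inj: "inj_on (dd_node k) {..k}"
proof (rule inj_onI)
  fix m l assume "m \<in> {..k}" "l \<in> {..k}" "dd_node k m = dd_node k l"
  moreover have "1 + real i / real k \<noteq> 0" for i
    using divide_nonneg_nonneg[of "real i" "real k"] by linarith
  ultimately show "m = l" by (cases "k = 0") (auto simp: dd_node_def split: if_splits)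
qed

text \<open>By \<open>partial_fractions\<close> the divided difference is the contour integral of
  \<open>F\<close> divided by the product of all \<open>\<zeta> - x m\<close>. The nodes stay in the
  disc of radius \<open>\<rho> / 2\<close>, so each factor is at least \<open>\<rho> / 2\<close>;
  scaling the nodes by \<open>\<alpha>\<close> accounts for \<open>\<alpha> ^ k\<close>.\<close>

lemma dd_holomorphic_bound:
  assumes F: "F holomorphic_on cball 0 \<rho>" and B: "\<And>z. cmod z \<le> \<rho> \<Longrightarrow> cmod (F z) \<le> B"
    and \<alpha>: "0 < \<alpha>" "4 * \<alpha> \<le> \<rho>"
  shows "cmod (\<Sum>m\<le>k. of_real (dd_weight k m) * F (of_real (\<alpha> * dd_node k m))) \<le> 2 * B * (2 * \<alpha> / \<rho>) ^ k"
proof -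
  define x where "x m = complex_of_real (\<alpha> * dd_node k m)" for m
  have \<rho>: "\<rho> > 0" using \<alpha> by linarith
  have B0: "B \<ge> 0" using order_trans[OF norm_ge_zero B[of 0]] \<rho> by simp
  have xb: "cmod (x m) \<le> \<rho> / 2" if "m \<le> k" for m
  proof -
    have "cmod (x m) = \<alpha> * dd_node k m" using dd_node_bounds[OF that] \<alpha> by (simp add: x_def norm_mult)
    also have "\<dots> \<le> \<alpha> * 2" using dd_node_bounds[OF that] \<alpha> by (intro mult_left_mono) auto
    finally show ?thesis using \<alpha> by linarith
  qed
  have "inj_on x {..k}" unfolding x_def using dd_node_inj \<alpha> by (auto simp: inj_on_def)
  have w: "1 / (\<Prod>l\<in>{..k}-{m}. x m - x l) = of_real (dd_weight k m) / of_real \<alpha> ^ k" if "m \<le> k" for m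
  proof -
    have "(\<Prod>l\<in>{..k}-{m}. x m - x l) = (\<Prod>l\<in>{..k}-{m}. of_real \<alpha> * of_real (dd_node k m - dd_node k l))"
      by (simp add: x_def algebra_simps)
    also have "\<dots> = of_real \<alpha> ^ k * of_real (\<Prod>l\<in>{..k}-{m}. dd_node k m - dd_node k l)"
      using that by (simp add: prod.distrib)
    finally show ?thesis by (simp add: dd_weight_def)
  qed
  have int: "((\<lambda>\<zeta>. \<Sum>m\<le>k. of_real (dd_weight k m) * (F \<zeta> / (\<zeta> - x m))) has_contour_integral
      (\<Sum>m\<le>k. of_real (dd_weight k m) * (2 * of_real pi * \<i> * F (x m)))) (circlepath 0 \<rho>)"
  proof (intro has_contour_integral_sum has_contour_integral_lmul)
    fix m assume m: "m \<in> {..k}"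
    have "cmod (x m) < \<rho>" using xb[of m] m \<rho> by fastforce
    then show "((\<lambda>\<zeta>. F \<zeta> / (\<zeta> - x m)) has_contour_integral 2 * of_real pi * \<i> * F (x m)) (circlepath 0 \<rho>)"
      by (intro Cauchy_integral_circlepath_simple F) auto
  qed auto
  have bnd: "cmod (\<Sum>m\<le>k. of_real (dd_weight k m) * (F \<zeta> / (\<zeta> - x m))) \<le> B * \<alpha> ^ k / (\<rho> / 2) ^ Suc k"
    if \<zeta>: "cmod (\<zeta> - 0) = \<rho>" for \<zeta>
  proof -
    have far: "\<rho> / 2 \<le> cmod (\<zeta> - x m)" if "m \<le> k" for m
      using norm_triangle_ineq2[of \<zeta> "x m"] xb[OF that] \<zeta> by simp
    have "\<zeta> \<notin> x ` {..k}" using far \<rho> by fastforce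
    from partial_fractions[OF _ _ \<open>inj_on x {..k}\<close> this]
    have "(\<Sum>m\<le>k. (of_real (dd_weight k m) / of_real \<alpha> ^ k) / (\<zeta> - x m)) = 1 / (\<Prod>l\<le>k. \<zeta> - x l)"
      using w by simp
    moreover have "(\<Sum>m\<le>k. (of_real (dd_weight k m) / of_real \<alpha> ^ k) / (\<zeta> - x m))
        = (\<Sum>m\<le>k. of_real (dd_weight k m) / (\<zeta> - x m)) / of_real \<alpha> ^ k"
      unfolding sum_divide_distrib by (intro sum.cong refl) (simp add: mult.commute)
    ultimately have "(\<Sum>m\<le>k. of_real (dd_weight k m) / (\<zeta> - x m)) / of_real \<alpha> ^ k = 1 / (\<Prod>l\<le>k. \<zeta> - x l)"
      by (simp only:)
    then have "(\<Sum>m\<le>k. of_real (dd_weight k m) / (\<zeta> - x m)) = 1 / (\<Prod>l\<le>k. \<zeta> - x l) * of_real \<alpha> ^ k"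
      using \<alpha> by (subst (asm) divide_eq_eq) simp
    moreover have "(\<Sum>m\<le>k. of_real (dd_weight k m) * (F \<zeta> / (\<zeta> - x m)))
        = F \<zeta> * (\<Sum>m\<le>k. of_real (dd_weight k m) / (\<zeta> - x m))"
      unfolding sum_distrib_left by (intro sum.cong refl) (simp add: mult.commute)
    ultimately have "(\<Sum>m\<le>k. of_real (dd_weight k m) * (F \<zeta> / (\<zeta> - x m))) = F \<zeta> * (of_real \<alpha> ^ k / (\<Prod>l\<le>k. \<zeta> - x l))"
      by simp
    then have "cmod (\<Sum>m\<le>k. of_real (dd_weight k m) * (F \<zeta> / (\<zeta> - x m)))
        = cmod (F \<zeta>) * \<alpha> ^ k / (\<Prod>l\<le>k. cmod (\<zeta> - x l))"
      using \<alpha> by (simp add: norm_mult norm_divide norm_power prod_norm)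
    also have "\<dots> \<le> B * \<alpha> ^ k / (\<Prod>l\<le>k. \<rho> / 2)"
    proof (rule frac_le)
      show "(\<Prod>l\<le>k. \<rho> / 2) \<le> (\<Prod>l\<le>k. cmod (\<zeta> - x l))"
        using far \<rho> by (intro prod_mono) auto
      show "cmod (F \<zeta>) * \<alpha> ^ k \<le> B * \<alpha> ^ k" using B[of \<zeta>] \<zeta> \<alpha> by (intro mult_right_mono) auto
    qed (use B0 \<alpha> \<rho> in \<open>auto intro!: prod_pos\<close>)
    finally show ?thesis by simp
  qed
  have "cmod (\<Sum>m\<le>k. of_real (dd_weight k m) * (2 * of_real pi * \<i> * F (x m)))
      \<le> B * \<alpha> ^ k / (\<rho> / 2) ^ Suc k * (2 * pi * \<rho>)"
    by (rule has_contour_integral_bound_circlepath[OF int _ \<rho> bnd]) (use B0 \<alpha> \<rho> in auto)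
  also have "(\<Sum>m\<le>k. of_real (dd_weight k m) * (2 * of_real pi * \<i> * F (x m))) =
     (2 * of_real pi * \<i>) * (\<Sum>m\<le>k. of_real (dd_weight k m) * F (x m))"
    by (simp add: sum_distrib_left mult_ac)
  also have "cmod \<dots> = 2 * pi * cmod (\<Sum>m\<le>k. of_real (dd_weight k m) * F (x m))"
    by (simp add: norm_mult)
  also have "B * \<alpha> ^ k / (\<rho> / 2) ^ Suc k * (2 * pi * \<rho>) = 2 * pi * (2 * B * (2 * \<alpha> / \<rho>) ^ k)"
    using \<rho> by (simp add: power_divide power_mult_distrib field_simps)
  finally show ?thesis by (simp add: x_def)
qed

text \<open>For \<open>m \<ge> 1\<close> the distance to node 0 is at least 1 and the other
  distances multiply to \<open>fact (m - 1) * fact (k - m) / k ^ (k - 1)\<close>. A binomial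
  coefficient is at most \<open>2 ^ k\<close>, and
  \<open>k ^ (k - 1) \<le> exp k * fact (k - 1)\<close>; with \<open>exp 1 \<le> 3\<close> this
  gives 6.\<close>

lemma dd_weight_bound:
  assumes m: "m \<le> k" and k: "k \<ge> 1"
  shows "\<bar>dd_weight k m\<bar> \<le> 6 ^ k"
proof (cases "m = 0")
  case True
  have "(\<Prod>l\<in>{..k}-{0}. \<bar>dd_node k 0 - dd_node k l\<bar>) \<ge> 1"
  proof (rule prod_ge_1)
    fix l assume "l \<in> {..k} - {0}"
    moreover have "0 \<le> real l / real k" by simp
    ultimately show "1 \<le> \<bar>dd_node k 0 - dd_node k l\<bar>" by (simp add: dd_node_def del: divide_nonneg_nonneg zero_le_divide_iff)
  qed
  then have "\<bar>dd_weight k m\<bar> \<le> 1" by (simp add: True dd_weight_def abs_prod divide_le_eq_1)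
  also have "\<dots> \<le> 6 ^ k" by (rule one_le_power) simp
  finally show ?thesis .
next
  case False
  then have m1: "m \<ge> 1" by simp
  have kpos: "real k > 0" using k by simp
  define d where "d l = \<bar>dd_node k m - dd_node k l\<bar>" for l
  have "{..k} - {m} = insert 0 ({1..<m} \<union> {m<..k})" using m m1 by auto
  then have "prod d ({..k}-{m}) = prod d (insert 0 ({1..<m} \<union> {m<..k}))" by (simp only:)
  also have "\<dots> = d 0 * prod d ({1..<m} \<union> {m<..k})" by (rule prod.insert) auto
  also have "prod d ({1..<m} \<union> {m<..k}) = prod d {1..<m} * prod d {m<..k}"
    by (rule prod.union_disjoint) auto
  finally have "(\<Prod>l\<in>{..k}-{m}. \<bar>dd_node k m - dd_node k l\<bar>)
    = \<bar>dd_node k m - dd_node k 0\<bar> * ((\<Prod>l\<in>{1..<m}. \<bar>dd_node k m - dd_node k l\<bar>) * (\<Prod>l\<in>{m<..k}. \<bar>dd_node k m - dd_node k l\<bar>))"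
    unfolding d_def .
  also have "(\<Prod>l\<in>{1..<m}. \<bar>dd_node k m - dd_node k l\<bar>) = (\<Prod>l\<in>{1..m-1}. real l / real k)"
    by (rule prod.reindex_bij_witness[of _ "\<lambda>l. m - l" "\<lambda>l. m - l"])
       (use m1 kpos in \<open>auto simp: dd_node_def of_nat_diff field_simps\<close>)
  also have "(\<Prod>l\<in>{m<..k}. \<bar>dd_node k m - dd_node k l\<bar>) = (\<Prod>l\<in>{1..k-m}. real l / real k)"
    by (rule prod.reindex_bij_witness[of _ "\<lambda>l. m + l" "\<lambda>l. l - m"])
       (use m1 kpos in \<open>auto simp: dd_node_def of_nat_diff field_simps\<close>)
  also have "(\<Prod>l\<in>{1..m-1}. real l / real k) * (\<Prod>l\<in>{1..k-m}. real l / real k)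
    = fact (m - 1) * fact (k - m) / real k ^ (k - 1)"
  proof -
    have "(\<Prod>l\<in>{1..i}. real l / real k) = fact i / real k ^ i" for i
      by (simp add: prod_dividef fact_prod)
    moreover have "k - 1 = (m - 1) + (k - m)" using m m1 by simp
    ultimately show ?thesis by (simp only: power_add times_divide_times_eq)
  qed
  also have "\<bar>dd_node k m - dd_node k 0\<bar> * (fact (m - 1) * fact (k - m) / real k ^ (k - 1))
     \<ge> 1 * (fact (m - 1) * fact (k - m) / real k ^ (k - 1))"
    by (intro mult_right_mono) (use m1 in \<open>auto simp: dd_node_def\<close>)
  finally have prod: "fact (m - 1) * fact (k - m) / real k ^ (k - 1) \<le> (\<Prod>l\<in>{..k}-{m}. \<bar>dd_node k m - dd_node k l\<bar>)"
    by simp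
  have f: "real k ^ (k - 1) \<le> 6 ^ k * (fact (m - 1) * fact (k - m))"
  proof -
    have "fact (k - 1) = fact (m - 1) * fact (k - m) * real ((k - 1) choose (m - 1))"
      using binomial_fact_lemma[of "m - 1" "k - 1"] m m1
      by (metis (no_types, lifting) diff_diff_left diff_le_mono le_add_diff_inverse of_nat_fact of_nat_mult)
    also have "real ((k - 1) choose (m - 1)) \<le> 2 ^ (k - 1)"
      using binomial_le_pow2[of "k - 1" "m - 1"] by (metis of_nat_le_iff of_nat_numeral of_nat_power)
    finally have c: "fact (k - 1) \<le> fact (m - 1) * fact (k - m) * (2::real) ^ (k - 1)"
      by (simp add: mult_left_mono)
    have "real k ^ (k - 1) \<le> exp (real k) * fact (k - 1)"
      using power_div_fact_le[of "real k" "k - 1"] by (simp add: field_simps)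
    also have "exp (real k) = exp 1 ^ k" by (simp flip: exp_of_nat_mult)
    also have "\<dots> * fact (k - 1) \<le> 3 ^ k * (fact (m - 1) * fact (k - m) * 2 ^ (k - 1))"
      using exp_le c by (intro mult_mono power_mono) auto
    also have "\<dots> \<le> 3 ^ k * (fact (m - 1) * fact (k - m) * 2 ^ k)"
      by (intro mult_left_mono power_increasing) auto
    also have "\<dots> = (3 * 2) ^ k * (fact (m - 1) * fact (k - m))" by (simp only: power_mult_distrib mult_ac)
    finally show ?thesis by simp
  qed
  have pos: "0 < fact (m - 1) * fact (k - m) / real k ^ (k - 1)" using kpos by simp
  have "\<bar>dd_weight k m\<bar> = 1 / (\<Prod>l\<in>{..k}-{m}. \<bar>dd_node k m - dd_node k l\<bar>)"
    by (simp add: dd_weight_def abs_prod)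
  also have "\<dots> \<le> 1 / (fact (m - 1) * fact (k - m) / real k ^ (k - 1))"
    by (intro frac_le prod pos) auto
  also have "\<dots> = real k ^ (k - 1) / (fact (m - 1) * fact (k - m))" by simp
  also have "\<dots> \<le> 6 ^ k" using f by (simp add: pos_divide_le_eq)
  finally show ?thesis .
qed

lemma dd_weight_sum_bound:
  assumes "k \<ge> 1"
  shows "(\<Sum>m\<le>k. \<bar>dd_weight k m\<bar>) \<le> 12 ^ k"
proof -
  have "(\<Sum>m\<le>k. \<bar>dd_weight k m\<bar>) \<le> (\<Sum>m\<le>k. 6 ^ k)"
    by (intro sum_mono dd_weight_bound) (use assms in auto)
  also have "\<dots> = real (Suc k) * 6 ^ k" by simp
  also have "\<dots> \<le> 2 ^ k * 6 ^ k"
  proof (intro mult_right_mono)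
    have "Suc k \<le> 2 ^ k" using less_exp[of k] by (rule Suc_leI)
    then show "real (Suc k) \<le> 2 ^ k" by (metis of_nat_le_iff of_nat_numeral of_nat_power)
  qed auto
  also have "\<dots> = (2 * 6) ^ k" by (simp only: power_mult_distrib)
  finally show ?thesis by simp
qed

section \<open>From Taylor polynomials to divided differences of \<open>f\<close>\<close>

lemma first_failure:
  assumes "Q (0::nat)" "\<not> Q n"
  obtains i where "Q i" "\<not> Q (Suc i)"
  using assms by (metis nat.induct)

text \<open>Both \<open>(f ^ j) ^ (j + 1)\<close> and \<open>(f ^ (j + 1)) ^ j\<close> equal \<open>f ^ (j * (j + 1))\<close>, hence \<open>G ^ (j + 1) - H ^ j\<close>
  is small on the real segment and vanishes to order \<open>n\<close> at 0.\<close>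
lemma power_pair_taylor:
  fixes \<gamma> \<eta> :: "nat \<Rightarrow> real \<Rightarrow> complex" and f :: "real \<Rightarrow> complex"
  assumes j: "j \<ge> 1" and k: "k \<ge> 1" and n: "n = jet_order j k"
    and f: "\<And>x. x \<in> {0..1} \<Longrightarrow> cmod (f x) \<le> 1"
    and \<gamma>0: "\<And>x. x \<in> {0..1} \<Longrightarrow> \<gamma> 0 x = f x ^ j" and \<eta>0: "\<And>x. x \<in> {0..1} \<Longrightarrow> \<eta> 0 x = f x ^ (j + 1)"
    and d\<gamma>: "\<And>m x. m < n \<Longrightarrow> x \<in> {0..1} \<Longrightarrow> (\<gamma> m has_vector_derivative \<gamma> (Suc m) x) (at x within {0..1})"
    and d\<eta>: "\<And>m x. m < n \<Longrightarrow> x \<in> {0..1} \<Longrightarrow> (\<eta> m has_vector_derivative \<eta> (Suc m) x) (at x within {0..1})"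
    and b\<gamma>: "\<And>m x. m \<le> n \<Longrightarrow> x \<in> {0..1} \<Longrightarrow> cmod (\<gamma> m x) \<le> real n ^ m"
    and b\<eta>: "\<And>m x. m \<le> n \<Longrightarrow> x \<in> {0..1} \<Longrightarrow> cmod (\<eta> m x) \<le> real n ^ m"
  defines "G \<equiv> taylor_poly n (\<lambda>m. \<gamma> m 0)" and "H \<equiv> taylor_poly n (\<lambda>m. \<eta> m 0)"
  shows "power_pair j k G H"
    and "\<And>x. x \<in> {0..1} \<Longrightarrow> cmod (f x ^ j - poly G (of_real x)) \<le> (rate j * x) ^ n"
    and "\<And>x. x \<in> {0..1} \<Longrightarrow> cmod (f x ^ (j + 1) - poly H (of_real x)) \<le> (rate j * x) ^ n"
proof -
  have n1: "n \<ge> 1" using j k by (simp add: n jet_order_def)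
  have rn: "rate j ^ n = exp (real n * (real j + 2))" by (simp add: rate_def exp_of_nat_mult)
  have e1: "exp (real n) \<le> rate j ^ n" unfolding rn using mult_left_mono[of 1 "real j + 2" "real n"] by simp
  have e2: "exp (2 * real n) \<le> rate j ^ n" unfolding rn using mult_left_mono[of 2 "real j + 2" "real n"] by (simp add: mult.commute)
  \<comment> \<open>This estimate dictates the exponent in \<open>rate j = exp (j + 2)\<close>:
    \<open>j + 1\<close> factors \<open>exp n\<close> come from the power, one more pays for the
    2.\<close>
  have e3: "2 * exp (real n) ^ (j + 1) \<le> rate j ^ n"
  proof -
    have "2 \<le> exp (real n)" using exp_ge_add_one_self[of "real n"] n1 by linarith
    then have "2 * exp (real n) ^ (j + 1) \<le> exp (real n) * exp (real n) ^ (j + 1)"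
      by (intro mult_right_mono) auto
    also have "\<dots> = exp (real (j + 2) * real n)" by (subst exp_of_nat_mult) simp
    finally show ?thesis by (simp add: rn algebra_simps)
  qed
  have c\<gamma>: "cmod (\<gamma> m 0) \<le> real n ^ m" and c\<eta>: "cmod (\<eta> m 0) \<le> real n ^ m" if "m < n" for m
    using b\<gamma> b\<eta> that by auto
  have Gb: "cmod (poly G z) \<le> exp n" and Hb: "cmod (poly H z) \<le> exp n" if "cmod z \<le> 1" for z
    unfolding G_def H_def using c\<gamma> c\<eta> that by (auto intro!: taylor_poly_norm_bound)
  have Gr: "cmod (f x ^ j - poly G (of_real x)) \<le> exp n * x ^ n"
    and Hr: "cmod (f x ^ (j + 1) - poly H (of_real x)) \<le> exp n * x ^ n" if x: "x \<in> {0..1}" for x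
    using taylor_poly_remainder[of n \<gamma> x, OF d\<gamma> b\<gamma>[OF order_refl] x]
      taylor_poly_remainder[of n \<eta> x, OF d\<eta> b\<eta>[OF order_refl] x] \<gamma>0[OF x] \<eta>0[OF x]
    by (auto simp: G_def H_def)
  show "cmod (f x ^ j - poly G (of_real x)) \<le> (rate j * x) ^ n"
    and "cmod (f x ^ (j + 1) - poly H (of_real x)) \<le> (rate j * x) ^ n" if x: "x \<in> {0..1}" for x
  proof -
    have "exp n * x ^ n \<le> (rate j * x) ^ n"
      using e1 x by (simp add: power_mult_distrib mult_right_mono)
    then show "cmod (f x ^ j - poly G (of_real x)) \<le> (rate j * x) ^ n"
      "cmod (f x ^ (j + 1) - poly H (of_real x)) \<le> (rate j * x) ^ n"
      using Gr[OF x] Hr[OF x] by linarith+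
  qed
  define Q where "Q = G ^ (j + 1) - H ^ j"
  have Qz: "cmod (poly Q z) \<le> (rate j * cmod z) ^ n" if z: "cmod z \<le> 1" for z
  proof -
    have "cmod (poly Q z) \<le> (2 * exp (real n) ^ (j + 1)) * cmod z ^ n"
    proof (rule poly_vanishing_bound[OF _ _ z])
      fix w :: complex assume w: "cmod w = 1"
      have "cmod (poly Q w) \<le> cmod (poly G w) ^ (j + 1) + cmod (poly H w) ^ j"
        unfolding Q_def poly_diff poly_power norm_power[symmetric] by (rule norm_triangle_ineq4)
      also have "\<dots> \<le> exp (real n) ^ (j + 1) + exp (real n) ^ j"
        using Gb[of w] Hb[of w] w by (intro add_mono power_mono) auto
      also have "exp (real n) ^ j \<le> exp (real n) ^ (j + 1)" by (intro power_increasing) auto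
      finally show "cmod (poly Q w) \<le> 2 * exp (real n) ^ (j + 1)" by simp
    next
      fix x :: real assume x: "0 < x" "x \<le> 1"
      define M where "M = exp (real n)"
      have M: "M \<ge> 1" by (simp add: M_def)
      \<comment> \<open>For the order of vanishing any constant in front of \<open>x ^ n\<close>
        will do, so the crude factor \<open>M ^ p\<close> from rescaling to the unit disc is
        harmless.\<close>
      have pd: "cmod (a ^ p - b ^ p) \<le> real p * M ^ p * cmod (a - b)"
        if "cmod a \<le> M" "cmod b \<le> M" for a b :: complex and p
      proof -
        have Mne: "complex_of_real M \<noteq> 0" using M by auto
        have "cmod ((a / M) ^ p - (b / M) ^ p) \<le> real p * cmod (a / M - b / M)"
          by (rule norm_power_diff) (use that M in \<open>auto simp: norm_divide\<close>)
        also have "\<dots> \<le> real p * cmod (a - b)"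
        proof (rule mult_left_mono)
          have "cmod (a / M - b / M) = cmod (a - b) / M"
            using M by (simp add: norm_divide flip: diff_divide_distrib)
          also have "\<dots> \<le> cmod (a - b)"
            using M mult_left_mono[OF M norm_ge_zero, of "a - b"] by (simp add: divide_le_eq)
          finally show "cmod (a / M - b / M) \<le> cmod (a - b)" .
        qed auto
        finally have "cmod ((a ^ p - b ^ p) / M ^ p) \<le> real p * cmod (a - b)"
          by (simp add: power_divide diff_divide_distrib)
        then show ?thesis using M by (simp add: norm_divide norm_power divide_le_eq mult_ac)
      qed
      have x1: "x \<in> {0..1}" using x by simp
      have fM: "cmod (f x ^ i) \<le> M" for i
        using f[OF x1] M power_le_one[of "cmod (f x)" i] by (simp add: norm_power)
      have GM: "cmod (poly G (of_real x)) \<le> M" "cmod (poly H (of_real x)) \<le> M"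
        using Gb[of "of_real x"] Hb[of "of_real x"] x by (auto simp: M_def)
      have "poly Q (of_real x) = (poly G (of_real x) ^ (j + 1) - (f x ^ j) ^ (j + 1))
          - (poly H (of_real x) ^ j - (f x ^ (j + 1)) ^ j)"
      proof -
        have pw: "(f x ^ j) ^ (j + 1) = (f x ^ (j + 1)) ^ j"
          by (simp only: power_mult[symmetric] mult.commute[of j])
        have "a - b = (a - p) - (b - p)" for a b p :: complex by simp
        then show ?thesis unfolding Q_def poly_diff poly_power pw by this
      qed
      also have "cmod \<dots> \<le> real (j + 1) * M ^ (j + 1) * cmod (poly G (of_real x) - f x ^ j)
          + real j * M ^ j * cmod (poly H (of_real x) - f x ^ (j + 1))"
        by (rule order_trans[OF norm_triangle_ineq4], intro add_mono pd fM GM)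
      also have "\<dots> \<le> real (j + 1) * M ^ (j + 1) * (M * x ^ n) + real j * M ^ j * (M * x ^ n)"
        using Gr[OF x1] Hr[OF x1] M
        by (intro add_mono mult_left_mono) (auto simp: M_def norm_minus_commute)
      finally show "cmod (poly Q (of_real x)) \<le> (real (j + 1) * M ^ (j + 1) * M + real j * M ^ j * M) * x ^ n"
        by (simp add: algebra_simps)
    qed
    also have "\<dots> \<le> rate j ^ n * cmod z ^ n" using e3 by (intro mult_right_mono) auto
    finally show ?thesis by (simp add: power_mult_distrib)
  qed
  show "power_pair j k G H"
    unfolding power_pair_def n[symmetric]
  proof (intro conjI allI impI)
    show "degree G \<le> n" unfolding G_def by (rule degree_taylor_poly)
    fix z :: complex assume z: "cmod z \<le> 1"
    show "cmod (poly G z) \<le> rate j ^ n" "cmod (poly H z) \<le> rate j ^ n"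
      using Gb[OF z] Hb[OF z] e1 by linarith+
    show "cmod (poly G z ^ (j + 1) - poly H z ^ j) \<le> (rate j * cmod z) ^ n"
      using Qz[OF z] by (simp add: Q_def)
    fix w :: complex assume w: "cmod w \<le> 1"
    have "exp (2 * real n) * cmod (z - w) \<le> rate j ^ n * cmod (z - w)" using e2 by (intro mult_right_mono) auto
    then show "cmod (poly G z - poly G w) \<le> rate j ^ n * cmod (z - w)"
      "cmod (poly H z - poly H w) \<le> rate j ^ n * cmod (z - w)"
      using taylor_poly_lipschitz[of n "\<lambda>m. \<gamma> m 0", OF c\<gamma> z w] taylor_poly_lipschitz[of n "\<lambda>m. \<eta> m 0", OF c\<eta> z w]
      unfolding G_def H_def by linarith+
  qed
qed

text \<open>\<open>\<gamma>\<close> and \<open>\<eta>\<close> stand for the successive derivatives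
  of the two powers, while \<open>f\<close> is only assumed bounded by 1. The bounds by powers of
  the Taylor order are a normalisation: a segment is rescaled until its derivatives have this
  size.\<close>

definition dd_estimate :: "nat \<Rightarrow> nat \<Rightarrow> real \<Rightarrow> real \<Rightarrow> bool" where
  "dd_estimate j k C \<kappa> \<longleftrightarrow> (\<forall>(f :: real \<Rightarrow> complex) \<gamma> \<eta> \<alpha>.
    (\<forall>x\<in>{0..1}. cmod (f x) \<le> 1 \<and> \<gamma> 0 x = f x ^ j \<and> \<eta> 0 x = f x ^ (j + 1)) \<longrightarrow>
    (\<forall>m<jet_order j k. \<forall>x\<in>{0..1}. (\<gamma> m has_vector_derivative \<gamma> (Suc m) x) (at x within {0..1}) \<and>
        (\<eta> m has_vector_derivative \<eta> (Suc m) x) (at x within {0..1})) \<longrightarrow>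
    (\<forall>m\<le>jet_order j k. \<forall>x\<in>{0..1}. cmod (\<gamma> m x) \<le> real (jet_order j k) ^ m \<and>
        cmod (\<eta> m x) \<le> real (jet_order j k) ^ m) \<longrightarrow>
    0 < \<alpha> \<longrightarrow> \<alpha> \<le> \<kappa> \<longrightarrow>
    cmod (\<Sum>m\<le>k. of_real (dd_weight k m) * f (\<alpha> * dd_node k m)) \<le> (C * \<alpha>) ^ k)"

lemma dd_estimateD:
  assumes "dd_estimate j k C \<kappa>"
    and "\<forall>x\<in>{0..1}. cmod (f x) \<le> 1 \<and> \<gamma> 0 x = f x ^ j \<and> \<eta> 0 x = f x ^ (j + 1)"
    and "\<forall>m<jet_order j k. \<forall>x\<in>{0..1}. (\<gamma> m has_vector_derivative \<gamma> (Suc m) x) (at x within {0..1}) \<and>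
        (\<eta> m has_vector_derivative \<eta> (Suc m) x) (at x within {0..1})"
    and "\<forall>m\<le>jet_order j k. \<forall>x\<in>{0..1}. cmod (\<gamma> m x) \<le> real (jet_order j k) ^ m \<and>
        cmod (\<eta> m x) \<le> real (jet_order j k) ^ m"
    and "0 < \<alpha>" "\<alpha> \<le> \<kappa>"
  shows "cmod (\<Sum>m\<le>k. of_real (dd_weight k m) * f (\<alpha> * dd_node k m)) \<le> (C * \<alpha>) ^ k"
  by (rule assms(1)[unfolded dd_estimate_def, THEN spec[of _ f], THEN spec[of _ \<gamma>], THEN spec[of _ \<eta>],
    THEN spec[of _ \<alpha>], THEN mp, THEN mp, THEN mp, THEN mp, THEN mp, OF assms(2-6)])

text \<open>The coarsest approximation is bounded on a disc of fixed radius, which suffices for it.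
  The finest has a scale comparable to \<open>\<alpha>\<close>; there the error against
  \<open>f\<close> is already of the form \<open>(C * 64 * \<alpha>) ^ k\<close>, and the size of
  the weights is all that is needed.\<close>

theorem divided_difference_bound:
  assumes j: "j \<ge> 1"
  shows "\<exists>C\<ge>1. \<exists>\<kappa>>0. \<forall>k\<ge>1. dd_estimate j k C \<kappa>"
proof -
  define D where "D = rate j"
  have D: "D \<ge> 1" by (simp add: D_def rate_ge)
  obtain C where C: "C \<ge> 1" and app: "\<And>k G H (f :: real \<Rightarrow> complex). k \<ge> 1 \<Longrightarrow> power_pair j k G H \<Longrightarrow>
    (\<forall>x\<in>{0..1}. cmod (f x) \<le> 1 \<and> cmod (f x ^ j - poly G (of_real x)) \<le> (D * x) ^ jet_order j k \<and>
        cmod (f x ^ (j + 1) - poly H (of_real x)) \<le> (D * x) ^ jet_order j k) \<Longrightarrow>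
    (\<exists>u. \<forall>l. 0 < l \<longrightarrow> D * l \<le> 1 \<longrightarrow>
      (\<exists>P. P holomorphic_on ball 0 (l / 2) \<and> (\<forall>z. cmod z \<le> l / 4 \<longrightarrow> cmod (P z) \<le> C ^ k) \<and>
       (\<forall>z. cmod z \<le> l / 8 \<longrightarrow> cmod (P z - u z) \<le> (C * l\<^sup>2) ^ k) \<and>
       (\<forall>x. 0 \<le> x \<longrightarrow> x \<le> l / 8 \<longrightarrow> cmod (f x - P (of_real x)) \<le> (C * l\<^sup>2) ^ k)))"
    using approximate_power_root[OF j] unfolding D_def by blast
  \<comment> \<open>768 = 12 * 64, from the sum of the weights and a last scale below
    \<open>64 * \<alpha>\<close>. 11 = 2 + 8 + 1, from the first approximation, the telescoping sum
    and the last error.\<close>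
  define C' where "C' = 11 * (768 * (C * D))"
  \<comment> \<open>Makes the coarsest scale \<open>1 / D\<close> at least
    \<open>32 * \<alpha>\<close>, so that at least one scale is admissible.\<close>
  define \<kappa> where "\<kappa> = 1 / (32 * D)"
  have CD: "C * D \<ge> 1" using mult_mono[of 1 C 1 D] C D by simp
  have C': "C' \<ge> 1" using CD by (simp add: C'_def)
  have \<kappa>: "\<kappa> > 0" using D by (simp add: \<kappa>_def)
  show ?thesis unfolding dd_estimate_def
  proof (rule exI[of _ C'], rule conjI[OF C'], rule exI[of _ \<kappa>], rule conjI[OF \<kappa>], intro allI impI)
    fix k :: nat and f :: "real \<Rightarrow> complex" and \<gamma> \<eta> \<alpha>
    assume k: "k \<ge> 1"
      and f: "\<forall>x\<in>{0..1}. cmod (f x) \<le> 1 \<and> \<gamma> 0 x = f x ^ j \<and> \<eta> 0 x = f x ^ (j + 1)"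
      and d: "\<forall>m<jet_order j k. \<forall>x\<in>{0..1}. (\<gamma> m has_vector_derivative \<gamma> (Suc m) x) (at x within {0..1}) \<and>
        (\<eta> m has_vector_derivative \<eta> (Suc m) x) (at x within {0..1})"
      and b: "\<forall>m\<le>jet_order j k. \<forall>x\<in>{0..1}. cmod (\<gamma> m x) \<le> real (jet_order j k) ^ m \<and>
        cmod (\<eta> m x) \<le> real (jet_order j k) ^ m"
      and \<alpha>: "0 < \<alpha>" "\<alpha> \<le> \<kappa>"
    define G where "G = taylor_poly (jet_order j k) (\<lambda>m. \<gamma> m 0)"
    define H where "H = taylor_poly (jet_order j k) (\<lambda>m. \<eta> m 0)"
    have GH: "power_pair j k G H"
      and "\<forall>x\<in>{0..1}. cmod (f x) \<le> 1 \<and> cmod (f x ^ j - poly G (of_real x)) \<le> (D * x) ^ jet_order j k \<and>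
        cmod (f x ^ (j + 1) - poly H (of_real x)) \<le> (D * x) ^ jet_order j k"
      unfolding G_def H_def D_def
      using power_pair_taylor[OF j k refl, of f \<gamma> \<eta>] f d b by blast+
    from app[OF k this] obtain u where u: "\<And>l. 0 < l \<Longrightarrow> D * l \<le> 1 \<Longrightarrow>
      (\<exists>P. P holomorphic_on ball 0 (l / 2) \<and> (\<forall>z. cmod z \<le> l / 4 \<longrightarrow> cmod (P z) \<le> C ^ k) \<and>
       (\<forall>z. cmod z \<le> l / 8 \<longrightarrow> cmod (P z - u z) \<le> (C * l\<^sup>2) ^ k) \<and>
       (\<forall>x. 0 \<le> x \<longrightarrow> x \<le> l / 8 \<longrightarrow> cmod (f x - P (of_real x)) \<le> (C * l\<^sup>2) ^ k))"
      by blast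
    define l where "l i = (1 / D) / 2 ^ i" for i :: nat
    have l: "l i > 0" "D * l i \<le> 1" "l (Suc i) = l i / 2" "l i \<le> 1 / 2 ^ i" "l i \<le> 1" for i
    proof -
      show "l i > 0" using D by (simp add: l_def)
      show "l (Suc i) = l i / 2" by (simp add: l_def)
      show "D * l i \<le> 1" using D one_le_power[of "2::real" i] by (simp add: l_def)
      show 1: "l i \<le> 1 / 2 ^ i" unfolding l_def using D by (intro divide_right_mono) auto
      have "1 / 2 ^ i \<le> (1::real)" using one_le_power[of "2::real" i] by simp
      with 1 show "l i \<le> 1" by linarith
    qed
    obtain P where P: "\<And>i. P i holomorphic_on ball 0 (l i / 2)"
      "\<And>i z. cmod z \<le> l i / 4 \<Longrightarrow> cmod (P i z) \<le> C ^ k"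
      "\<And>i z. cmod z \<le> l i / 8 \<Longrightarrow> cmod (P i z - u z) \<le> (C * (l i)\<^sup>2) ^ k"
      "\<And>i x. 0 \<le> x \<Longrightarrow> x \<le> l i / 8 \<Longrightarrow> cmod (f x - P i (of_real x)) \<le> (C * (l i)\<^sup>2) ^ k"
    proof -
      have "\<forall>i. \<exists>P. P holomorphic_on ball 0 (l i / 2) \<and> (\<forall>z. cmod z \<le> l i / 4 \<longrightarrow> cmod (P z) \<le> C ^ k) \<and>
       (\<forall>z. cmod z \<le> l i / 8 \<longrightarrow> cmod (P z - u z) \<le> (C * (l i)\<^sup>2) ^ k) \<and>
       (\<forall>x. 0 \<le> x \<longrightarrow> x \<le> l i / 8 \<longrightarrow> cmod (f x - P (of_real x)) \<le> (C * (l i)\<^sup>2) ^ k)"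
        using u[OF l(1,2)] by blast
      from choice[OF this] show ?thesis using that by blast
    qed
    have a0: "32 * \<alpha> \<le> l 0" using \<alpha>(2) D by (simp add: l_def \<kappa>_def field_simps)
    have "(\<lambda>i. 1 / 2 ^ i :: real) \<longlonglongrightarrow> 0"
      using LIMSEQ_realpow_zero[of "1 / 2 :: real"] by (simp add: power_divide)
    then have "eventually (\<lambda>i. 1 / 2 ^ i < 32 * \<alpha>) sequentially"
      using \<alpha>(1) by (intro order_tendstoD) auto
    then obtain N where "1 / 2 ^ N < 32 * \<alpha>" by (auto simp: eventually_sequentially)
    then have "\<not> 32 * \<alpha> \<le> l N" using l(4)[of N] by linarith
    \<comment> \<open>The finest scale that is still at least \<open>32 * \<alpha>\<close>; as
      scales are halved, it is below \<open>64 * \<alpha>\<close>.\<close>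
    then obtain i where i: "32 * \<alpha> \<le> l i" "\<not> 32 * \<alpha> \<le> l (Suc i)"
      using first_failure[of "\<lambda>i. 32 * \<alpha> \<le> l i", OF a0] by blast
    have mono: "l q \<ge> l p" if "q \<le> p" for p q
      unfolding l_def using that D by (intro divide_left_mono power_increasing) auto
    define X where "X = (768 * (C * D) * \<alpha>) ^ k"
    define S where "S F = (\<Sum>m\<le>k. of_real (dd_weight k m) * F (complex_of_real (\<alpha> * dd_node k m)))" for F :: "complex \<Rightarrow> complex"
    have X: "(c * \<alpha>) ^ k \<le> X" if "0 \<le> c" "c \<le> 768 * (C * D)" for c
      unfolding X_def using that \<alpha> by (intro power_mono mult_right_mono) auto
    have Xnn: "0 \<le> X" unfolding X_def using C D \<alpha> by (intro zero_le_power mult_nonneg_nonneg) auto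
    have CCD: "C \<le> C * D" "0 \<le> C" using C D by (auto simp: mult_le_cancel_left1)
    have S0: "cmod (S (P 0)) \<le> 2 * X"
    proof -
      have "cmod (S (P 0)) \<le> 2 * C ^ k * (2 * \<alpha> / (1 / D / 8)) ^ k"
        unfolding S_def
      proof (rule dd_holomorphic_bound)
        have l0: "l 0 = 1 / D" by (simp add: l_def)
        have "cball 0 (1 / D / 8) \<subseteq> ball (0::complex) (l 0 / 2)" using D by (auto simp: l0 field_simps)
        then show "P 0 holomorphic_on cball 0 (1 / D / 8)" using P(1)[of 0] holomorphic_on_subset by blast
        show "cmod (P 0 z) \<le> C ^ k" if "cmod z \<le> 1 / D / 8" for z
        proof (rule P(2))
          have "cmod z \<le> l 0 / 8" unfolding l0 by (rule that)
          then show "cmod z \<le> l 0 / 4" using l(1)[of 0] by linarith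
        qed
        show "4 * \<alpha> \<le> 1 / D / 8" using a0 by (simp add: l0)
      qed (use \<alpha> in auto)
      also have "\<dots> = 2 * ((16 * (C * D)) * \<alpha>) ^ k" using D by (simp add: power_mult_distrib[symmetric] field_simps del: power_mult_distrib)
      also have "\<dots> \<le> 2 * X" using CD by (intro mult_left_mono X) auto
      finally show ?thesis .
    qed
    have S1: "cmod (S (\<lambda>z. P (Suc q) z - P q z)) \<le> 4 * X * (1 / 2) ^ q" if q: "q < i" for q
    proof -
      have lq: "64 * \<alpha> \<le> l q" using i(1) mono[of "Suc q" i] q l(3)[of q] by simp
      have "cmod (S (\<lambda>z. P (Suc q) z - P q z)) \<le> 2 * (2 * (C * (l q)\<^sup>2) ^ k) * (2 * \<alpha> / (l q / 16)) ^ k"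
        unfolding S_def
      proof (rule dd_holomorphic_bound)
        have "cball 0 (l q / 16) \<subseteq> ball (0::complex) (l (Suc q) / 2)" "cball 0 (l q / 16) \<subseteq> ball (0::complex) (l q / 2)"
          using l(1)[of q] by (auto simp: l(3))
        then show "(\<lambda>z. P (Suc q) z - P q z) holomorphic_on cball 0 (l q / 16)"
          using P(1) holomorphic_on_subset by (intro holomorphic_intros) blast+
        show "cmod (P (Suc q) z - P q z) \<le> 2 * (C * (l q)\<^sup>2) ^ k" if z: "cmod z \<le> l q / 16" for z
        proof -
          have "cmod (P (Suc q) z - u z) \<le> (C * (l (Suc q))\<^sup>2) ^ k"
            by (rule P(3)) (use z in \<open>simp add: l(3)\<close>)
          also have "\<dots> \<le> (C * (l q)\<^sup>2) ^ k"
            using mono[of q "Suc q"] l(1)[of "Suc q"] CCD by (intro power_mono mult_left_mono) auto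
          finally have 1: "cmod (P (Suc q) z - u z) \<le> (C * (l q)\<^sup>2) ^ k" .
          have 2: "cmod (P q z - u z) \<le> (C * (l q)\<^sup>2) ^ k"
            by (rule P(3)) (use z l(1)[of q] in linarith)
          show ?thesis using 1 2 norm_triangle_ineq4[of "P (Suc q) z - u z" "P q z - u z"] by simp
        qed
        show "4 * \<alpha> \<le> l q / 16" using lq by simp
      qed (use \<alpha> in auto)
      also have "\<dots> = 4 * ((C * (l q)\<^sup>2) * (2 * \<alpha> / (l q / 16))) ^ k" by (simp only: power_mult_distrib)
      also have "(C * (l q)\<^sup>2) * (2 * \<alpha> / (l q / 16)) = (32 * C * \<alpha>) * l q"
        using l(1)[of q] by (simp add: power2_eq_square field_simps)
      also have "4 * ((32 * C * \<alpha>) * l q) ^ k = 4 * ((32 * C * \<alpha>) ^ k * l q ^ k)" by (simp only: power_mult_distrib)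
      also have "\<dots> \<le> 4 * (X * (1 / 2) ^ q)"
      proof (intro mult_left_mono mult_mono)
        show "(32 * C * \<alpha>) ^ k \<le> X" using CCD by (intro X) auto
        \<comment> \<open>The surplus power of the scale, left over from the square in the error,
          becomes the ratio 1/2 of a geometric series.\<close>
        have "l q ^ k \<le> l q ^ 1" using k l(1,5)[of q] by (intro power_decreasing) auto
        also have "\<dots> \<le> (1 / 2) ^ q" using l(4)[of q] by (simp add: power_divide)
        finally show "l q ^ k \<le> (1 / 2) ^ q" .
        show "0 \<le> X" using Xnn k CD by simp
      qed (use l(1)[of q] in auto)
      finally show ?thesis by simp
    qed
    have S2: "cmod ((\<Sum>m\<le>k. of_real (dd_weight k m) * f (\<alpha> * dd_node k m)) - S (P i)) \<le> X"
    proof -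
      have li: "l i < 64 * \<alpha>" using i(2) by (simp add: l(3))
      have "cmod ((\<Sum>m\<le>k. of_real (dd_weight k m) * f (\<alpha> * dd_node k m)) - S (P i))
        = cmod (\<Sum>m\<le>k. of_real (dd_weight k m) * (f (\<alpha> * dd_node k m) - P i (of_real (\<alpha> * dd_node k m))))"
        by (simp add: S_def sum_subtractf right_diff_distrib)
      also have "\<dots> \<le> (\<Sum>m\<le>k. \<bar>dd_weight k m\<bar> * (C * (l i)\<^sup>2) ^ k)"
      proof (rule sum_norm_le)
        fix m assume m: "m \<in> {..k}"
        have nb: "0 \<le> dd_node k m" "dd_node k m \<le> 2" using dd_node_bounds[of m k] m by auto
        have "\<alpha> * dd_node k m \<le> \<alpha> * 2" using nb \<alpha> by (intro mult_left_mono) auto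
        then have "\<alpha> * dd_node k m \<le> l i / 8" using i(1) \<alpha> by linarith
        then have "cmod (f (\<alpha> * dd_node k m) - P i (of_real (\<alpha> * dd_node k m))) \<le> (C * (l i)\<^sup>2) ^ k"
          using nb \<alpha> by (intro P(4)) auto
        then show "cmod (of_real (dd_weight k m) * (f (\<alpha> * dd_node k m) - P i (of_real (\<alpha> * dd_node k m))))
          \<le> \<bar>dd_weight k m\<bar> * (C * (l i)\<^sup>2) ^ k"
          unfolding norm_mult norm_of_real by (rule mult_left_mono) auto
      qed
      also have "\<dots> = (\<Sum>m\<le>k. \<bar>dd_weight k m\<bar>) * (C * (l i)\<^sup>2) ^ k" by (simp add: sum_distrib_right)
      also have "\<dots> \<le> 12 ^ k * (C * (64 * \<alpha>)) ^ k"
      proof (intro mult_mono dd_weight_sum_bound k power_mono mult_left_mono)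
        have "(l i)\<^sup>2 \<le> l i" using l(1,5)[of i] by (simp add: power2_eq_square mult_left_le)
        then show "(l i)\<^sup>2 \<le> 64 * \<alpha>" using li by linarith
      qed (use CCD in auto)
      also have "\<dots> = (12 * (C * (64 * \<alpha>))) ^ k" by (simp only: power_mult_distrib)
      also have "12 * (C * (64 * \<alpha>)) = (768 * C) * \<alpha>" by simp
      also have "((768 * C) * \<alpha>) ^ k \<le> X" using CCD by (intro X) auto
      finally show ?thesis .
    qed
    have tele: "S (P i) = S (P 0) + (\<Sum>q<i. S (\<lambda>z. P (Suc q) z - P q z))"
    proof -
      have "S (\<lambda>z. P (Suc q) z - P q z) = S (P (Suc q)) - S (P q)" for q
        by (simp add: S_def sum_subtractf right_diff_distrib)
      then show ?thesis using sum_lessThan_telescope[of "\<lambda>q. S (P q)" i] by simp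
    qed
    have "cmod (\<Sum>q<i. S (\<lambda>z. P (Suc q) z - P q z)) \<le> (\<Sum>q<i. 4 * X * (1 / 2) ^ q)"
      using S1 by (intro sum_norm_le) auto
    also have "\<dots> = 4 * X * (\<Sum>q<i. (1 / 2) ^ q)" by (simp add: sum_distrib_left)
    also have "\<dots> \<le> 4 * X * 2"
    proof (rule mult_left_mono)
      show "(\<Sum>q<i. (1 / 2) ^ q) \<le> (2::real)" by (simp add: sum_gp_strict)
      show "0 \<le> 4 * X" using Xnn k CD by simp
    qed
    finally have "cmod (S (P i)) \<le> 2 * X + 8 * X"
      unfolding tele using S0 norm_triangle_ineq[of "S (P 0)" "\<Sum>q<i. S (\<lambda>z. P (Suc q) z - P q z)"] by linarith
    then have "cmod (\<Sum>m\<le>k. of_real (dd_weight k m) * f (\<alpha> * dd_node k m)) \<le> 11 * X"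
      using S2 norm_triangle_ineq2[of "\<Sum>m\<le>k. of_real (dd_weight k m) * f (\<alpha> * dd_node k m)" "S (P i)"] by linarith
    also have "11 * X \<le> 11 ^ k * X"
      using k Xnn CD by (intro mult_right_mono) (auto simp: self_le_power)
    also have "\<dots> = (11 * (768 * (C * D) * \<alpha>)) ^ k" by (simp only: X_def power_mult_distrib)
    also have "11 * (768 * (C * D) * \<alpha>) = C' * \<alpha>" by (simp add: C'_def)
    finally show "cmod (\<Sum>m\<le>k. of_real (dd_weight k m) * f (\<alpha> * dd_node k m)) \<le> (C' * \<alpha>) ^ k" .
  qed
qed

section \<open>Bounded mixed differences imply smoothness\<close>

definition step_diff :: "real \<Rightarrow> 'n::finite \<Rightarrow> (real^'n \<Rightarrow> complex) \<Rightarrow> real^'n \<Rightarrow> complex" where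
  "step_diff h i F x = F (x + h *\<^sub>R axis i 1) - F x"

fun mixed_diff :: "real \<Rightarrow> 'n::finite list \<Rightarrow> (real^'n \<Rightarrow> complex) \<Rightarrow> real^'n \<Rightarrow> complex" where
  "mixed_diff h [] F = F"
| "mixed_diff h (i # is) F = step_diff h i (mixed_diff h is F)"

lemma step_diff_commute: "step_diff h i (step_diff h' j F) = step_diff h' j (step_diff h i F)"
  by (rule ext) (simp add: step_diff_def algebra_simps)

lemma mixed_diff_step_diff: "mixed_diff h is (step_diff h' j F) = step_diff h' j (mixed_diff h is F)"
  by (induction "is") (simp_all add: step_diff_commute)

lemma mixed_diff_snoc: "mixed_diff h (is @ [i]) F = mixed_diff h is (step_diff h i F)"
  by (induction "is") simp_all

lemma mixed_diff_foldr: "mixed_diff h is F = foldr (step_diff h) is F"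
  by (induction "is") simp_all

lemma mixed_diff_mset:
  assumes "mset is = mset js"
  shows "mixed_diff h is F = mixed_diff h js F"
proof -
  have "fold (step_diff h) (rev is) = fold (step_diff h) (rev js)"
    by (rule fold_multiset_equiv) (use assms in \<open>auto simp: fun_eq_iff step_diff_commute\<close>)
  then show ?thesis by (simp add: mixed_diff_foldr foldr_conv_fold)
qed

lemma dist_axis_step: "dist x (x + (h::real) *\<^sub>R (axis i 1 :: real^'n::finite)) = \<bar>h\<bar>"
  by (simp add: dist_norm)

lemma mixed_diff_tendsto:
  assumes h: "h \<ge> 0" and lim: "\<And>y. dist x y \<le> real (length is) * h \<Longrightarrow> (\<lambda>m. F m y) \<longlonglongrightarrow> L y"
  shows "(\<lambda>m. mixed_diff h is (F m) x) \<longlonglongrightarrow> mixed_diff h is L x"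
  using lim
proof (induction "is" arbitrary: x)
  case Nil
  then show ?case by simp
next
  case (Cons i "is")
  have "(\<lambda>m. mixed_diff h is (F m) x) \<longlonglongrightarrow> mixed_diff h is L x"
    by (rule Cons.IH, rule Cons.prems) (use h in \<open>simp add: algebra_simps\<close>)
  moreover have "(\<lambda>m. mixed_diff h is (F m) (x + h *\<^sub>R axis i 1)) \<longlonglongrightarrow> mixed_diff h is L (x + h *\<^sub>R axis i 1)"
  proof (rule Cons.IH, rule Cons.prems)
    fix y assume "dist (x + h *\<^sub>R axis i 1) y \<le> real (length is) * h"
    then show "dist x y \<le> real (length (i # is)) * h"
      using dist_triangle[of x y "x + h *\<^sub>R axis i 1"] dist_axis_step[of x h i] h by (simp add: algebra_simps)
  qed
  ultimately show ?case by (auto simp: step_diff_def intro!: tendsto_diff)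
qed

lemma step_diff_subdivide:
  "step_diff (real N * \<eta>) i F x = (\<Sum>l<N. step_diff \<eta> i F (x + (real l * \<eta>) *\<^sub>R axis i 1))"
proof (induction N)
  case (Suc N)
  have "step_diff (real (Suc N) * \<eta>) i F x = step_diff (real N * \<eta>) i F x + step_diff \<eta> i F (x + (real N * \<eta>) *\<^sub>R axis i 1)"
    by (simp add: step_diff_def algebra_simps)
  then show ?case using Suc by simp
qed (simp add: step_diff_def)

text \<open>Each of the \<open>length is\<close> differences of step \<open>N * \<eta>\<close>
  splits into \<open>N\<close> of step \<open>\<eta>\<close>, so bounds for arbitrarily small steps
  carry over to larger ones.\<close>

lemma mixed_diff_subdivide:
  assumes \<eta>: "\<eta> \<ge> 0" and b: "\<And>y. dist x y \<le> real (length is) * (real N * \<eta>) \<Longrightarrow> cmod (mixed_diff \<eta> is F y) \<le> C"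
  shows "cmod (mixed_diff (real N * \<eta>) is F x) \<le> real N ^ length is * C"
  using b
proof (induction "is" arbitrary: x F)
  case Nil
  then show ?case by simp
next
  case (Cons i "is")
  have "mixed_diff (real N * \<eta>) (i # is) F x = (\<Sum>l<N. mixed_diff (real N * \<eta>) is (step_diff \<eta> i F) (x + (real l * \<eta>) *\<^sub>R axis i 1))"
    by (simp add: step_diff_subdivide mixed_diff_step_diff)
  also have "cmod \<dots> \<le> (\<Sum>l<N. real N ^ length is * C)"
  proof (intro sum_norm_le Cons.IH)
    fix l y assume l: "l \<in> {..<N}"
      and y: "dist (x + (real l * \<eta>) *\<^sub>R axis i 1) y \<le> real (length is) * (real N * \<eta>)"
    have "dist x (x + (real l * \<eta>) *\<^sub>R axis i 1) \<le> real N * \<eta>"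
      using l \<eta> unfolding dist_axis_step by (simp add: mult_right_mono)
    then have "dist x y \<le> real (length (i # is)) * (real N * \<eta>)"
      using y dist_triangle[of x y "x + (real l * \<eta>) *\<^sub>R axis i 1"] by (simp add: algebra_simps)
    then show "cmod (mixed_diff \<eta> is (step_diff \<eta> i F) y) \<le> C" using Cons.prems[of y] by (simp add: mixed_diff_step_diff)
  qed
  finally show ?case by simp
qed

text \<open>\<open>h0\<close> may depend on \<open>r\<close> and on the list, \<open>B\<close> only
  on the list. Continuity is included because difference bounds relate steps with rational ratio;
  all other steps are reached as limits.\<close>

definition diff_bounded :: "real \<Rightarrow> (real^'n::finite \<Rightarrow> complex) \<Rightarrow> ('n list \<Rightarrow> real) \<Rightarrow> bool" where
  "diff_bounded R F B \<longleftrightarrow> continuous_on (ball 0 R) F \<and>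
     (\<forall>r<R. \<forall>is. \<exists>h0>0. \<forall>h. 0 < h \<and> h < h0 \<longrightarrow>
        (\<forall>x\<in>ball 0 r. cmod (mixed_diff h is F x) \<le> B is * h ^ length is))"

lemma diff_boundedD:
  assumes "diff_bounded R F B" "r < R"
  obtains h0 where "h0 > 0" "\<And>h x. 0 < h \<Longrightarrow> h < h0 \<Longrightarrow> x \<in> ball 0 r \<Longrightarrow> cmod (mixed_diff h is F x) \<le> B is * h ^ length is"
proof -
  have "\<forall>r<R. \<forall>is. \<exists>h0>0. \<forall>h. 0 < h \<and> h < h0 \<longrightarrow> (\<forall>x\<in>ball 0 r. cmod (mixed_diff h is F x) \<le> B is * h ^ length is)"
    using assms(1) unfolding diff_bounded_def by (rule conjunct2)
  then have "\<exists>h0>0. \<forall>h. 0 < h \<and> h < h0 \<longrightarrow> (\<forall>x\<in>ball 0 r. cmod (mixed_diff h is F x) \<le> B is * h ^ length is)"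
    using assms(2) by simp
  then show ?thesis using that by blast
qed

section \<open>Convergence of difference quotients\<close>

definition dquot :: "(real^'n::finite \<Rightarrow> complex) \<Rightarrow> 'n \<Rightarrow> real \<Rightarrow> real^'n \<Rightarrow> complex" where
  "dquot F i h x = step_diff h i F x /\<^sub>R h"

text \<open>Along the progression the first differences change by at most
  \<open>B * h\<^sup>2\<close> per step. Adding \<open>p\<close> of them gives an error of at most
  \<open>p\<^sup>2 * B * h\<^sup>2\<close>, and the quotient divides by
  \<open>p * h\<close>.\<close>

lemma dquot_multiple:
  assumes h: "h > 0" and p: "p \<ge> 1" and x: "\<And>l. l \<le> p \<Longrightarrow> x + (real l * h) *\<^sub>R axis i 1 \<in> V"
    and b: "\<And>y. y \<in> V \<Longrightarrow> cmod (mixed_diff h [i, i] F y) \<le> B * h\<^sup>2"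
  shows "cmod (dquot F i (real p * h) x - dquot F i h x) \<le> B * (real p * h)"
proof -
  define y where "y l = x + (real l * h) *\<^sub>R axis i 1" for l
  have B: "B * h\<^sup>2 \<ge> 0" using order_trans[OF norm_ge_zero b[OF x[of 0]]] by simp
  then have B0: "B \<ge> 0" using h by (simp add: zero_le_mult_iff)
  have step: "cmod (step_diff h i F (y l) - step_diff h i F x) \<le> real l * (B * h\<^sup>2)" if "l \<le> p" for l
    using that
  proof (induction l)
    case 0
    then show ?case by (simp add: y_def)
  next
    case (Suc l)
    have "step_diff h i F (y (Suc l)) - step_diff h i F (y l) = mixed_diff h [i, i] F (y l)"
      by (simp add: step_diff_def y_def algebra_simps)
    moreover have "cmod (mixed_diff h [i, i] F (y l)) \<le> B * h\<^sup>2" unfolding y_def using Suc.prems by (intro b x) simp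
    ultimately have "cmod (step_diff h i F (y (Suc l)) - step_diff h i F (y l)) \<le> B * h\<^sup>2" by simp
    moreover have "cmod (step_diff h i F (y l) - step_diff h i F x) \<le> real l * (B * h\<^sup>2)" using Suc by simp
    ultimately show ?case
      using norm_triangle_ineq[of "step_diff h i F (y (Suc l)) - step_diff h i F (y l)" "step_diff h i F (y l) - step_diff h i F x"]
      by (simp add: algebra_simps)
  qed
  have "step_diff (real p * h) i F x - of_nat p * step_diff h i F x = (\<Sum>l<p. step_diff h i F (y l) - step_diff h i F x)"
    by (simp add: step_diff_subdivide y_def sum_subtractf)
  also have "cmod \<dots> \<le> (\<Sum>l<p. real p * (B * h\<^sup>2))"
  proof (rule sum_norm_le)
    fix l assume l: "l \<in> {..<p}"
    have "real l * (B * h\<^sup>2) \<le> real p * (B * h\<^sup>2)" using l B by (intro mult_right_mono) auto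
    then show "cmod (step_diff h i F (y l) - step_diff h i F x) \<le> real p * (B * h\<^sup>2)" using step[of l] l by simp
  qed
  also have "\<dots> = (B * (real p * h)) * (real p * h)" by (simp add: power2_eq_square)
  finally have 1: "cmod (step_diff (real p * h) i F x - of_nat p * step_diff h i F x) \<le> (B * (real p * h)) * (real p * h)" .
  have ph: "real p * h > 0" using p h by simp
  have "dquot F i (real p * h) x - dquot F i h x = (step_diff (real p * h) i F x - of_nat p * step_diff h i F x) /\<^sub>R (real p * h)"
    using p h by (simp add: dquot_def scaleR_conv_of_real field_simps)
  then have "cmod (dquot F i (real p * h) x - dquot F i h x)
      = cmod (step_diff (real p * h) i F x - of_nat p * step_diff h i F x) / (real p * h)"
    using ph by (simp only: norm_scaleR divide_inverse abs_inverse abs_of_pos mult.commute)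
  also have "\<dots> \<le> B * (real p * h)" using 1 ph by (simp add: pos_divide_le_eq)
  finally show ?thesis .
qed

lemma ball_step:
  fixes x :: "real^'n::finite"
  assumes "x \<in> ball 0 r" "\<bar>t\<bar> \<le> r' - r"
  shows "x + t *\<^sub>R axis i 1 \<in> ball 0 r'"
proof -
  have "norm (x + t *\<^sub>R axis i 1) \<le> norm x + \<bar>t\<bar>" using norm_triangle_ineq[of x "t *\<^sub>R axis i 1"] by simp
  then show ?thesis using assms unfolding mem_ball_0 by linarith
qed

text \<open>\<open>h\<close> and \<open>h'\<close> need not be commensurable. Both are compared with
  the step \<open>h / (p + 1)\<close>, where \<open>h'\<close> is replaced by the largest multiple
  of that step not above it. These multiples tend to \<open>h'\<close> as \<open>p\<close> grows,
  and continuity of \<open>F\<close> finishes.\<close>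

lemma dquot_cauchy:
  assumes V: "\<And>y. y \<in> ball 0 r' \<Longrightarrow> isCont F y"
    and b: "\<And>h y. 0 < h \<Longrightarrow> h < h0 \<Longrightarrow> y \<in> ball 0 r' \<Longrightarrow> cmod (mixed_diff h [i, i] F y) \<le> B * h\<^sup>2"
    and x: "x \<in> ball 0 r" and h: "0 < h" "h \<le> h'" "h' \<le> r' - r" "h' < h0"
  shows "cmod (dquot F i h' x - dquot F i h x) \<le> 2 * B * h'"
proof -
  have r: "0 < r' - r" using h by linarith
  have B0: "B \<ge> 0"
  proof -
    have "x \<in> ball 0 r'" using x r by auto
    then have "0 \<le> B * h\<^sup>2" using order_trans[OF norm_ge_zero b[of h x]] h by simp
    then show ?thesis using h by (simp add: zero_le_mult_iff)
  qed
  define \<eta> where "\<eta> p = h / real (Suc p)" for p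
  define N where "N p = nat \<lfloor>h' / \<eta> p\<rfloor>" for p
  have \<eta>: "\<eta> p > 0" "\<eta> p \<le> h" "h = real (Suc p) * \<eta> p" for p
    using h by (auto simp: \<eta>_def field_simps simp del: of_nat_Suc)
  have N1: "real (N p) * \<eta> p \<le> h'" and N2: "h' \<le> real (N p) * \<eta> p + \<eta> p" and N3: "N p \<ge> 1" for p
  proof -
    have "h' / \<eta> p \<ge> 1" using \<eta>(1,2)[of p] h by (simp add: pos_le_divide_eq)
    then have f: "real (N p) = of_int \<lfloor>h' / \<eta> p\<rfloor>" "N p \<ge> 1" unfolding N_def by linarith+
    have "real (N p) \<le> h' / \<eta> p" "h' / \<eta> p \<le> real (N p) + 1" unfolding f(1) by linarith+
    then show "real (N p) * \<eta> p \<le> h'" "h' \<le> real (N p) * \<eta> p + \<eta> p"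
      using \<eta>[of p] by (auto simp: field_simps)
    show "N p \<ge> 1" by (rule f(2))
  qed
  have in_ball: "x + (real l * \<eta> p) *\<^sub>R axis i 1 \<in> ball 0 r'" if "real l * \<eta> p \<le> h'" for l p
    using that h \<eta>(1)[of p] by (intro ball_step[OF x]) (auto simp: abs_mult)
  have est: "cmod (dquot F i (real (N p) * \<eta> p) x - dquot F i h x) \<le> 2 * B * h'" for p
  proof -
    have small: "\<eta> p < h0" using \<eta>[of p] h by linarith
    have "cmod (dquot F i (real (N p) * \<eta> p) x - dquot F i (\<eta> p) x) \<le> B * (real (N p) * \<eta> p)"
    proof (rule dquot_multiple[OF \<eta>(1) N3, where V = "ball 0 r'"])
      fix l assume "l \<le> N p"
      then have "real l * \<eta> p \<le> real (N p) * \<eta> p" using \<eta>(1)[of p] by (intro mult_right_mono) auto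
      then show "x + (real l * \<eta> p) *\<^sub>R axis i 1 \<in> ball 0 r'" using N1[of p] by (intro in_ball) linarith
    qed (use b \<eta>(1) small in auto)
    moreover have "cmod (dquot F i (real (Suc p) * \<eta> p) x - dquot F i (\<eta> p) x) \<le> B * (real (Suc p) * \<eta> p)"
    proof (rule dquot_multiple[OF \<eta>(1), where V = "ball 0 r'"])
      fix l assume "l \<le> Suc p"
      then have "real l * \<eta> p \<le> real (Suc p) * \<eta> p" using \<eta>(1)[of p] by (intro mult_right_mono) auto
      then show "x + (real l * \<eta> p) *\<^sub>R axis i 1 \<in> ball 0 r'" using \<eta>(3)[of p] h by (intro in_ball) linarith
    qed (use b \<eta>(1) small in auto)
    moreover have "B * (real (N p) * \<eta> p) \<le> B * h'" "B * h \<le> B * h'" using N1[of p] B0 h by (auto intro: mult_left_mono)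
    ultimately show ?thesis
      using norm_triangle_ineq4[of "dquot F i (real (N p) * \<eta> p) x - dquot F i (\<eta> p) x" "dquot F i h x - dquot F i (\<eta> p) x"]
      unfolding \<eta>(3)[of p, symmetric] by simp
  qed
  have "(\<lambda>p. \<eta> p) \<longlonglongrightarrow> 0" unfolding \<eta>_def
    using LIMSEQ_Suc[OF lim_const_over_n[of h]] by simp
  then have "(\<lambda>p. h' - \<eta> p) \<longlonglongrightarrow> h' - 0" by (intro tendsto_intros)
  then have lim0: "(\<lambda>p. h' - \<eta> p) \<longlonglongrightarrow> h'" by simp
  have lim: "(\<lambda>p. real (N p) * \<eta> p) \<longlonglongrightarrow> h'"
  proof (rule tendsto_sandwich[where f = "\<lambda>p. h' - \<eta> p" and h = "\<lambda>_. h'", rotated 2])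
    show "eventually (\<lambda>p. h' - \<eta> p \<le> real (N p) * \<eta> p) sequentially"
      using N2 by (intro always_eventually allI) (simp add: algebra_simps)
    show "eventually (\<lambda>p. real (N p) * \<eta> p \<le> h') sequentially"
      using N1 by (intro always_eventually allI)
  qed (simp_all add: lim0)
  have cont: "isCont F (x + h' *\<^sub>R axis i 1)" using h by (intro V ball_step[OF x]) auto
  have "(\<lambda>p. F (x + (real (N p) * \<eta> p) *\<^sub>R axis i 1)) \<longlonglongrightarrow> F (x + h' *\<^sub>R axis i 1)"
    by (rule isCont_tendsto_compose[OF cont]) (intro tendsto_intros lim)
  then have "(\<lambda>p. dquot F i (real (N p) * \<eta> p) x) \<longlonglongrightarrow> dquot F i h' x"
    unfolding dquot_def step_diff_def using h by (intro tendsto_intros lim) auto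
  then have "(\<lambda>p. cmod (dquot F i (real (N p) * \<eta> p) x - dquot F i h x)) \<longlonglongrightarrow> cmod (dquot F i h' x - dquot F i h x)"
    by (intro tendsto_intros)
  then show ?thesis using est by (intro LIMSEQ_le_const2) auto
qed

text \<open>By the bound on second differences, the difference quotients for the steps \<open>h\<close> and \<open>p * h\<close> differ by
  \<open>O(p * h)\<close>; so the quotients converge locally uniformly as \<open>h\<close> tends to 0.\<close>
lemma diff_bounded_partial:
  fixes F :: "real^'n::finite \<Rightarrow> complex"
  assumes F: "diff_bounded R F B"
  shows "\<And>x. x \<in> ball 0 R \<Longrightarrow> ((\<lambda>t. F (x + t *\<^sub>R axis i 1)) has_vector_derivative partial i F x) (at 0)"
    and "diff_bounded R (partial i F) (\<lambda>is. B (is @ [i]))"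
proof -
  define L where "L x = lim (\<lambda>m. dquot F i (inverse (real (Suc m))) x)" for x
  have contF: "continuous_on (ball 0 R) F" using F by (simp add: diff_bounded_def)
  then have isC: "isCont F y" if "y \<in> ball 0 R" for y
    using that by (simp add: continuous_on_eq_continuous_at)
  have inv_lim: "(\<lambda>m. inverse (real (Suc m))) \<longlonglongrightarrow> 0" by (rule LIMSEQ_inverse_real_of_nat)
  have L: "\<exists>\<delta>>0. \<delta> \<le> (R - r) / 2 \<and> (\<forall>h x. 0 < h \<longrightarrow> h \<le> \<delta> \<longrightarrow> x \<in> ball 0 r \<longrightarrow>
      cmod (dquot F i h x - L x) \<le> 2 * B [i, i] * h)" if r: "r < R" for r
  proof -
    define r' where "r' = (r + R) / 2"
    have r': "r < r'" "r' < R" using r by (auto simp: r'_def)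
    obtain h0 where h0: "h0 > 0" "\<And>h x. 0 < h \<Longrightarrow> h < h0 \<Longrightarrow> x \<in> ball 0 r' \<Longrightarrow> cmod (mixed_diff h [i, i] F x) \<le> B [i, i] * h\<^sup>2"
      using diff_boundedD[OF F r'(2), of "[i, i]"] by (auto simp: power2_eq_square)
    define \<delta> where "\<delta> = min ((R - r) / 2) (h0 / 2)"
    have \<delta>: "\<delta> > 0" "\<delta> \<le> r' - r" "\<delta> < h0" "\<delta> \<le> (R - r) / 2" 
    proof -
      have "r' - r = (R - r) / 2" by (simp add: r'_def field_simps)
      moreover have "\<delta> \<le> (R - r) / 2" unfolding \<delta>_def by (rule min.cobounded1)
      moreover have "\<delta> \<le> h0 / 2" unfolding \<delta>_def by (rule min.cobounded2)
      moreover have "0 < \<delta>" using r h0(1) by (simp add: \<delta>_def)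
      ultimately show "\<delta> > 0" "\<delta> \<le> r' - r" "\<delta> < h0" "\<delta> \<le> (R - r) / 2" using h0(1) by linarith+
    qed
    have cau: "cmod (dquot F i h' x - dquot F i h x) \<le> 2 * B [i, i] * h'"
      if "x \<in> ball 0 r" "0 < h" "h \<le> h'" "h' \<le> \<delta>" for h h' x
      using that \<delta> r' by (intro dquot_cauchy[of r' F h0 i "B [i, i]" x r] isC h0(2)) auto
    have "cmod (dquot F i h x - L x) \<le> 2 * B [i, i] * h" if h: "0 < h" "h \<le> \<delta>" and x: "x \<in> ball 0 r" for h x
    proof -
      have B0: "0 \<le> B [i, i]"
      proof -
        have "0 \<le> 2 * B [i, i] * h" using order_trans[OF norm_ge_zero cau[OF x h(1) order_refl h(2)]] .
        then show ?thesis using h by (simp add: zero_le_mult_iff)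
      qed
      have "Cauchy (\<lambda>m. dquot F i (inverse (real (Suc m))) x)"
      proof (rule CauchyI', unfold dist_norm)
        fix e :: real assume e: "e > 0"
        have "eventually (\<lambda>m. inverse (real (Suc m)) < min \<delta> (e / (2 * B [i, i] + 1))) sequentially"
          using inv_lim \<delta>(1) e B0 by (intro order_tendstoD(2)[OF inv_lim]) auto
        then obtain M where M: "\<And>m. m \<ge> M \<Longrightarrow> inverse (real (Suc m)) < min \<delta> (e / (2 * B [i, i] + 1))"
          by (auto simp: eventually_sequentially)
        show "\<exists>M. \<forall>m\<ge>M. \<forall>n>m. norm (dquot F i (inverse (real (Suc m))) x - dquot F i (inverse (real (Suc n))) x) < e"
        proof (intro exI[of _ M] allI impI)
          fix m n assume mn: "M \<le> m" "m < n"
          have "norm (dquot F i (inverse (real (Suc m))) x - dquot F i (inverse (real (Suc n))) x)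
             \<le> 2 * B [i, i] * inverse (real (Suc m))"
            using M[OF mn(1)] mn by (intro cau x) (auto simp: le_imp_inverse_le simp del: of_nat_Suc)
          also have "\<dots> \<le> (2 * B [i, i] + 1) * inverse (real (Suc m))"
            by (intro mult_right_mono) auto
          also have "\<dots> < e"
            using M[OF mn(1)] B0 by (simp add: less_divide_eq mult.commute del: of_nat_Suc split: if_splits)
          finally show "norm (dquot F i (inverse (real (Suc m))) x - dquot F i (inverse (real (Suc n))) x) < e" .
        qed
      qed
      then have lim: "(\<lambda>m. dquot F i (inverse (real (Suc m))) x) \<longlonglongrightarrow> L x"
        unfolding L_def by (simp add: Cauchy_convergent_iff convergent_LIMSEQ_iff)
      then have "(\<lambda>m. cmod (dquot F i h x - dquot F i (inverse (real (Suc m))) x)) \<longlonglongrightarrow> cmod (dquot F i h x - L x)"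
        by (intro tendsto_intros)
      moreover have "eventually (\<lambda>m. inverse (real (Suc m)) < h) sequentially"
        using inv_lim h by (intro order_tendstoD(2)[OF inv_lim])
      then have "eventually (\<lambda>m. cmod (dquot F i h x - dquot F i (inverse (real (Suc m))) x) \<le> 2 * B [i, i] * h) sequentially"
        by eventually_elim (use h x in \<open>auto intro!: cau\<close>)
      ultimately show ?thesis by (intro tendsto_upperbound) auto
    qed
    then show ?thesis using \<delta> by blast
  qed
  have contL: "isCont L x" if x: "x \<in> ball 0 R" for x
  proof -
    obtain r where r: "norm x < r" "r < R" using x dense[of "norm x" R] by auto
    obtain \<delta> where \<delta>: "\<delta> > 0" "\<delta> \<le> (R - r) / 2" "\<And>h x. 0 < h \<Longrightarrow> h \<le> \<delta> \<Longrightarrow> x \<in> ball 0 r \<Longrightarrow>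
      cmod (dquot F i h x - L x) \<le> 2 * B [i, i] * h" using L[OF r(2)] by blast
    have "uniform_limit (ball 0 r) (\<lambda>m. dquot F i (inverse (real (Suc m)))) L sequentially"
      unfolding uniform_limit_iff
    proof (intro allI impI)
      fix e :: real assume e: "e > 0"
      have "eventually (\<lambda>m. inverse (real (Suc m)) < min \<delta> (e / (\<bar>2 * B [i, i]\<bar> + 1))) sequentially"
        using \<delta>(1) e by (intro order_tendstoD(2)[OF inv_lim]) auto
      then show "eventually (\<lambda>m. \<forall>x\<in>ball 0 r. dist (dquot F i (inverse (real (Suc m))) x) (L x) < e) sequentially"
      proof eventually_elim
        case (elim m)
        have "2 * B [i, i] * inverse (real (Suc m)) \<le> (\<bar>2 * B [i, i]\<bar> + 1) * inverse (real (Suc m))"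
          by (intro mult_right_mono) auto
        also have "\<dots> < e"
          using elim by (simp add: less_divide_eq mult.commute del: of_nat_Suc split: if_splits)
        finally have *: "2 * B [i, i] * inverse (real (Suc m)) < e" .
        show ?case
        proof
          fix y :: "real^'n" assume "y \<in> ball 0 r"
          then have "cmod (dquot F i (inverse (real (Suc m))) y - L y) \<le> 2 * B [i, i] * inverse (real (Suc m))"
            using elim by (intro \<delta>(3)) auto
          then show "dist (dquot F i (inverse (real (Suc m))) y) (L y) < e" using * by (simp add: dist_norm)
        qed
      qed
    qed
    moreover have "eventually (\<lambda>m. inverse (real (Suc m)) < \<delta>) sequentially"
      using \<delta>(1) by (intro order_tendstoD(2)[OF inv_lim])
    then have "eventually (\<lambda>m. continuous_on (ball 0 r) (dquot F i (inverse (real (Suc m))))) sequentially"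
    proof eventually_elim
      case (elim m)
      have "y + inverse (real (Suc m)) *\<^sub>R axis i 1 \<in> ball 0 R" if "y \<in> ball 0 r" for y :: "real^'n"
        using elim \<delta>(2) r by (intro ball_step[OF that]) auto
      then show ?case unfolding dquot_def[abs_def] step_diff_def
        using r by (intro continuous_intros continuous_on_compose2[OF contF] continuous_on_subset[OF contF]) auto
    qed
    ultimately have "continuous_on (ball 0 r) L"
      by (intro uniform_limit_theorem[where F = sequentially]) (auto intro: eventually_mono)
    then show ?thesis using r by (simp add: continuous_on_eq_continuous_at)
  qed
  have deriv: "((\<lambda>t. F (x + t *\<^sub>R axis i 1)) has_vector_derivative L x) (at 0)" if x: "x \<in> ball 0 R" for x
  proof -
    obtain r0 where r0: "norm x < r0" "r0 < R" using x dense[of "norm x" R] by auto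
    obtain r where r: "r0 < r" "r < R" using dense[OF r0(2)] by auto
    obtain \<delta> where \<delta>: "\<delta> > 0" "\<And>h x. 0 < h \<Longrightarrow> h \<le> \<delta> \<Longrightarrow> x \<in> ball 0 r \<Longrightarrow>
      cmod (dquot F i h x - L x) \<le> 2 * B [i, i] * h" using L[OF r(2)] by blast
    have qd: "step_diff h i F y = h *\<^sub>R dquot F i h y" if "h > 0" for h y using that by (simp add: dquot_def)
    show ?thesis unfolding has_vector_derivative_def has_derivative_at_alt
    proof (intro conjI allI impI)
      show "bounded_linear (\<lambda>h. h *\<^sub>R L x)" by (rule bounded_linear_scaleR_left)
      fix e :: real assume e: "e > 0"
      obtain d1 where d1: "d1 > 0" "\<And>y. dist y x < d1 \<Longrightarrow> dist (L y) (L x) < e / 2"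
        using contL[OF x] e unfolding continuous_at_eps_delta by (metis half_gt_zero)
      define d where "d = Min {\<delta>, d1, r - r0, e / 2 / (\<bar>2 * B [i, i]\<bar> + 1)}"
      have d: "d > 0" "d \<le> \<delta>" "d \<le> d1" "d \<le> r - r0" "d \<le> e / 2 / (\<bar>2 * B [i, i]\<bar> + 1)"
        using \<delta>(1) d1(1) r e by (auto simp: d_def)
      have near: "cmod (dquot F i h y - L y) \<le> e / 2" if "0 < h" "h < d" "y \<in> ball 0 r" for h y
      proof -
        have "cmod (dquot F i h y - L y) \<le> 2 * B [i, i] * h" using that d by (intro \<delta>(2)) auto
        also have "\<dots> \<le> (\<bar>2 * B [i, i]\<bar> + 1) * h" using that by (intro mult_right_mono) auto
        also have "\<dots> \<le> (\<bar>2 * B [i, i]\<bar> + 1) * (e / 2 / (\<bar>2 * B [i, i]\<bar> + 1))"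
          using that d by (intro mult_left_mono) auto
        also have "\<dots> = e / 2"
        proof -
          have "c * (e / 2 / c) = e / 2" if "c > 0" for c using that by simp
          from this[of "\<bar>2 * B [i, i]\<bar> + 1"] show ?thesis by linarith
        qed
        finally show ?thesis .
      qed
      show "\<exists>d>0. \<forall>t. norm (t - 0) < d \<longrightarrow>
          norm (F (x + t *\<^sub>R axis i 1) - F (x + 0 *\<^sub>R axis i 1) - (t - 0) *\<^sub>R L x) \<le> e * norm (t - 0)"
      proof (intro exI[of _ d] conjI d(1) allI impI)
        fix t :: real assume t: "norm (t - 0) < d"
        consider "t = 0" | "t > 0" | "t < 0" by linarith
        then show "norm (F (x + t *\<^sub>R axis i 1) - F (x + 0 *\<^sub>R axis i 1) - (t - 0) *\<^sub>R L x) \<le> e * norm (t - 0)"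
        proof cases
          case 2
          have "x \<in> ball 0 r" using r0 r by simp
          have "F (x + t *\<^sub>R axis i 1) - F x - t *\<^sub>R L x = t *\<^sub>R (dquot F i t x - L x)"
            using qd[OF 2, of x] by (simp add: step_diff_def scaleR_diff_right)
          moreover have "cmod (dquot F i t x - L x) \<le> e / 2" using 2 t \<open>x \<in> ball 0 r\<close> by (intro near) auto
          then have "\<bar>t\<bar> * cmod (dquot F i t x - L x) \<le> \<bar>t\<bar> * e" using e by (intro mult_left_mono) auto
          ultimately show ?thesis by (simp add: mult.commute)
        next
          case 3
          \<comment> \<open>For a backward step the forward quotient is taken at
            \<open>x + t *\<^sub>R axis i 1\<close>, and continuity of the limit \<open>L\<close>
            carries the value back to \<open>x\<close>.\<close>
          define h where "h = - t"
          have h: "h > 0" "h < d" using 3 t by (auto simp: h_def)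
          define y where "y = x + t *\<^sub>R axis i 1"
          have y: "y \<in> ball 0 r" unfolding y_def using r0 t d by (intro ball_step[where r = r0]) auto
          have xy: "x = y + h *\<^sub>R axis i 1" by (simp add: y_def h_def)
          have "F x - F y = h *\<^sub>R dquot F i h y"
            using qd[OF h(1), of y] unfolding step_diff_def xy[symmetric] .
          moreover have "F y - F x - t *\<^sub>R L x = h *\<^sub>R L x - (F x - F y)" by (simp add: h_def)
          ultimately have "F y - F x - t *\<^sub>R L x = h *\<^sub>R (L x - dquot F i h y)"
            by (simp only: scaleR_diff_right)
          moreover have "cmod (L x - dquot F i h y) \<le> e"
          proof -
            have "cmod (dquot F i h y - L y) \<le> e / 2" using h y by (intro near)
            moreover have "dist (L y) (L x) < e / 2"
              using h d by (intro d1(2)) (simp add: y_def dist_norm h_def)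
            ultimately show ?thesis
              using norm_triangle_ineq[of "dquot F i h y - L y" "L y - L x"] by (simp add: dist_norm norm_minus_commute)
          qed
          then have "\<bar>h\<bar> * cmod (L x - dquot F i h y) \<le> \<bar>h\<bar> * e" by (intro mult_left_mono) auto
          ultimately show ?thesis by (simp add: y_def h_def mult.commute)
        qed simp
      qed
    qed
  qed
  have pL: "partial i F x = L x" if "x \<in> ball 0 R" for x
    unfolding partial_def using vector_derivative_at[OF deriv[OF that]] .
  show "((\<lambda>t. F (x + t *\<^sub>R axis i 1)) has_vector_derivative partial i F x) (at 0)" if "x \<in> ball 0 R" for x
    using deriv[OF that] pL[OF that] by simp
  show "diff_bounded R (partial i F) (\<lambda>is. B (is @ [i]))"
    unfolding diff_bounded_def
  proof (intro conjI allI impI)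
    have "continuous_on (ball 0 R) L" using contL by (simp add: continuous_on_eq_continuous_at)
    then show "continuous_on (ball 0 R) (partial i F)" by (rule continuous_on_eq) (simp add: pL)
    fix r and "is" :: "'n list" assume r: "r < R"
    define k where "k = length is"
    define r' where "r' = (r + R) / 2"
    have r': "r < r'" "r' < R" using r by (auto simp: r'_def)
    obtain h0 where h0: "h0 > 0" "\<And>h x. 0 < h \<Longrightarrow> h < h0 \<Longrightarrow> x \<in> ball 0 r' \<Longrightarrow>
        cmod (mixed_diff h (is @ [i]) F x) \<le> B (is @ [i]) * h ^ Suc k"
      using diff_boundedD[OF F r'(2), of "is @ [i]"] unfolding k_def length_append_singleton by blast
    obtain \<delta> where \<delta>: "\<delta> > 0" "\<And>h x. 0 < h \<Longrightarrow> h \<le> \<delta> \<Longrightarrow> x \<in> ball 0 r' \<Longrightarrow>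
      cmod (dquot F i h x - L x) \<le> 2 * B [i, i] * h" using L[OF r'(2)] by blast
    define h1 where "h1 = min h0 ((r' - r) / (real k + 1))"
    have h1: "h1 > 0" using h0 r' by (simp add: h1_def)
    show "\<exists>h0>0. \<forall>h. 0 < h \<and> h < h0 \<longrightarrow> (\<forall>x\<in>ball 0 r. cmod (mixed_diff h is (partial i F) x) \<le> B (is @ [i]) * h ^ length is)"
    proof (intro exI[of _ h1] conjI h1 allI impI ballI)
      fix h and x :: "real^'n" assume h: "0 < h \<and> h < h1" and x: "x \<in> ball 0 r"
      have kh: "real k * h < r' - r"
      proof -
        have "h < (r' - r) / (real k + 1)" using h by (simp add: h1_def)
        then have "h * (real k + 1) < r' - r" by (simp add: pos_less_divide_eq)
        then show ?thesis using h by (simp add: algebra_simps)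
      qed
      have inb: "y \<in> ball 0 r'" if "dist x y \<le> real k * h" for y
        using that kh x dist_triangle[of 0 y x] by (simp add: dist_commute)
      define \<eta> where "\<eta> N = h / real (Suc N)" for N
      have \<eta>: "\<eta> N > 0" "\<eta> N \<le> h" "h = real (Suc N) * \<eta> N" for N
        using h by (auto simp: \<eta>_def field_simps simp del: of_nat_Suc)
      \<comment> \<open>Differences of order \<open>k + 1\<close> with the small step
        \<open>\<eta> N\<close> are added up only in the \<open>k\<close> directions of the list.
        The direction \<open>i\<close> keeps the step \<open>\<eta> N\<close> and becomes the
        derivative in the limit.\<close>
      have bound: "cmod (mixed_diff h is (dquot F i (\<eta> N)) x) \<le> B (is @ [i]) * h ^ k" for N
      proof -
        have "cmod (mixed_diff (real (Suc N) * \<eta> N) is (step_diff (\<eta> N) i F) x) \<le> real (Suc N) ^ length is * (B (is @ [i]) * \<eta> N ^ Suc k)"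
        proof (rule mixed_diff_subdivide)
          show "0 \<le> \<eta> N" using \<eta>(1)[of N] by simp
          fix y assume "dist x y \<le> real (length is) * (real (Suc N) * \<eta> N)"
          then have "y \<in> ball 0 r'" unfolding \<eta>(3)[symmetric] k_def[symmetric] by (rule inb)
          moreover have "\<eta> N < h0" using \<eta>(2)[of N] h by (simp add: h1_def)
          ultimately show "cmod (mixed_diff (\<eta> N) is (step_diff (\<eta> N) i F) y) \<le> B (is @ [i]) * \<eta> N ^ Suc k"
            using h0(2)[OF \<eta>(1)] by (simp only: mixed_diff_snoc)
        qed
        also have "\<dots> = B (is @ [i]) * h ^ k * \<eta> N"
        proof -
          have "h ^ k = real (Suc N) ^ k * \<eta> N ^ k" by (subst \<eta>(3)[of N]) (rule power_mult_distrib)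
          then show ?thesis unfolding k_def[symmetric] by (simp only: power_Suc mult_ac)
        qed
        finally have "cmod (mixed_diff h is (step_diff (\<eta> N) i F) x) \<le> B (is @ [i]) * h ^ k * \<eta> N" unfolding \<eta>(3)[symmetric] .
        moreover have "mixed_diff h is (\<lambda>y. c *\<^sub>R G y) x = c *\<^sub>R mixed_diff h is G x" for c G x
          by (induction "is" arbitrary: x) (simp_all add: step_diff_def scaleR_diff_right)
        then have "mixed_diff h is (dquot F i (\<eta> N)) x = mixed_diff h is (step_diff (\<eta> N) i F) x /\<^sub>R \<eta> N"
          by (simp add: dquot_def[abs_def])
        ultimately show ?thesis using \<eta>(1)[of N] by (simp add: field_simps)
      qed
      have "(\<lambda>N. mixed_diff h is (dquot F i (\<eta> N)) x) \<longlonglongrightarrow> mixed_diff h is (partial i F) x"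
      proof (rule mixed_diff_tendsto)
        fix y assume "dist x y \<le> real (length is) * h"
        then have y: "y \<in> ball 0 r'" using inb by (simp add: k_def)
        have \<eta>0: "\<eta> \<longlonglongrightarrow> 0" unfolding \<eta>_def[abs_def]
          using LIMSEQ_Suc[OF lim_const_over_n[of h]] by simp
        have "(\<lambda>N. dquot F i (\<eta> N) y) \<longlonglongrightarrow> L y"
        proof (rule Lim_transform_bound[where g = "\<lambda>N. 2 * B [i, i] * \<eta> N", THEN LIM_zero_cancel])
          show "eventually (\<lambda>N. norm (dquot F i (\<eta> N) y - L y) \<le> norm (2 * B [i, i] * \<eta> N)) sequentially"
          proof -
            have "eventually (\<lambda>N. \<eta> N < \<delta>) sequentially" using \<delta>(1) \<eta>0 by (intro order_tendstoD(2))
            then show ?thesis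
            proof eventually_elim
              case (elim N)
              have "cmod (dquot F i (\<eta> N) y - L y) \<le> 2 * B [i, i] * \<eta> N" using elim \<eta>(1) y by (intro \<delta>(2)) auto
              then show ?case by simp
            qed
          qed
          show "(\<lambda>N. 2 * B [i, i] * \<eta> N) \<longlonglongrightarrow> 0" using tendsto_mult_right_zero[OF \<eta>0] by simp
        qed
        moreover have "partial i F y = L y" using y r' by (intro pL) auto
        ultimately show "(\<lambda>N. dquot F i (\<eta> N) y) \<longlonglongrightarrow> partial i F y" by simp
      qed (use h in simp)
      then have "(\<lambda>N. cmod (mixed_diff h is (dquot F i (\<eta> N)) x)) \<longlonglongrightarrow> cmod (mixed_diff h is (partial i F) x)" by (rule tendsto_norm)
      then show "cmod (mixed_diff h is (partial i F) x) \<le> B (is @ [i]) * h ^ length is"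
        using bound unfolding k_def by (intro LIMSEQ_le_const2) auto
    qed
  qed
qed

lemma diff_bounded_iter_partial:
  assumes "diff_bounded R F B"
  shows "diff_bounded R (iter_partial is F) (\<lambda>js. B (js @ is))"
proof (induction "is")
  case (Cons i "is")
  from diff_bounded_partial(2)[OF Cons.IH, of i] show ?case by simp
qed (use assms in simp)

lemma diff_bounded_bound:
  assumes "diff_bounded R F B" "x \<in> ball 0 R"
  shows "cmod (F x) \<le> B []"
proof -
  obtain r where r: "norm x < r" "r < R" using assms(2) dense[of "norm x" R] by auto
  obtain h0 where h0: "h0 > 0" "\<And>h x. 0 < h \<Longrightarrow> h < h0 \<Longrightarrow> x \<in> ball 0 r \<Longrightarrow> cmod (mixed_diff h [] F x) \<le> B [] * h ^ length ([] :: 'a list)"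
    using diff_boundedD[OF assms(1) r(2)] by blast
  have "x \<in> ball 0 r" unfolding mem_ball_0 by (rule r(1))
  then show ?thesis using h0(2)[of "h0 / 2" x] h0(1) by simp
qed

theorem diff_bounded_smooth:
  fixes F :: "real^'n::finite \<Rightarrow> complex"
  assumes "diff_bounded R F B"
  shows "smooth_on (ball 0 R) F" and "\<And>x is. x \<in> ball 0 R \<Longrightarrow> cmod (iter_partial is F x) \<le> B is"
proof -
  note it = diff_bounded_iter_partial[OF assms]
  show "smooth_on (ball 0 R) F"
    unfolding smooth_on_def
  proof (intro allI conjI ballI)
    fix "is" show "continuous_on (ball 0 R) (iter_partial is F)" using it[of "is"] by (simp add: diff_bounded_def)
    fix i and x :: "real^'n" assume "x \<in> ball 0 R"
    from diff_bounded_partial(1)[OF it this] show "(\<lambda>t. iter_partial is F (x + t *\<^sub>R axis i 1)) differentiable (at 0)"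
      by (auto simp: has_vector_derivative_def differentiable_def)
  qed
  show "cmod (iter_partial is F x) \<le> B is" if "x \<in> ball 0 R" for x "is"
    using diff_bounded_bound[OF it that] by simp
qed

section \<open>Derivatives of smooth functions along segments\<close>

lemma smooth_on_partial:
  assumes "smooth_on U f" "x \<in> U"
  shows "((\<lambda>t. iter_partial is f (x + t *\<^sub>R axis i 1)) has_vector_derivative iter_partial (i # is) f x) (at 0)"
  using assms by (auto simp: smooth_on_def partial_def vector_derivative_works)

lemma smooth_on_continuous: "smooth_on U f \<Longrightarrow> continuous_on U (iter_partial is f)"
  by (auto simp: smooth_on_def)

lemma smooth_on_subset: "smooth_on U f \<Longrightarrow> V \<subseteq> U \<Longrightarrow> smooth_on V f"
  unfolding smooth_on_def by (blast intro: continuous_on_subset)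

lemma has_vector_derivative_shift_zero:
  fixes F :: "real^'n::finite \<Rightarrow> complex"
  assumes "((\<lambda>t. F (x + s *\<^sub>R v + t *\<^sub>R v)) has_vector_derivative D) (at 0)"
  shows "((\<lambda>t. F (x + t *\<^sub>R v)) has_vector_derivative D) (at s)"
proof -
  have "((\<lambda>t. t - s) has_vector_derivative 1) (at s)"
    by (auto intro!: derivative_eq_intros)
  moreover have "((\<lambda>t. F (x + s *\<^sub>R v + t *\<^sub>R v)) has_vector_derivative D) (at (s - s))"
    using assms by simp
  ultimately have "((\<lambda>t. F (x + s *\<^sub>R v + t *\<^sub>R v)) \<circ> (\<lambda>t. t - s) has_vector_derivative (1 *\<^sub>R D)) (at s)"
    by (rule vector_diff_chain_at)
  then show ?thesis by (simp add: o_def algebra_simps)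
qed

lemma axis_mean_value:
  fixes F :: "real^'n::finite \<Rightarrow> complex"
  assumes h: "h \<ge> 0"
    and d: "\<And>s. 0 \<le> s \<Longrightarrow> s \<le> h \<Longrightarrow> ((\<lambda>t. F (x + s *\<^sub>R v + t *\<^sub>R v)) has_vector_derivative D s) (at 0)"
    and b: "\<And>s. 0 \<le> s \<Longrightarrow> s \<le> h \<Longrightarrow> cmod (D s) \<le> M"
  shows "cmod (F (x + h *\<^sub>R v) - F x) \<le> M * h"
proof (cases "h = 0")
  case False
  define \<phi> where "\<phi> t = F (x + t *\<^sub>R v)" for t
  have d': "(\<phi> has_vector_derivative D s) (at s)" if "0 \<le> s" "s \<le> h" for s
    unfolding \<phi>_def by (rule has_vector_derivative_shift_zero[OF d[OF that]])
  have "norm (\<phi> h - \<phi> 0) \<le> M * h - M * 0"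
  proof (rule differentiable_bound_general[where f' = D and \<phi>' = "\<lambda>_. M"])
    show "0 < h" using False h by simp
    show "continuous_on {0..h} \<phi>"
      by (intro continuous_at_imp_continuous_on ballI has_vector_derivative_continuous[OF d']) auto
    show "(\<phi> has_vector_derivative D s) (at s)" if "0 < s" "s < h" for s using d' that by simp
    show "cmod (D s) \<le> M" if "0 < s" "s < h" for s using b that by simp
    show "((*) M has_vector_derivative M) (at s)" for s
      by (auto intro!: derivative_eq_intros)
  qed (intro continuous_intros)
  then show ?thesis by (simp add: \<phi>_def)
qed simp

lemma mixed_diff_has_partial:
  assumes g: "smooth_on V g" and V: "\<And>y. dist x y \<le> real (length js) * \<bar>h\<bar> \<Longrightarrow> y \<in> V"
  shows "((\<lambda>t. mixed_diff h js (iter_partial ks g) (x + t *\<^sub>R axis i 1)) has_vector_derivative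
           mixed_diff h js (iter_partial (i # ks) g) x) (at 0)"
  using V
proof (induction js arbitrary: x)
  case Nil
  then show ?case using smooth_on_partial[OF g] by simp
next
  case (Cons j js)
  have 1: "((\<lambda>t. mixed_diff h js (iter_partial ks g) (x + t *\<^sub>R axis i 1)) has_vector_derivative
           mixed_diff h js (iter_partial (i # ks) g) x) (at 0)"
    by (rule Cons.IH, rule Cons.prems) (simp add: algebra_simps)
  have 2: "((\<lambda>t. mixed_diff h js (iter_partial ks g) (x + h *\<^sub>R axis j 1 + t *\<^sub>R axis i 1)) has_vector_derivative
           mixed_diff h js (iter_partial (i # ks) g) (x + h *\<^sub>R axis j 1)) (at 0)"
  proof (rule Cons.IH, rule Cons.prems)
    fix y assume "dist (x + h *\<^sub>R axis j 1) y \<le> real (length js) * \<bar>h\<bar>"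
    then show "dist x y \<le> real (length (j # js)) * \<bar>h\<bar>"
      using dist_triangle[of x y "x + h *\<^sub>R axis j 1"] dist_axis_step[of x h j] by (simp add: algebra_simps)
  qed
  have eq: "mixed_diff h (j # js) (iter_partial ks g) (x + t *\<^sub>R axis i 1) =
     mixed_diff h js (iter_partial ks g) (x + h *\<^sub>R axis j 1 + t *\<^sub>R axis i 1) - mixed_diff h js (iter_partial ks g) (x + t *\<^sub>R axis i 1)" for t
    by (simp add: step_diff_def add.commute add.left_commute)
  show ?case unfolding eq using has_vector_derivative_diff[OF 2 1] by (simp add: step_diff_def)
qed

text \<open>The mean value inequality is applied in the direction of the head of \<open>js\<close>,
  then recursively. The head becomes the innermost of the new partial derivatives, hence
  \<open>rev js\<close>.\<close>

lemma mixed_diff_bound: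
  assumes g: "smooth_on V g" and h: "h \<ge> 0"
    and V: "\<And>y. dist x y \<le> real (length js) * h \<Longrightarrow> y \<in> V"
    and b: "\<And>y. y \<in> V \<Longrightarrow> cmod (iter_partial (rev js @ ks) g y) \<le> M"
  shows "cmod (mixed_diff h js (iter_partial ks g) x) \<le> M * h ^ length js"
  using V b
proof (induction js arbitrary: ks x)
  case Nil
  then show ?case by simp
next
  case (Cons i js)
  have inV: "y \<in> V" if "0 \<le> s" "s \<le> h" "dist (x + s *\<^sub>R axis i 1) y \<le> real (length js) * h" for s y
  proof (rule Cons.prems(1))
    show "dist x y \<le> real (length (i # js)) * h"
      using dist_triangle[of x y "x + s *\<^sub>R axis i 1"] dist_axis_step[of x s i] that by (simp add: algebra_simps)
  qed
  have "cmod (mixed_diff h js (iter_partial ks g) (x + h *\<^sub>R axis i 1) - mixed_diff h js (iter_partial ks g) x) \<le> (M * h ^ length js) * h"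
  proof (rule axis_mean_value[OF h])
    fix s assume s: "0 \<le> s" "s \<le> h"
    show "((\<lambda>t. mixed_diff h js (iter_partial ks g) (x + s *\<^sub>R axis i 1 + t *\<^sub>R axis i 1)) has_vector_derivative
           mixed_diff h js (iter_partial (i # ks) g) (x + s *\<^sub>R axis i 1)) (at 0)"
      by (rule mixed_diff_has_partial[OF g]) (use inV[OF s] h in auto)
    show "cmod (mixed_diff h js (iter_partial (i # ks) g) (x + s *\<^sub>R axis i 1)) \<le> M * h ^ length js"
      by (rule Cons.IH) (use inV[OF s] Cons.prems(2) in auto)
  qed
  then show ?case by (simp add: step_diff_def mult_ac)
qed

section \<open>Partial derivatives in arbitrary order\<close>

lemma mset_sorted_indices:
  fixes js :: "'n::finite list"
  shows "mset (concat (map (\<lambda>i. replicate (count (mset js) i) i) index_list)) = mset js"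
proof -
  have il: "set (index_list :: 'n list) = UNIV" "distinct (index_list :: 'n list)"
    using someI_ex[OF finite_distinct_list[OF finite[of "UNIV :: 'n set"]]] unfolding index_list_def by blast+
  have "count (mset (concat (map (\<lambda>i. replicate (c i) i) xs))) k = (if k \<in> set xs then c k else 0)"
    if "distinct xs" for xs :: "'n list" and c k
    using that by (induction xs) auto
  from this[OF il(2)] il(1) show ?thesis by (intro multiset_eqI) simp
qed

lemma mi_len_count: "mi_len (count (mset js)) = length (js :: 'n::finite list)"
proof -
  have "length js = (\<Sum>i\<in>set_mset (mset js). count (mset js) i)"
    by (metis size_mset size_multiset_overloaded_eq)
  also have "\<dots> = (\<Sum>i\<in>UNIV. count (mset js) i)"
    by (rule sum.mono_neutral_left) (auto simp: not_in_iff)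
  finally show ?thesis by (simp add: mi_len_def)
qed

text \<open>The classes bound \<open>dpartial\<close>, whose indices come in a fixed order. Mixed
  differences do not depend on the order, so passing to them and back with
  \<open>diff_bounded_smooth\<close> bounds \<open>iter_partial\<close> for every order of the
  indices.\<close>

lemma dpartial_bound_diff_bounded:
  fixes g :: "real^'n::finite \<Rightarrow> complex"
  assumes g: "smooth_on (ball 0 R) g" and b: "\<And>x \<alpha>. x \<in> ball 0 R \<Longrightarrow> cmod (dpartial \<alpha> g x) \<le> M (mi_len \<alpha>)"
  shows "diff_bounded R g (\<lambda>is. M (length is))"
  unfolding diff_bounded_def
proof (intro conjI allI impI)
  show "continuous_on (ball 0 R) g" using smooth_on_continuous[OF g, of "[]"] by simp
  fix r and "is" :: "'n list" assume r: "r < R"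
  define js where "js = concat (map (\<lambda>i. replicate (count (mset is) i) i) (index_list :: 'n list))"
  define h0 where "h0 = (R - r) / (real (length is) + 1)"
  have h0: "h0 > 0" using r by (simp add: h0_def)
  show "\<exists>h0>0. \<forall>h. 0 < h \<and> h < h0 \<longrightarrow> (\<forall>x\<in>ball 0 r. cmod (mixed_diff h is g x) \<le> M (length is) * h ^ length is)"
  proof (intro exI[of _ h0] conjI h0 allI impI ballI)
    fix h and x :: "real^'n" assume h: "0 < h \<and> h < h0" and x: "x \<in> ball 0 r"
    have ms: "mset (rev js) = mset is" unfolding js_def using mset_sorted_indices[of "is"] by simp
    then have len: "length (rev js) = length is" using mset_eq_length by blast
    then have len': "length js = length is" by simp
    have "cmod (mixed_diff h (rev js) (iter_partial [] g) x) \<le> M (length is) * h ^ length (rev js)"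
    proof (rule mixed_diff_bound[OF g])
      fix y assume "dist x y \<le> real (length (rev js)) * h"
      moreover have "real (length is) * h < R - r"
      proof -
        have "h * (real (length is) + 1) < R - r" using h by (simp add: h0_def pos_less_divide_eq)
        then show ?thesis using h by (simp add: algebra_simps)
      qed
      ultimately show "y \<in> ball 0 R"
        using x dist_triangle[of 0 y x] by (simp add: len' dist_commute)
    next
      fix y :: "real^'n" assume "y \<in> ball 0 R"
      from b[OF this, of "count (mset is)"]
      show "cmod (iter_partial (rev (rev js) @ []) g y) \<le> M (length is)"
        by (simp add: dpartial_def js_def mi_len_count)
    qed (use h in simp)
    then show "cmod (mixed_diff h is g x) \<le> M (length is) * h ^ length is"
      using mixed_diff_mset[OF ms, of h g] by (simp add: len')
  qed
qed

section \<open>Directional derivatives from continuous partial derivatives\<close>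

lemma directional_derivative_step:
  fixes F :: "real^'n::finite \<Rightarrow> complex"
  assumes V: "open V" "y \<in> V"
    and d: "\<And>z. z \<in> V \<Longrightarrow> ((\<lambda>t. F (z + t *\<^sub>R axis j 1)) has_vector_derivative F' z) (at 0)"
    and c: "continuous_on V F'"
    and w: "((\<lambda>t. F (y + t *\<^sub>R w)) has_vector_derivative D) (at 0)"
  shows "((\<lambda>t. F (y + t *\<^sub>R (w + c *\<^sub>R axis j 1))) has_vector_derivative (D + c *\<^sub>R F' y)) (at 0)"
  unfolding has_vector_derivative_def has_derivative_at_alt
proof (intro conjI allI impI)
  show "bounded_linear (\<lambda>h. h *\<^sub>R (D + c *\<^sub>R F' y))" by (rule bounded_linear_scaleR_left)
  fix e :: real assume e: "e > 0"
  define e' where "e' = e / 2 / (\<bar>c\<bar> + 1)"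
  have e': "e' > 0" using e by (simp add: e'_def)
  have ce: "\<bar>c\<bar> * e' \<le> e / 2"
  proof -
    have "\<bar>c\<bar> * e' \<le> (\<bar>c\<bar> + 1) * e'" using e' by (intro mult_right_mono) auto
    also have "\<dots> = e / 2"
    proof -
      have "q * (e / 2 / q) = e / 2" if "q > 0" for q using that by simp
      from this[of "\<bar>c\<bar> + 1"] show ?thesis unfolding e'_def by linarith
    qed
    finally show ?thesis .
  qed
  have "isCont F' y" using c V by (simp add: continuous_on_eq_continuous_at)
  then obtain d1 where d1: "d1 > 0" "\<And>z. dist z y < d1 \<Longrightarrow> dist (F' z) (F' y) < e'"
    using e' unfolding continuous_at_eps_delta by blast
  obtain d2 where d2: "d2 > 0" "ball y d2 \<subseteq> V" using V openE by blast
  obtain d3 where d3: "d3 > 0" "\<And>t. norm (t - 0) < d3 \<Longrightarrow>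
      norm (F (y + t *\<^sub>R w) - F (y + 0 *\<^sub>R w) - (t - 0) *\<^sub>R D) \<le> e / 2 * norm (t - 0)"
    using w e unfolding has_vector_derivative_def has_derivative_at_alt by (meson half_gt_zero)
  define q where "q = norm w + \<bar>c\<bar> + 1"
  have q: "q > 0" unfolding q_def by (smt (verit) norm_ge_zero)
  define \<delta> where "\<delta> = Min {d1 / q, d2 / q, d3}"
  have \<delta>: "\<delta> > 0" "\<delta> \<le> d1 / q" "\<delta> \<le> d2 / q" "\<delta> \<le> d3" using d1 d2 d3 q by (auto simp: \<delta>_def)
  show "\<exists>\<delta>>0. \<forall>t. norm (t - 0) < \<delta> \<longrightarrow> norm (F (y + t *\<^sub>R (w + c *\<^sub>R axis j 1)) - F (y + 0 *\<^sub>R (w + c *\<^sub>R axis j 1))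
      - (t - 0) *\<^sub>R (D + c *\<^sub>R F' y)) \<le> e * norm (t - 0)"
  proof (intro exI[of _ \<delta>] conjI \<delta>(1) allI impI)
    fix t :: real assume "norm (t - 0) < \<delta>"
    then have t: "\<bar>t\<bar> < \<delta>" by simp
    define z where "z = y + t *\<^sub>R w"
    \<comment> \<open>\<open>axis_mean_value\<close> takes nonnegative steps, so the sign of
      \<open>t * c\<close> is put into the direction.\<close>
    define v where "v = (if t * c \<ge> 0 then 1 else - 1) *\<^sub>R (axis j 1 :: real^'n)"
    define \<sigma> :: real where "\<sigma> = (if t * c \<ge> 0 then 1 else - 1)"
    have v: "v = \<sigma> *\<^sub>R axis j 1" "\<bar>\<sigma>\<bar> = 1" "\<sigma> * \<bar>t * c\<bar> = t * c" by (auto simp: v_def \<sigma>_def abs_if)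
    have tq: "\<bar>t\<bar> * q < d1" "\<bar>t\<bar> * q < d2"
      using t \<delta> q by (auto simp: pos_le_divide_eq intro: less_le_trans[OF mult_strict_right_mono])
    have near: "dist y (z + s *\<^sub>R v) \<le> \<bar>t\<bar> * q" if "0 \<le> s" "s \<le> \<bar>t * c\<bar>" for s
    proof -
      have "dist y (z + s *\<^sub>R v) = norm (t *\<^sub>R w + s *\<^sub>R v)" by (simp add: z_def dist_norm norm_minus_commute algebra_simps)
      also have "\<dots> \<le> \<bar>t\<bar> * norm w + \<bar>t\<bar> * \<bar>c\<bar>"
        using norm_triangle_ineq[of "t *\<^sub>R w" "s *\<^sub>R v"] that v by (simp add: abs_mult)
      also have "\<dots> \<le> \<bar>t\<bar> * q" by (simp add: q_def algebra_simps)
      finally show ?thesis .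
    qed
    \<comment> \<open>Subtracting the expected linear part leaves a function whose derivative near
      \<open>y\<close> is at most \<open>e'\<close>, by continuity of \<open>F'\<close>.\<close>
    define \<Phi> where "\<Phi> x = F x - (x \<bullet> axis j 1) *\<^sub>R F' y" for x
    have "cmod (\<Phi> (z + \<bar>t * c\<bar> *\<^sub>R v) - \<Phi> z) \<le> e' * \<bar>t * c\<bar>"
    proof (rule axis_mean_value)
      fix s assume s: "0 \<le> s" "s \<le> \<bar>t * c\<bar>"
      define x where "x = z + s *\<^sub>R v"
      have x: "dist x y < d1" "x \<in> V"
        using near[OF s] tq d2(2) by (auto simp: x_def dist_commute subset_iff)
      have "((\<lambda>t. F (x + t *\<^sub>R axis j 1)) has_vector_derivative F' x) (at (\<sigma> * 0))" using d[OF x(2)] by simp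
      moreover have "((\<lambda>t. \<sigma> * t) has_vector_derivative \<sigma>) (at 0)" by (auto intro!: derivative_eq_intros)
      ultimately have "((\<lambda>t. F (x + t *\<^sub>R axis j 1)) \<circ> (\<lambda>t. \<sigma> * t) has_vector_derivative \<sigma> *\<^sub>R F' x) (at 0)"
        by (intro vector_diff_chain_at) auto
      then have 1: "((\<lambda>t. F (x + t *\<^sub>R v)) has_vector_derivative \<sigma> *\<^sub>R F' x) (at 0)"
        by (simp add: o_def v(1) mult.commute)
      have 2: "((\<lambda>t. ((x + t *\<^sub>R v) \<bullet> axis j 1) *\<^sub>R F' y) has_vector_derivative \<sigma> *\<^sub>R F' y) (at 0)"
      proof -
        have "((\<lambda>t. (x \<bullet> axis j 1 + t * \<sigma>) *\<^sub>R F' y) has_vector_derivative \<sigma> *\<^sub>R F' y) (at 0)"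
          by (auto intro!: derivative_eq_intros)
        then show ?thesis by (simp add: v(1) inner_add_left inner_axis_axis)
      qed
      show "((\<lambda>t. \<Phi> (z + s *\<^sub>R v + t *\<^sub>R v)) has_vector_derivative \<sigma> *\<^sub>R (F' (z + s *\<^sub>R v) - F' y)) (at 0)"
        unfolding \<Phi>_def x_def[symmetric] scaleR_diff_right by (rule has_vector_derivative_diff[OF 1 2])
      show "cmod (\<sigma> *\<^sub>R (F' (z + s *\<^sub>R v) - F' y)) \<le> e'"
        using d1(2)[OF x(1)] v(2) unfolding x_def by (simp add: dist_norm)
    qed simp
    also have "z + \<bar>t * c\<bar> *\<^sub>R v = y + t *\<^sub>R (w + c *\<^sub>R axis j 1)"
    proof -
      have "\<bar>t * c\<bar> *\<^sub>R v = (\<sigma> * \<bar>t * c\<bar>) *\<^sub>R axis j 1" by (simp add: v(1) mult.commute)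
      then show ?thesis by (simp add: v(3) z_def scaleR_add_right add.assoc)
    qed
    finally have A: "cmod (\<Phi> (y + t *\<^sub>R (w + c *\<^sub>R axis j 1)) - \<Phi> z) \<le> e' * \<bar>t * c\<bar>" .
    have "\<Phi> (y + t *\<^sub>R (w + c *\<^sub>R axis j 1)) - \<Phi> z
        = F (y + t *\<^sub>R (w + c *\<^sub>R axis j 1)) - F z - (t * c) *\<^sub>R F' y"
      by (simp add: \<Phi>_def z_def inner_add_left inner_axis_axis scaleR_add_left scaleR_add_right)
    then have B: "cmod (F (y + t *\<^sub>R (w + c *\<^sub>R axis j 1)) - F z - (t * c) *\<^sub>R F' y) \<le> e / 2 * \<bar>t\<bar>"
      using A mult_left_mono[OF ce, of "\<bar>t\<bar>"] by (simp add: abs_mult mult_ac)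
    have C: "cmod (F z - F y - t *\<^sub>R D) \<le> e / 2 * \<bar>t\<bar>"
      using d3(2)[of t] t \<delta> by (simp add: z_def)
    have split: "F (y + t *\<^sub>R (w + c *\<^sub>R axis j 1)) - F y - t *\<^sub>R (D + c *\<^sub>R F' y) =
      (F (y + t *\<^sub>R (w + c *\<^sub>R axis j 1)) - F z - (t * c) *\<^sub>R F' y) + (F z - F y - t *\<^sub>R D)"
      by (simp add: scaleR_add_right)
    have "cmod (F (y + t *\<^sub>R (w + c *\<^sub>R axis j 1)) - F y - t *\<^sub>R (D + c *\<^sub>R F' y)) \<le> e / 2 * \<bar>t\<bar> + e / 2 * \<bar>t\<bar>"
      unfolding split by (rule norm_triangle_mono[OF B C])
    then show "norm (F (y + t *\<^sub>R (w + c *\<^sub>R axis j 1)) - F (y + 0 *\<^sub>R (w + c *\<^sub>R axis j 1))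
      - (t - 0) *\<^sub>R (D + c *\<^sub>R F' y)) \<le> e * norm (t - 0)" by simp
  qed
qed

lemma directional_derivative:
  fixes F :: "real^'n::finite \<Rightarrow> complex"
  assumes V: "open V" "y \<in> V"
    and d: "\<And>z j. z \<in> V \<Longrightarrow> ((\<lambda>t. F (z + t *\<^sub>R axis j 1)) has_vector_derivative F' j z) (at 0)"
    and c: "\<And>j. continuous_on V (F' j)"
  shows "((\<lambda>t. F (y + t *\<^sub>R v)) has_vector_derivative (\<Sum>j\<in>UNIV. v $ j *\<^sub>R F' j y)) (at 0)"
proof -
  have "((\<lambda>t. F (y + t *\<^sub>R (\<Sum>j\<in>S. v $ j *\<^sub>R axis j 1))) has_vector_derivative (\<Sum>j\<in>S. v $ j *\<^sub>R F' j y)) (at 0)"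
    if "finite S" for S
    using that
  proof (induction S rule: finite_induct)
    case empty
    show ?case by simp
  next
    case (insert j S)
    from directional_derivative_step[where j = j and c = "v $ j", OF V d c insert.IH] insert.hyps
    show ?case by (simp add: add.commute)
  qed
  from this[of UNIV] have "((\<lambda>t. F (y + t *\<^sub>R (\<Sum>j\<in>UNIV. v $ j *\<^sub>R axis j 1))) has_vector_derivative
      (\<Sum>j\<in>UNIV. v $ j *\<^sub>R F' j y)) (at 0)" by simp
  moreover have "(\<Sum>j\<in>UNIV. v $ j *\<^sub>R axis j 1) = v"
    using basis_expansion[of v] by (simp add: scalar_mult_eq_scaleR)
  ultimately show ?thesis by (simp only:)
qed

text \<open>The \<open>m\<close>-th derivative in direction \<open>v\<close> of
  \<open>iter_partial ks g\<close>, expanded into partial derivatives: the new indices pile up in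
  \<open>ks\<close>, so bounds on \<open>iter_partial\<close> apply directly.\<close>

fun iter_directional :: "real^'n::finite \<Rightarrow> nat \<Rightarrow> 'n list \<Rightarrow> (real^'n \<Rightarrow> complex) \<Rightarrow> real^'n \<Rightarrow> complex" where
  "iter_directional v 0 ks g y = iter_partial ks g y"
| "iter_directional v (Suc m) ks g y = (\<Sum>j\<in>UNIV. v $ j *\<^sub>R iter_directional v m (j # ks) g y)"

lemma iter_directional_derivative:
  assumes g: "smooth_on V g" "open V" "y \<in> V"
  shows "((\<lambda>t. iter_directional v m ks g (y + t *\<^sub>R v)) has_vector_derivative iter_directional v (Suc m) ks g y) (at 0)"
proof (induction m arbitrary: ks)
  case 0
  have "((\<lambda>t. iter_partial ks g (y + t *\<^sub>R v)) has_vector_derivative (\<Sum>j\<in>UNIV. v $ j *\<^sub>R iter_partial (j # ks) g y)) (at 0)"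
    by (rule directional_derivative[OF g(2,3)])
       (auto intro: smooth_on_partial[OF g(1)] smooth_on_continuous[OF g(1)] simp del: iter_partial.simps)
  then show ?case by simp
next
  case (Suc m)
  have "((\<lambda>t. \<Sum>j\<in>UNIV. v $ j *\<^sub>R iter_directional v m (j # ks) g (y + t *\<^sub>R v)) has_vector_derivative
      (\<Sum>j\<in>UNIV. v $ j *\<^sub>R iter_directional v (Suc m) (j # ks) g y)) (at 0)"
    by (intro has_vector_derivative_sum bounded_linear.has_vector_derivative[OF bounded_linear_scaleR_right] Suc)
  then show ?case by simp
qed

lemma iter_directional_bound:
  fixes v :: "real^'n::finite"
  assumes v: "\<And>j. \<bar>v $ j\<bar> \<le> 1" and b: "\<And>is. length is = m + length ks \<Longrightarrow> cmod (iter_partial is g y) \<le> M"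
  shows "cmod (iter_directional v m ks g y) \<le> real CARD('n) ^ m * M"
  using b
proof (induction m arbitrary: ks)
  case (Suc m)
  have "cmod (iter_directional v (Suc m) ks g y) \<le> (\<Sum>j\<in>(UNIV :: 'n set). real CARD('n) ^ m * M)"
    unfolding iter_directional.simps
  proof (rule sum_norm_le)
    fix j :: 'n
    have IH: "cmod (iter_directional v m (j # ks) g y) \<le> real CARD('n) ^ m * M" by (rule Suc.IH) (use Suc.prems in auto)
    have "cmod (v $ j *\<^sub>R iter_directional v m (j # ks) g y) \<le> 1 * cmod (iter_directional v m (j # ks) g y)"
      unfolding norm_scaleR by (intro mult_right_mono) (use v in auto)
    with IH show "cmod (v $ j *\<^sub>R iter_directional v m (j # ks) g y) \<le> real CARD('n) ^ m * M" by simp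
  qed
  then show ?case by simp
qed simp

text \<open>Away from its zeros \<open>f\<close> is the quotient of the two powers; at a zero,
  \<open>\<bar>f\<bar>\<close> is the \<open>j\<close>-th root of \<open>\<bar>f ^ j\<bar>\<close>
  and tends to 0.\<close>

lemma continuous_on_power_root:
  fixes f :: "'a::topological_space \<Rightarrow> complex"
  assumes j: "j \<ge> 1" and g: "continuous_on S (\<lambda>x. f x ^ j)" and h: "continuous_on S (\<lambda>x. f x ^ (j + 1))"
  shows "continuous_on S f"
  unfolding continuous_on_def
proof
  fix x assume x: "x \<in> S"
  have gx: "((\<lambda>x. f x ^ j) \<longlongrightarrow> f x ^ j) (at x within S)" and hx: "((\<lambda>x. f x ^ (j + 1)) \<longlongrightarrow> f x ^ (j + 1)) (at x within S)"
    using g h x by (auto simp: continuous_on_def)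
  show "(f \<longlongrightarrow> f x) (at x within S)"
  proof (cases "f x = 0")
    case True
    have "((\<lambda>x. root j (cmod (f x ^ j))) \<longlongrightarrow> root j (cmod (f x ^ j))) (at x within S)"
      by (intro tendsto_intros gx)
    then have "((\<lambda>x. cmod (f x)) \<longlongrightarrow> 0) (at x within S)"
      using j True by (simp add: norm_power real_root_power_cancel zero_power)
    then show ?thesis using True by (simp add: tendsto_norm_zero_iff)
  next
    case False
    have "((\<lambda>x. f x ^ (j + 1) / f x ^ j) \<longlongrightarrow> f x ^ (j + 1) / f x ^ j) (at x within S)"
      using False by (intro tendsto_divide gx hx) auto
    moreover have "f y ^ (j + 1) / f y ^ j = f y" for y
      using j by (cases "f y = 0") (auto simp: zero_power)
    ultimately show ?thesis by simp
  qed
qed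

section \<open>Mixed differences from divided differences\<close>

lemma sum_Pow_insert:
  fixes \<phi> :: "'a set \<Rightarrow> 'b::comm_monoid_add"
  assumes "finite I" "a \<notin> I"
  shows "(\<Sum>S\<in>Pow (insert a I). \<phi> S) = (\<Sum>S\<in>Pow I. \<phi> S) + (\<Sum>S\<in>Pow I. \<phi> (insert a S))"
proof -
  have "(\<Sum>S\<in>Pow (insert a I). \<phi> S) = (\<Sum>S\<in>Pow I. \<phi> S) + (\<Sum>S\<in>insert a ` Pow I. \<phi> S)"
    unfolding Pow_insert by (rule sum.union_disjoint) (use assms in auto)
  also have "(\<Sum>S\<in>insert a ` Pow I. \<phi> S) = (\<Sum>S\<in>Pow I. \<phi> (insert a S))"
  proof (rule sum.reindex_cong[where l = "insert a"])
    show "inj_on (insert a) (Pow I)"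
    proof (rule inj_onI)
      fix S T assume ST: "S \<in> Pow I" "T \<in> Pow I" "insert a S = insert a T"
      then have "a \<notin> S" "a \<notin> T" using assms(2) by auto
      then show "S = T" using ST(3) by (simp add: insert_ident)
    qed
  qed auto
  finally show ?thesis .
qed

text \<open>The terms for \<open>S\<close> and \<open>insert a S\<close> have opposite signs and
  cancel.\<close>

lemma alternating_sum_Pow_zero:
  fixes \<phi> :: "'a set \<Rightarrow> complex"
  assumes I: "finite I" "a \<in> I" and \<phi>: "\<And>S. S \<subseteq> I - {a} \<Longrightarrow> \<phi> (insert a S) = \<phi> S"
  shows "(\<Sum>S\<in>Pow I. (-1) ^ card S * \<phi> S) = 0"
proof -
  define J where "J = I - {a}"
  have J: "finite J" "a \<notin> J" "I = insert a J" using I by (auto simp: J_def)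
  have "(\<Sum>S\<in>Pow J. (-1) ^ card (insert a S) * \<phi> (insert a S)) = (\<Sum>S\<in>Pow J. - ((-1) ^ card S * \<phi> S))"
  proof (rule sum.cong[OF refl])
    fix S assume S: "S \<in> Pow J"
    then have "finite S" "a \<notin> S" using J finite_subset by auto
    then show "(-1) ^ card (insert a S) * \<phi> (insert a S) = - ((-1) ^ card S * \<phi> S)"
      using \<phi>[of S] S by (simp add: J_def)
  qed
  then show ?thesis unfolding J(3) sum_Pow_insert[OF J(1,2)] by (simp add: sum_negf)
qed

text \<open>\<open>rev\<close> gives the head of the list the last index, so that the induction adds
  \<open>n\<close> to the subsets of \<open>{..<n}\<close>.\<close>

lemma mixed_diff_alternating_sum:
  fixes F :: "real^'n::finite \<Rightarrow> complex"
  shows "(\<Sum>S\<in>Pow {..<length is}. (-1) ^ card S * F (x + (\<Sum>l\<in>S. h *\<^sub>R axis (rev is ! l) 1)))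
    = (-1) ^ length is * mixed_diff h is F x"
proof (induction "is" arbitrary: x)
  case Nil
  then show ?case by simp
next
  case (Cons i "is")
  define n where "n = length is"
  have nth: "(\<Sum>l\<in>S. h *\<^sub>R axis (rev (i # is) ! l) 1) = (\<Sum>l\<in>S. h *\<^sub>R (axis (rev is ! l) 1 :: real^'n))" if "S \<in> Pow {..<n}" for S
    using that by (intro sum.cong refl) (auto simp: nth_append n_def)
  have last: "rev (i # is) ! n = i" by (simp add: nth_append n_def)
  have fin: "finite S" "n \<notin> S" if "S \<in> Pow {..<n}" for S using that finite_subset by auto
  have "(\<Sum>S\<in>Pow {..<length (i # is)}. (-1) ^ card S * F (x + (\<Sum>l\<in>S. h *\<^sub>R axis (rev (i # is) ! l) 1)))
    = (\<Sum>S\<in>Pow {..<n}. (-1) ^ card S * F (x + (\<Sum>l\<in>S. h *\<^sub>R axis (rev (i # is) ! l) 1)))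
    + (\<Sum>S\<in>Pow {..<n}. (-1) ^ card (insert n S) * F (x + (\<Sum>l\<in>insert n S. h *\<^sub>R axis (rev (i # is) ! l) 1)))"
    by (simp only: n_def[symmetric] list.size add_Suc_right add_0_right lessThan_Suc) (rule sum_Pow_insert; simp)
  also have "(\<Sum>S\<in>Pow {..<n}. (-1) ^ card S * F (x + (\<Sum>l\<in>S. h *\<^sub>R axis (rev (i # is) ! l) 1))) = (-1) ^ n * mixed_diff h is F x"
    unfolding n_def Cons.IH[symmetric] by (intro sum.cong refl) (simp only: nth[unfolded n_def])
  also have "(\<Sum>S\<in>Pow {..<n}. (-1) ^ card (insert n S) * F (x + (\<Sum>l\<in>insert n S. h *\<^sub>R axis (rev (i # is) ! l) 1)))
     = - (\<Sum>S\<in>Pow {..<n}. (-1) ^ card S * F ((x + h *\<^sub>R axis i 1) + (\<Sum>l\<in>S. h *\<^sub>R axis (rev is ! l) 1)))"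
    unfolding sum_negf[symmetric]
  proof (rule sum.cong[OF refl])
    fix S assume S: "S \<in> Pow {..<n}"
    have "(\<Sum>l\<in>insert n S. h *\<^sub>R (axis (rev (i # is) ! l) 1 :: real^'n))
      = h *\<^sub>R axis i 1 + (\<Sum>l\<in>S. h *\<^sub>R axis (rev is ! l) 1)"
      by (subst sum.insert[OF fin[OF S]]) (simp only: last nth[OF S])
    moreover have "card (insert n S) = Suc (card S)" using fin[OF S] by simp
    ultimately show "(-1) ^ card (insert n S) * F (x + (\<Sum>l\<in>insert n S. h *\<^sub>R axis (rev (i # is) ! l) 1))
      = - ((-1) ^ card S * F ((x + h *\<^sub>R axis i 1) + (\<Sum>l\<in>S. h *\<^sub>R axis (rev is ! l) 1)))"
      by (simp add: add.assoc)
  qed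
  also have "(\<Sum>S\<in>Pow {..<n}. (-1) ^ card S * F ((x + h *\<^sub>R axis i 1) + (\<Sum>l\<in>S. h *\<^sub>R axis (rev is ! l) 1)))
     = (-1) ^ n * mixed_diff h is F (x + h *\<^sub>R axis i 1)"
    unfolding n_def by (rule Cons.IH)
  finally show ?case by (simp add: step_diff_def n_def algebra_simps)
qed

text \<open>For \<open>m = Suc l\<close> the argument of \<open>f\<close> does not depend on whether \<open>l \<in> S\<close>, so only \<open>m = 0\<close> survives
  the alternating sum.\<close>
lemma kemperman_identity:
  fixes f :: "'v::real_vector \<Rightarrow> complex" and v :: "nat \<Rightarrow> 'v"
  assumes k: "k \<ge> 1"
  defines "a \<equiv> \<lambda>S. - (\<Sum>l\<in>S. (1 / dd_node k (Suc l)) *\<^sub>R v l)"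
  shows "(\<Sum>S\<in>Pow {..<k}. (-1) ^ card S *
            (\<Sum>m\<le>k. of_real (dd_weight k m) * f (x + (\<Sum>l\<in>S. v l) + dd_node k m *\<^sub>R a S)))
       = of_real (dd_weight k 0) * (\<Sum>S\<in>Pow {..<k}. (-1) ^ card S * f (x + (\<Sum>l\<in>S. v l)))"
proof -
  have "(\<Sum>S\<in>Pow {..<k}. (-1) ^ card S * (\<Sum>m\<le>k. of_real (dd_weight k m) * f (x + (\<Sum>l\<in>S. v l) + dd_node k m *\<^sub>R a S)))
    = (\<Sum>m\<le>k. of_real (dd_weight k m) * (\<Sum>S\<in>Pow {..<k}. (-1) ^ card S * f (x + (\<Sum>l\<in>S. v l) + dd_node k m *\<^sub>R a S)))"
    unfolding sum_distrib_left by (subst sum.swap) (intro sum.cong refl, simp add: mult_ac)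
  also have "\<dots> = (\<Sum>m\<le>k. if m = 0 then of_real (dd_weight k 0) * (\<Sum>S\<in>Pow {..<k}. (-1) ^ card S * f (x + (\<Sum>l\<in>S. v l))) else 0)"
  proof (rule sum.cong[OF refl])
    fix m assume m: "m \<in> {..k}"
    show "of_real (dd_weight k m) * (\<Sum>S\<in>Pow {..<k}. (-1) ^ card S * f (x + (\<Sum>l\<in>S. v l) + dd_node k m *\<^sub>R a S))
      = (if m = 0 then of_real (dd_weight k 0) * (\<Sum>S\<in>Pow {..<k}. (-1) ^ card S * f (x + (\<Sum>l\<in>S. v l))) else 0)"
    proof (cases "m = 0")
      case True
      then show ?thesis by (simp add: dd_node_def)
    next
      case False
      then obtain q where q: "m = Suc q" by (cases m) auto
      have nz: "dd_node k m \<noteq> 0"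
      proof -
        have "0 \<le> real m / real k" by simp
        then have "1 + real m / real k \<noteq> 0" by linarith
        then show ?thesis using False by (simp add: dd_node_def)
      qed
      have "(\<Sum>S\<in>Pow {..<k}. (-1) ^ card S * f (x + (\<Sum>l\<in>S. v l) + dd_node k m *\<^sub>R a S)) = 0"
      proof (rule alternating_sum_Pow_zero[where a = q])
        fix S assume "S \<subseteq> {..<k} - {q}"
        then have S: "finite S" "q \<notin> S" using finite_subset by auto
        have "a (insert q S) = a S - (1 / dd_node k m) *\<^sub>R v q" using S by (simp add: a_def q)
        moreover have "dd_node k m *\<^sub>R ((1 / dd_node k m) *\<^sub>R v q) = v q" using nz by simp
        ultimately have "dd_node k m *\<^sub>R a (insert q S) = dd_node k m *\<^sub>R a S - v q" by (simp only: scaleR_diff_right)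
        moreover have "(\<Sum>l\<in>insert q S. v l) = v q + (\<Sum>l\<in>S. v l)" using S by simp
        ultimately have "x + (\<Sum>l\<in>insert q S. v l) + dd_node k m *\<^sub>R a (insert q S) = x + (\<Sum>l\<in>S. v l) + dd_node k m *\<^sub>R a S"
          by (simp add: algebra_simps)
        then show "f (x + (\<Sum>l\<in>insert q S. v l) + dd_node k m *\<^sub>R a (insert q S)) = f (x + (\<Sum>l\<in>S. v l) + dd_node k m *\<^sub>R a S)"
          by (simp only:)
      qed (use m q in auto)
      then show ?thesis using False by simp
    qed
  qed
  also have "\<dots> = of_real (dd_weight k 0) * (\<Sum>S\<in>Pow {..<k}. (-1) ^ card S * f (x + (\<Sum>l\<in>S. v l)))" by simp
  finally show ?thesis .
qed

text \<open>All nodes are within distance 2 of node 0. A lower bound for this weight is wanted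
  because Kemperman's identity is solved for the mixed difference.\<close>

lemma dd_weight_zero: "1 \<le> 2 ^ k * \<bar>dd_weight k 0\<bar>"
proof -
  have "(\<Prod>l\<in>{..k}-{0}. \<bar>dd_node k 0 - dd_node k l\<bar>) \<le> (\<Prod>l\<in>{..k}-{0}. 2)"
    by (rule prod_mono) (use dd_node_bounds in \<open>force simp: dd_node_def\<close>)
  also have "\<dots> = 2 ^ k" by simp
  finally have le: "(\<Prod>l\<in>{..k}-{0}. \<bar>dd_node k 0 - dd_node k l\<bar>) \<le> 2 ^ k" .
  have pos: "(\<Prod>l\<in>{..k}-{0}. \<bar>dd_node k 0 - dd_node k l\<bar>) > 0"
  proof (rule prod_pos)
    fix l assume l: "l \<in> {..k} - {0}"
    then have "dd_node k 0 \<noteq> dd_node k l" using inj_onD[OF dd_node_inj, of k 0 l] by auto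
    then show "\<bar>dd_node k 0 - dd_node k l\<bar> > 0" by simp
  qed
  have "\<bar>dd_weight k 0\<bar> = 1 / (\<Prod>l\<in>{..k}-{0}. \<bar>dd_node k 0 - dd_node k l\<bar>)" by (simp add: dd_weight_def abs_prod)
  then show ?thesis using le pos by (simp add: pos_le_divide_eq)
qed

text \<open>Divided differences of positive order kill constants: the contour bound for the constant
  function 1 tends to 0 as the radius grows.\<close>

lemma sum_dd_weight:
  assumes k: "k \<ge> 1"
  shows "(\<Sum>m\<le>k. complex_of_real (dd_weight k m)) = 0"
proof -
  have "cmod (\<Sum>m\<le>k. complex_of_real (dd_weight k m)) \<le> 4 / \<rho>" if "\<rho> \<ge> 4" for \<rho>
  proof -
    have "cmod (\<Sum>m\<le>k. of_real (dd_weight k m) * (\<lambda>_. 1) (of_real (1 * dd_node k m))) \<le> 2 * 1 * (2 * 1 / \<rho>) ^ k"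
      by (rule dd_holomorphic_bound) (use that in auto)
    also have "(2 * 1 / \<rho>) ^ k \<le> (2 * 1 / \<rho>) ^ 1" using that k by (intro power_decreasing) auto
    finally show ?thesis by simp
  qed
  then have "eventually (\<lambda>\<rho>. cmod (\<Sum>m\<le>k. complex_of_real (dd_weight k m)) \<le> 4 / \<rho>) at_top"
    unfolding eventually_at_top_linorder by blast
  moreover have "((\<lambda>\<rho>::real. 4 / \<rho>) \<longlongrightarrow> 0) at_top" by real_asymp
  ultimately have "cmod (\<Sum>m\<le>k. complex_of_real (dd_weight k m)) \<le> 0" by (intro tendsto_lowerbound) auto
  then show ?thesis by simp
qed

text \<open>The directions \<open>a\<close> in Kemperman's identity have norm at most
  \<open>length is * h\<close> because the nodes other than 0 are at least 1. Of the factor 4, one 2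
  counts the subsets and the other comes from \<open>dd_weight_zero\<close>.\<close>

lemma mixed_difference_bound:
  fixes f :: "real^'n::finite \<Rightarrow> complex"
  assumes k: "length is \<ge> 1" and h: "h > 0" and x: "x \<in> ball 0 r"
    and b: "\<And>y a. y \<in> ball 0 (r + real (length is) * h) \<Longrightarrow> 0 < norm a \<Longrightarrow> norm a \<le> real (length is) * h \<Longrightarrow>
       cmod (\<Sum>m\<le>length is. of_real (dd_weight (length is) m) * f (y + dd_node (length is) m *\<^sub>R a)) \<le> E"
    and E: "E \<ge> 0"
  shows "cmod (mixed_diff h is f x) \<le> 4 ^ length is * E"
proof -
  define k where "k = length is"
  define v where "v l = h *\<^sub>R (axis (rev is ! l) 1 :: real^'n)" for l
  define a where "a S = - (\<Sum>l\<in>S. (1 / dd_node k (Suc l)) *\<^sub>R v l)" for S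
  have nv: "norm (v l) = h" for l using h by (simp add: v_def)
  have node1: "dd_node k (Suc l) \<ge> 1" for l by (simp add: dd_node_def del: of_nat_Suc)
  have nsum: "norm (\<Sum>l\<in>S. v l) < real k * h \<or> norm (\<Sum>l\<in>S. v l) \<le> real k * h" "norm (a S) \<le> real k * h" if S: "S \<subseteq> {..<k}" for S
  proof -
    have card: "card S \<le> k" using card_mono[OF _ S] by simp
    have c: "real (card S) * h \<le> real k * h" using card h by (intro mult_right_mono) auto
    have "norm (\<Sum>l\<in>S. v l) \<le> (\<Sum>l\<in>S. h)" by (rule sum_norm_le) (simp add: nv)
    then show "norm (\<Sum>l\<in>S. v l) < real k * h \<or> norm (\<Sum>l\<in>S. v l) \<le> real k * h" using c by simp
    have "norm (a S) \<le> (\<Sum>l\<in>S. h)" unfolding a_def norm_minus_cancel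
    proof (rule sum_norm_le)
      fix l
      have "norm ((1 / dd_node k (Suc l)) *\<^sub>R v l) = (1 / dd_node k (Suc l)) * h" using node1[of l] by (simp add: nv)
      also have "\<dots> \<le> 1 * h" using node1[of l] h by (intro mult_right_mono) auto
      finally show "norm ((1 / dd_node k (Suc l)) *\<^sub>R v l) \<le> h" by simp
    qed
    then show "norm (a S) \<le> real k * h" using c by simp
  qed
  have each: "cmod (\<Sum>m\<le>k. of_real (dd_weight k m) * f (x + (\<Sum>l\<in>S. v l) + dd_node k m *\<^sub>R a S)) \<le> E"
    if S: "S \<subseteq> {..<k}" for S
  \<comment> \<open>The hypothesis covers nonzero directions only. For \<open>a S = 0\<close>, in
    particular for the empty set, the divided difference is that of a constant.\<close>
  proof (cases "a S = 0")
    case True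
    then have "(\<Sum>m\<le>k. of_real (dd_weight k m) * f (x + (\<Sum>l\<in>S. v l) + dd_node k m *\<^sub>R a S))
      = (\<Sum>m\<le>k. of_real (dd_weight k m)) * f (x + (\<Sum>l\<in>S. v l))" by (simp add: sum_distrib_right)
    then show ?thesis using sum_dd_weight[of k] k E by (simp add: k_def)
  next
    case False
    have "norm (x + (\<Sum>l\<in>S. v l)) < r + real k * h"
      using norm_triangle_ineq[of x "\<Sum>l\<in>S. v l"] nsum(1)[OF S] x by (auto simp: dist_norm)
    then have inb: "x + (\<Sum>l\<in>S. v l) \<in> ball 0 (r + real k * h)" unfolding mem_ball_0 .
    show ?thesis unfolding k_def
      by (rule b[OF inb[unfolded k_def]]) (use False nsum(2)[OF S] in \<open>simp_all add: k_def\<close>)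
  qed
  have "cmod (of_real (dd_weight k 0) * (\<Sum>S\<in>Pow {..<k}. (-1) ^ card S * f (x + (\<Sum>l\<in>S. v l)))) \<le> (\<Sum>S\<in>Pow {..<k}. E)"
    unfolding kemperman_identity[OF k[folded k_def], symmetric] a_def[symmetric]
    by (rule sum_norm_le) (use each in \<open>auto simp: norm_mult norm_power\<close>)
  then have "\<bar>dd_weight k 0\<bar> * cmod (mixed_diff h is f x) \<le> 2 ^ k * E"
    using mixed_diff_alternating_sum[of f x h "is"] by (simp add: v_def k_def norm_mult norm_power card_Pow)
  then have u: "2 ^ k * (\<bar>dd_weight k 0\<bar> * cmod (mixed_diff h is f x)) \<le> 2 ^ k * (2 ^ k * E)" by (intro mult_left_mono) auto
  have "1 * cmod (mixed_diff h is f x) \<le> (2 ^ k * \<bar>dd_weight k 0\<bar>) * cmod (mixed_diff h is f x)"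
    by (intro mult_right_mono dd_weight_zero) auto
  also have "\<dots> = 2 ^ k * (\<bar>dd_weight k 0\<bar> * cmod (mixed_diff h is f x))" by (rule mult.assoc)
  also note u
  also have "2 ^ k * (2 ^ k * E) = (2 * 2) ^ k * E" by (simp only: power_mult_distrib mult.assoc)
  also have "2 * 2 = (4::real)" by simp
  finally show ?thesis unfolding k_def mult_1 .
qed

section \<open>Roots in ultradifferentiable classes\<close>

lemma B_class_iff:
  "B_class \<omega> \<rho> V f \<longleftrightarrow> smooth_on V f \<and>
     (\<exists>B\<ge>1. \<forall>x\<in>V. \<forall>\<alpha>. cmod (dpartial \<alpha> f x) \<le> B * exp (phi_star \<omega> (\<rho> * real (mi_len \<alpha>)) / \<rho>))"
proof -
  have conv: "a * exp (- p / \<rho>) \<le> B \<longleftrightarrow> a \<le> B * exp (p / \<rho>)" for a B p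
  proof -
    have "exp (- p / \<rho>) = 1 / exp (p / \<rho>)" by (simp add: exp_minus inverse_eq_divide)
    then show ?thesis by (simp add: pos_divide_le_eq)
  qed
  have "bdd_above {cmod (dpartial \<alpha> f x) * exp (- phi_star \<omega> (\<rho> * real (mi_len \<alpha>)) / \<rho>) | x \<alpha>. x \<in> V} \<longleftrightarrow>
     (\<exists>B. \<forall>x\<in>V. \<forall>\<alpha>. cmod (dpartial \<alpha> f x) * exp (- phi_star \<omega> (\<rho> * real (mi_len \<alpha>)) / \<rho>) \<le> B)"
    unfolding bdd_above_def by blast
  also have "\<dots> \<longleftrightarrow> (\<exists>B\<ge>1. \<forall>x\<in>V. \<forall>\<alpha>. cmod (dpartial \<alpha> f x) * exp (- phi_star \<omega> (\<rho> * real (mi_len \<alpha>)) / \<rho>) \<le> B)"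
    by (metis max.cobounded1 max.cobounded2 order_trans)
  finally show ?thesis unfolding B_class_def conv by simp
qed

lemma B_class_mono:
  assumes \<omega>: "weight_function \<omega>" and \<rho>: "0 < \<rho>" "\<rho> \<le> \<rho>'" and f: "B_class \<omega> \<rho> V f"
  shows "B_class \<omega> \<rho>' V f"
proof -
  from f obtain B where B: "smooth_on V f" "B \<ge> 1" "\<And>x \<alpha>. x \<in> V \<Longrightarrow>
      cmod (dpartial \<alpha> f x) \<le> B * exp (phi_star \<omega> (\<rho> * real (mi_len \<alpha>)) / \<rho>)"
    unfolding B_class_iff by blast
  have "cmod (dpartial \<alpha> f x) \<le> B * exp (phi_star \<omega> (\<rho>' * real (mi_len \<alpha>)) / \<rho>')" if "x \<in> V" for x \<alpha>
  proof (rule order_trans[OF B(3)[OF that]])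
    show "B * exp (phi_star \<omega> (\<rho> * real (mi_len \<alpha>)) / \<rho>) \<le> B * exp (phi_star \<omega> (\<rho>' * real (mi_len \<alpha>)) / \<rho>')"
      using B(2) phi_star_div_mono[OF \<omega> \<rho>] by (intro mult_left_mono) auto
  qed
  then show ?thesis unfolding B_class_iff using B by blast
qed

lemma B_class_subset: "B_class \<omega> \<rho> U f \<Longrightarrow> V \<subseteq> U \<Longrightarrow> B_class \<omega> \<rho> V f"
  unfolding B_class_iff using smooth_on_subset by blast

text \<open>Reduction to \<open>[0, 1]\<close>: the segment of length \<open>\<delta>\<close> from
  \<open>y\<close> in the direction of \<open>a\<close> is rescaled and \<open>f\<close> is divided
  by \<open>B\<close>. Each derivative gains a factor \<open>\<delta>\<close>, and the assumption on
  \<open>\<delta> * \<mu>\<close> turns \<open>\<mu> ^ m\<close> into a power of the Taylor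
  order.\<close>

lemma line_divided_difference:
  fixes f :: "real^'n::finite \<Rightarrow> complex"
  assumes j: "j \<ge> 1" and k: "k \<ge> 1"
    and C: "dd_estimate j k C \<kappa>"
    and g: "smooth_on (ball 0 R) (\<lambda>x. f x ^ j)" "smooth_on (ball 0 R) (\<lambda>x. f x ^ (j + 1))"
    and B: "B \<ge> 1" and fB: "\<And>x. x \<in> ball 0 R \<Longrightarrow> cmod (f x) \<le> B"
    and gB: "\<And>x is. x \<in> ball 0 R \<Longrightarrow> length is \<le> jet_order j k \<Longrightarrow> cmod (iter_partial is (\<lambda>x. f x ^ j) x) \<le> B * \<mu> ^ length is"
            "\<And>x is. x \<in> ball 0 R \<Longrightarrow> length is \<le> jet_order j k \<Longrightarrow> cmod (iter_partial is (\<lambda>x. f x ^ (j + 1)) x) \<le> B * \<mu> ^ length is"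
    and \<mu>: "\<mu> > 0"
    and \<delta>: "\<delta> > 0" "real CARD('n) * \<delta> * \<mu> \<le> real (jet_order j k)" "r + \<delta> \<le> R"
    and y: "y \<in> ball 0 r" and a: "0 < norm a" "norm a \<le> \<kappa> * \<delta>"
  shows "cmod (\<Sum>m\<le>k. of_real (dd_weight k m) * f (y + dd_node k m *\<^sub>R a)) \<le> B * (C * norm a / \<delta>) ^ k"
proof -
  define v where "v = (1 / norm a) *\<^sub>R a"
  define \<alpha> where "\<alpha> = norm a / \<delta>"
  have v1: "norm v = 1" using a by (simp add: v_def)
  have vj: "\<bar>v $ i\<bar> \<le> 1" for i using component_le_norm_cart[of v i] v1 by simp
  have \<alpha>: "0 < \<alpha>" "\<alpha> \<le> \<kappa>" using a \<delta> by (auto simp: \<alpha>_def pos_divide_le_eq)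
  have inb: "y + (x * \<delta>) *\<^sub>R v \<in> ball 0 R" if "x \<in> {0..1}" for x
  proof -
    have "norm (y + (x * \<delta>) *\<^sub>R v) \<le> norm y + norm ((x * \<delta>) *\<^sub>R v)" by (rule norm_triangle_ineq)
    also have "norm ((x * \<delta>) *\<^sub>R v) = x * \<delta>" using that \<delta> v1 by simp
    also have "x * \<delta> \<le> 1 * \<delta>" using that \<delta> by (intro mult_right_mono) auto
    finally show ?thesis using y \<delta>(3) unfolding mem_ball_0 by simp
  qed
  define \<phi> where "\<phi> x = f (y + (x * \<delta>) *\<^sub>R v) / of_real B" for x
  define \<Gamma> where "\<Gamma> p m x = (\<delta> ^ m / B ^ p) *\<^sub>R iter_directional v m [] (\<lambda>x. f x ^ p) (y + (x * \<delta>) *\<^sub>R v)" for p m and x :: real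
  have deriv: "(\<Gamma> p m has_vector_derivative \<Gamma> p (Suc m) x) (at x within {0..1})"
    if p: "smooth_on (ball 0 R) (\<lambda>x. f x ^ p)" and x: "x \<in> {0..1}" for p m x
  proof -
    have "((\<lambda>t. iter_directional v m [] (\<lambda>x. f x ^ p) (y + t *\<^sub>R v)) has_vector_derivative
        iter_directional v (Suc m) [] (\<lambda>x. f x ^ p) (y + (x * \<delta>) *\<^sub>R v)) (at (x * \<delta>))"
      by (rule has_vector_derivative_shift_zero, rule iter_directional_derivative[OF p open_ball inb[OF x]])
    moreover have "((\<lambda>x. x * \<delta>) has_vector_derivative \<delta>) (at x)" by (auto intro!: derivative_eq_intros)
    ultimately have "((\<lambda>t. iter_directional v m [] (\<lambda>x. f x ^ p) (y + t *\<^sub>R v)) \<circ> (\<lambda>x. x * \<delta>) has_vector_derivative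
        \<delta> *\<^sub>R iter_directional v (Suc m) [] (\<lambda>x. f x ^ p) (y + (x * \<delta>) *\<^sub>R v)) (at x)"
      by (intro vector_diff_chain_at)
    then have "((\<lambda>x. iter_directional v m [] (\<lambda>x. f x ^ p) (y + (x * \<delta>) *\<^sub>R v)) has_vector_derivative
        \<delta> *\<^sub>R iter_directional v (Suc m) [] (\<lambda>x. f x ^ p) (y + (x * \<delta>) *\<^sub>R v)) (at x)" by (simp only: o_def)
    then have "((\<lambda>x. (\<delta> ^ m / B ^ p) *\<^sub>R iter_directional v m [] (\<lambda>x. f x ^ p) (y + (x * \<delta>) *\<^sub>R v)) has_vector_derivative
        (\<delta> ^ m / B ^ p) *\<^sub>R (\<delta> *\<^sub>R iter_directional v (Suc m) [] (\<lambda>x. f x ^ p) (y + (x * \<delta>) *\<^sub>R v))) (at x)"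
      by (rule bounded_linear.has_vector_derivative[OF bounded_linear_scaleR_right])
    moreover have "(\<delta> ^ m / B ^ p) *\<^sub>R (\<delta> *\<^sub>R z) = (\<delta> ^ Suc m / B ^ p) *\<^sub>R z" for z :: complex by simp
    ultimately have "(\<Gamma> p m has_vector_derivative \<Gamma> p (Suc m) x) (at x)"
      unfolding \<Gamma>_def[abs_def] by (simp only:)
    then show ?thesis by (rule has_vector_derivative_at_within)
  qed
  have bound: "cmod (\<Gamma> p m x) \<le> real (jet_order j k) ^ m"
    if p: "p \<ge> 1" "\<And>x is. x \<in> ball 0 R \<Longrightarrow> length is \<le> jet_order j k \<Longrightarrow> cmod (iter_partial is (\<lambda>x. f x ^ p) x) \<le> B * \<mu> ^ length is"
      and m: "m \<le> jet_order j k" and x: "x \<in> {0..1}" for p m x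
  proof -
    have "cmod (iter_directional v m [] (\<lambda>x. f x ^ p) (y + (x * \<delta>) *\<^sub>R v)) \<le> real CARD('n) ^ m * (B * \<mu> ^ m)"
      by (rule iter_directional_bound[OF vj]) (use p(2)[OF inb[OF x]] m in fastforce)
    moreover have c0: "0 \<le> \<delta> ^ m / B ^ p" using \<delta> B by simp
    ultimately have "cmod (\<Gamma> p m x) \<le> (\<delta> ^ m / B ^ p) * (real CARD('n) ^ m * (B * \<mu> ^ m))"
      unfolding \<Gamma>_def norm_scaleR abs_of_nonneg[OF c0] by (rule mult_left_mono)
    also have "\<dots> = (B / B ^ p) * (real CARD('n) * \<delta> * \<mu>) ^ m" by (simp add: power_mult_distrib)
    also have "\<dots> \<le> 1 * real (jet_order j k) ^ m"
    proof (intro mult_mono power_mono \<delta>(2))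
      show "B / B ^ p \<le> 1" using B self_le_power[OF B] p(1) by (simp add: divide_le_eq_1)
    qed (use B \<delta> \<mu> in auto)
    finally show ?thesis by simp
  qed
  have "cmod (\<Sum>m\<le>k. of_real (dd_weight k m) * \<phi> (\<alpha> * dd_node k m)) \<le> (C * \<alpha>) ^ k"
  proof (rule dd_estimateD[OF C, where \<gamma> = "\<Gamma> j" and \<eta> = "\<Gamma> (j + 1)"])
    show "\<forall>x\<in>{0..1}. cmod (\<phi> x) \<le> 1 \<and> \<Gamma> j 0 x = \<phi> x ^ j \<and> \<Gamma> (j + 1) 0 x = \<phi> x ^ (j + 1)"
    proof (intro ballI conjI)
      fix x :: real assume x: "x \<in> {0..1}"
      show "cmod (\<phi> x) \<le> 1" using fB[OF inb[OF x]] B by (simp add: \<phi>_def norm_divide)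
      have eq: "\<Gamma> p 0 x = \<phi> x ^ p" for p
        using B by (simp add: \<Gamma>_def \<phi>_def power_divide scaleR_conv_of_real[where 'a = complex])
      show "\<Gamma> j 0 x = \<phi> x ^ j" "\<Gamma> (j + 1) 0 x = \<phi> x ^ (j + 1)" by (rule eq)+
    qed
    show "\<forall>m<jet_order j k. \<forall>x\<in>{0..1}. (\<Gamma> j m has_vector_derivative \<Gamma> j (Suc m) x) (at x within {0..1}) \<and>
        (\<Gamma> (j + 1) m has_vector_derivative \<Gamma> (j + 1) (Suc m) x) (at x within {0..1})"
      using deriv[OF g(1)] deriv[OF g(2)] by blast
    show "\<forall>m\<le>jet_order j k. \<forall>x\<in>{0..1}. cmod (\<Gamma> j m x) \<le> real (jet_order j k) ^ m \<and>
        cmod (\<Gamma> (j + 1) m x) \<le> real (jet_order j k) ^ m"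
      using bound[OF j gB(1)] bound[OF _ gB(2)] by auto
  qed (use \<alpha> in auto)
  moreover have "\<phi> (\<alpha> * dd_node k m) = f (y + dd_node k m *\<^sub>R a) / of_real B" for m
  proof -
    have "(\<alpha> * dd_node k m * \<delta>) *\<^sub>R v = dd_node k m *\<^sub>R a" using a \<delta> by (simp add: \<alpha>_def v_def)
    then show ?thesis by (simp only: \<phi>_def)
  qed
  ultimately have "cmod ((\<Sum>m\<le>k. of_real (dd_weight k m) * f (y + dd_node k m *\<^sub>R a)) / of_real B) \<le> (C * \<alpha>) ^ k"
    by (simp add: sum_divide_distrib)
  then have "cmod (\<Sum>m\<le>k. of_real (dd_weight k m) * f (y + dd_node k m *\<^sub>R a)) \<le> (C * \<alpha>) ^ k * B"
    using B by (simp add: norm_divide pos_divide_le_eq)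
  then show ?thesis by (simp add: \<alpha>_def mult.commute)
qed

text \<open>\<open>L\<close> depends on \<open>\<omega>\<close>, \<open>j\<close>, \<open>R\<close>
  and the dimension only; all dependence on \<open>\<rho>\<close> and \<open>f\<close> goes into the
  constant in front of the weights.\<close>

lemma power_root_B_class:
  fixes \<omega> :: "real \<Rightarrow> real"
  assumes \<omega>: "weight_function \<omega>" and j: "j \<ge> 1" and R: "R > 0"
  shows "\<exists>L\<ge>1. \<forall>\<rho>>0. \<forall>f :: real^'n::finite \<Rightarrow> complex.
    B_class \<omega> \<rho> (ball 0 R) (\<lambda>x. f x ^ j) \<longrightarrow> B_class \<omega> \<rho> (ball 0 R) (\<lambda>x. f x ^ (j + 1)) \<longrightarrow>
    B_class \<omega> (L * \<rho>) (ball 0 (R / 2)) f"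
proof -
  obtain C \<kappa> where C: "C \<ge> 1" "\<kappa> > 0" and dd: "\<And>k. k \<ge> 1 \<Longrightarrow> dd_estimate j k C \<kappa>"
    using divided_difference_bound[OF j] by blast
  define d where "d = real CARD('n)"
  have "CARD('n) \<ge> 1" using zero_less_card_finite[where 'a = 'n] by linarith
  then have d: "d \<ge> 1" by (simp add: d_def)
  \<comment> \<open>For the segment length \<open>c * n / \<mu>\<close>, the bound
    \<open>1 / d\<close> secures the derivative bounds after rescaling, and \<open>R / 12\<close>,
    together with \<open>n \<le> 3 * \<mu>\<close>, keeps the length below
    \<open>R / 4\<close>.\<close>
  define c where "c = min (1 / d) (R / 12)"
  have c: "c > 0" "d * c \<le> 1" "c \<le> 1" "3 * c \<le> R / 4"
  proof -
    show "c > 0" using d R by (simp add: c_def)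
    have c1: "c \<le> 1 / d" unfolding c_def by (rule min.cobounded1)
    then show "d * c \<le> 1" using d by (simp add: field_simps)
    have "1 / d \<le> 1" using d by simp
    then show "c \<le> 1" using c1 by linarith
    have "c \<le> R / 12" unfolding c_def by (rule min.cobounded2)
    then show "3 * c \<le> R / 4" by linarith
  qed
  define N where "N = real (4 * j * (j + 1))"
  have "1 \<le> 4 * j * (j + 1)" using j by simp
  then have N: "N \<ge> 1" unfolding N_def by linarith
  have jet: "real (jet_order j k) = N * real k" for k by (simp add: jet_order_def N_def)
  have "4 * C / c \<ge> 1" using C c by (simp add: pos_le_divide_eq)
  then obtain L1 where L1: "L1 \<ge> 1" "\<And>\<rho> k. \<rho> > 0 \<Longrightarrow> (4 * C / c) ^ k * exp (phi_star \<omega> (\<rho> * real k) / \<rho>)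
           \<le> exp (1 / \<rho>) * exp (phi_star \<omega> (L1 * \<rho> * real k) / (L1 * \<rho>))"
    using weight_sequence_absorb[OF \<omega>] by blast
  \<comment> \<open>\<open>L1\<close> absorbs the geometric constant \<open>4 * C / c\<close>, and
    \<open>N\<close> accounts for the Taylor order \<open>N * k\<close>.\<close>
  define L where "L = L1 * N"
  have L: "L \<ge> 1" using mult_mono[of 1 L1 1 N] L1 N by (simp add: L_def)
  show ?thesis
  proof (intro exI[of _ L] conjI L allI impI)
    fix \<rho> :: real and f :: "real^'n \<Rightarrow> complex"
    assume \<rho>: "\<rho> > 0" and g: "B_class \<omega> \<rho> (ball 0 R) (\<lambda>x. f x ^ j)" and h: "B_class \<omega> \<rho> (ball 0 R) (\<lambda>x. f x ^ (j + 1))"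
    define M where "M m = exp (phi_star \<omega> (\<rho> * real m) / \<rho>)" for m
    obtain B1 where B1: "B1 \<ge> 1" "\<And>x \<alpha>. x \<in> ball 0 R \<Longrightarrow> cmod (dpartial \<alpha> (\<lambda>x. f x ^ j) x) \<le> B1 * M (mi_len \<alpha>)"
      using g unfolding B_class_iff M_def by blast
    obtain B2 where B2: "B2 \<ge> 1" "\<And>x \<alpha>. x \<in> ball 0 R \<Longrightarrow> cmod (dpartial \<alpha> (\<lambda>x. f x ^ (j + 1)) x) \<le> B2 * M (mi_len \<alpha>)"
      using h unfolding B_class_iff M_def by blast
    have sm: "smooth_on (ball 0 R) (\<lambda>x. f x ^ j)" "smooth_on (ball 0 R) (\<lambda>x. f x ^ (j + 1))"
      using g h by (auto simp: B_class_iff)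
    define B where "B = max B1 B2"
    have B: "B \<ge> 1" "B1 \<le> B" "B2 \<le> B" using B1 by (auto simp: B_def)
    have all1: "cmod (iter_partial is (\<lambda>x. f x ^ j) x) \<le> B * M (length is)"
      and all2: "cmod (iter_partial is (\<lambda>x. f x ^ (j + 1)) x) \<le> B * M (length is)" if x: "x \<in> ball 0 R" for x "is"
    proof -
      have M0: "0 \<le> M m" for m by (simp add: M_def)
      have "cmod (iter_partial is (\<lambda>x. f x ^ j) x) \<le> B1 * M (length is)"
        using diff_bounded_smooth(2)[OF dpartial_bound_diff_bounded[OF sm(1), of "\<lambda>m. B1 * M m"] x] B1(2) by blast
      also have "\<dots> \<le> B * M (length is)" using B M0 by (intro mult_right_mono)
      finally show "cmod (iter_partial is (\<lambda>x. f x ^ j) x) \<le> B * M (length is)" .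
      have "cmod (iter_partial is (\<lambda>x. f x ^ (j + 1)) x) \<le> B2 * M (length is)"
        using diff_bounded_smooth(2)[OF dpartial_bound_diff_bounded[OF sm(2), of "\<lambda>m. B2 * M m"] x] B2(2) by blast
      also have "\<dots> \<le> B * M (length is)" using B M0 by (intro mult_right_mono)
      finally show "cmod (iter_partial is (\<lambda>x. f x ^ (j + 1)) x) \<le> B * M (length is)" .
    qed
    have phi0: "phi_star \<omega> 0 \<le> 0" by (rule phi_star_least[OF \<omega>]) (simp add: weight_nonneg[OF \<omega>])
    have fB: "cmod (f x) \<le> B" if x: "x \<in> ball 0 R" for x
    proof -
      have "M 0 \<le> 1" using phi0 \<rho> by (simp add: M_def divide_nonpos_pos)
      then have "B * M 0 \<le> B * 1" using B by (intro mult_left_mono) auto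
      then have "cmod (f x) ^ j \<le> B ^ j"
        using all1[OF x, of "[]"] self_le_power[OF B(1), of j] j by (simp add: norm_power)
      then show ?thesis using j B power_mono_iff[of "cmod (f x)" B j] by simp
    qed
    obtain K where K: "K \<ge> 0" "\<And>n. n \<ge> 1 \<Longrightarrow> real n ^ n \<le> exp (real n) * (exp K * M n)"
      using weight_sequence_lower[OF \<omega> \<rho>] unfolding M_def by blast
    \<comment> \<open>The factor \<open>exp (\<omega> 1 / \<rho>)\<close> is there for order 0,
      where \<open>phi_star \<omega> 0\<close> can be negative but is at least
      \<open>- \<omega> 1\<close>.\<close>
    define Bs where "Bs m = B * exp K * exp (1 / (N * \<rho>)) * exp (\<omega> 1 / \<rho>) * exp (phi_star \<omega> (L * \<rho> * real m) / (L * \<rho>))" for m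
    have \<omega>1: "\<omega> 1 \<ge> 0" by (rule weight_nonneg[OF \<omega>]) simp
    have "diff_bounded (R / 2) f (\<lambda>is. Bs (length is))"
      unfolding diff_bounded_def
    proof (intro conjI allI impI)
      have "continuous_on (ball 0 R) f"
        by (rule continuous_on_power_root[OF j]) (use smooth_on_continuous[OF sm(1), of "[]"] smooth_on_continuous[OF sm(2), of "[]"] in auto)
      then show "continuous_on (ball 0 (R / 2)) f" by (rule continuous_on_subset) (use R in auto)
      fix r and "is" :: "'n list" assume r: "r < R / 2"
      define k where "k = length is"
      show "\<exists>h0>0. \<forall>h. 0 < h \<and> h < h0 \<longrightarrow> (\<forall>x\<in>ball 0 r. cmod (mixed_diff h is f x) \<le> Bs (length is) * h ^ length is)"
      proof (cases "k = 0")
        case True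
        have "B \<le> Bs 0"
        proof -
          have "0 * 0 - \<omega> (exp 0) \<le> phi_star \<omega> 0" by (rule phi_star_upper[OF \<omega>]) simp
          then have "- \<omega> 1 / (L * \<rho>) \<le> phi_star \<omega> 0 / (L * \<rho>)" using L \<rho> by (intro divide_right_mono) auto
          moreover have "\<omega> 1 / (L * \<rho>) \<le> \<omega> 1 / \<rho>"
            using L \<rho> \<omega>1 by (intro divide_left_mono) (auto simp: mult_le_cancel_right1)
          ultimately have "0 \<le> K + 1 / (N * \<rho>) + \<omega> 1 / \<rho> + phi_star \<omega> 0 / (L * \<rho>)"
            using K(1) zero_le_divide_1_iff[of "N * \<rho>"] mult_nonneg_nonneg[of N \<rho>] N \<rho> minus_divide_left[of "\<omega> 1" "L * \<rho>"]
            by linarith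
          then have "1 \<le> exp (K + 1 / (N * \<rho>) + \<omega> 1 / \<rho> + phi_star \<omega> 0 / (L * \<rho>))" by simp
          then have "B * 1 \<le> B * exp (K + 1 / (N * \<rho>) + \<omega> 1 / \<rho> + phi_star \<omega> 0 / (L * \<rho>))"
            using B by (intro mult_left_mono) auto
          then show ?thesis by (simp add: Bs_def exp_add mult.assoc)
        qed
        then have "cmod (f x) \<le> Bs 0" if "x \<in> ball 0 r" for x using fB[of x] that r R by simp
        then show ?thesis using True by (intro exI[of _ 1]) (simp add: k_def)
      next
        case False
        then have k: "k \<ge> 1" by simp
        define n where "n = jet_order j k"
        have n: "real n = N * real k" by (simp add: n_def jet)
        have n1: "n \<ge> 1" using k j by (simp add: n_def jet_order_def)
        \<comment> \<open>\<open>\<mu> ^ n\<close> is \<open>exp K\<close> times the weight of order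
          \<open>n\<close>. By \<open>phi_star_scale\<close> the powers of \<open>\<mu>\<close> then
          dominate the weights of all lower orders as well.\<close>
        define \<mu> where "\<mu> = exp ((K + phi_star \<omega> (\<rho> * real n) / \<rho>) / real n)"
        have \<mu>: "\<mu> > 0" by (simp add: \<mu>_def)
        have M\<mu>: "M m \<le> \<mu> ^ m" if "m \<le> n" for m
        proof -
          have "phi_star \<omega> (real m / real n * (\<rho> * real n)) \<le> real m / real n * phi_star \<omega> (\<rho> * real n)"
            by (rule phi_star_scale[OF \<omega>]) (use that n1 in auto)
          moreover have "real m / real n * (\<rho> * real n) = \<rho> * real m" using n1 by simp
          ultimately have "phi_star \<omega> (\<rho> * real m) \<le> real m / real n * phi_star \<omega> (\<rho> * real n)" by (simp only:)
          then have "phi_star \<omega> (\<rho> * real m) / \<rho> \<le> real m / real n * phi_star \<omega> (\<rho> * real n) / \<rho>"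
            by (rule divide_right_mono) (use \<rho> in simp)
          also have "\<dots> \<le> real m / real n * (K + phi_star \<omega> (\<rho> * real n) / \<rho>)"
          proof -
            have "0 \<le> real m / real n * K" using K by simp
            then show ?thesis unfolding distrib_left times_divide_eq_right by linarith
          qed
          also have "\<dots> = real m * ((K + phi_star \<omega> (\<rho> * real n) / \<rho>) / real n)" by simp
          finally show ?thesis unfolding M_def \<mu>_def exp_of_nat_mult[symmetric] by simp
        qed
        \<comment> \<open>If \<open>\<mu>\<close> were small compared with \<open>n\<close>, the
          segments would leave the ball; the lower bound on the weights excludes this.\<close>
        have n\<mu>: "real n \<le> 3 * \<mu>"
        proof -
          have "\<mu> ^ n = exp K * M n"
            unfolding \<mu>_def exp_of_nat_mult[symmetric] M_def using n1 by (simp add: exp_add)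
          moreover have "exp (real n) = exp 1 ^ n" by (simp flip: exp_of_nat_mult)
          ultimately have "real n ^ n \<le> (exp 1 * \<mu>) ^ n" using K(2)[OF n1] by (simp add: power_mult_distrib)
          then have "real n \<le> exp 1 * \<mu>" using n1 \<mu> power_mono_iff[of "real n" "exp 1 * \<mu>" n] by simp
          also have "\<dots> \<le> 3 * \<mu>" using exp_le \<mu> by (intro mult_right_mono) auto
          finally show ?thesis .
        qed
        define \<delta> where "\<delta> = c * real n / \<mu>"
        have \<delta>: "\<delta> > 0" using c n1 \<mu> by (simp add: \<delta>_def)
        have \<delta>R: "\<delta> \<le> R / 4"
        proof -
          have "\<delta> \<le> c * (3 * \<mu>) / \<mu>" unfolding \<delta>_def using n\<mu> c \<mu> by (intro divide_right_mono mult_left_mono) auto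
          also have "\<dots> = 3 * c" using \<mu> by simp
          finally show ?thesis using c by linarith
        qed
        have d\<delta>: "real CARD('n) * \<delta> * \<mu> \<le> real (jet_order j k)"
        proof -
          have "real CARD('n) * \<delta> * \<mu> = (d * c) * real n" using \<mu> by (simp add: \<delta>_def d_def)
          also have "\<dots> \<le> 1 * real n" using c by (intro mult_right_mono) auto
          finally show ?thesis by (simp add: n_def)
        qed
        have line: "cmod (\<Sum>m\<le>k. of_real (dd_weight k m) * f (y + dd_node k m *\<^sub>R a)) \<le> B * (C * norm a / \<delta>) ^ k"
          if "y \<in> ball 0 (3 * R / 4)" "0 < norm a" "norm a \<le> \<kappa> * \<delta>" for y a
        proof (rule line_divided_difference[OF j k dd[OF k] sm B(1) fB _ _ \<mu> \<delta> d\<delta> _ that])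
          fix x :: "real^'n" and js :: "'n list" assume xj: "x \<in> ball 0 R" "length js \<le> jet_order j k"
          have "B * M (length js) \<le> B * \<mu> ^ length js"
            using M\<mu> xj(2) B by (intro mult_left_mono) (auto simp: n_def)
          then show "cmod (iter_partial js (\<lambda>x. f x ^ j) x) \<le> B * \<mu> ^ length js"
            "cmod (iter_partial js (\<lambda>x. f x ^ (j + 1)) x) \<le> B * \<mu> ^ length js"
            using all1[OF xj(1), of js] all2[OF xj(1), of js] by linarith+
        qed (use \<delta>R in auto)
        have final: "4 ^ k * (B * (C * (real k * h) / \<delta>) ^ k) \<le> Bs k * h ^ k" if h: "h > 0" for h
        proof -
          have "C * (real k * h) / \<delta> = (C / c) * (\<mu> / N) * h"
            using c \<mu> N k by (simp add: \<delta>_def n field_simps)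
          also have "\<dots> \<le> (C / c) * (\<mu> / 1) * h"
            using c \<mu> N C h by (intro mult_right_mono mult_left_mono divide_left_mono) auto
          finally have "(C * (real k * h) / \<delta>) ^ k \<le> ((C / c) * \<mu> * h) ^ k"
            using C h \<delta> by (intro power_mono) auto
          then have "4 ^ k * (B * (C * (real k * h) / \<delta>) ^ k) \<le> 4 ^ k * (B * ((C / c) * \<mu> * h) ^ k)"
            using B by (intro mult_left_mono) auto
          also have "\<dots> = B * ((4 * C / c) ^ k * \<mu> ^ k) * h ^ k"
            by (simp add: power_mult_distrib power_divide)
          also have "\<dots> \<le> B * (exp K * (exp (1 / (N * \<rho>)) * exp (phi_star \<omega> (L * \<rho> * real k) / (L * \<rho>)))) * h ^ k"
          proof (intro mult_right_mono mult_left_mono)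
            \<comment> \<open>As \<open>n = N * k\<close>, the \<open>k\<close>-th power of
              \<open>\<mu>\<close> is, up to \<open>exp (K / N)\<close>, the weight of order
              \<open>k\<close> for the parameter \<open>N * \<rho>\<close>.\<close>
            have "\<mu> ^ k = exp (K / N + phi_star \<omega> (N * \<rho> * real k) / (N * \<rho>))"
              unfolding \<mu>_def exp_of_nat_mult[symmetric] n using N k \<rho> by (simp add: field_simps)
            also have "\<dots> \<le> exp (K + phi_star \<omega> (N * \<rho> * real k) / (N * \<rho>))"
              using K(1) N by (simp add: divide_le_eq mult_le_cancel_left1)
            finally have "(4 * C / c) ^ k * \<mu> ^ k \<le> (4 * C / c) ^ k * (exp K * exp (phi_star \<omega> (N * \<rho> * real k) / (N * \<rho>)))"
              using C c by (intro mult_left_mono) (auto simp: exp_add)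
            also have "\<dots> = exp K * ((4 * C / c) ^ k * exp (phi_star \<omega> (N * \<rho> * real k) / (N * \<rho>)))" by simp
            also have "\<dots> \<le> exp K * (exp (1 / (N * \<rho>)) * exp (phi_star \<omega> (L1 * (N * \<rho>) * real k) / (L1 * (N * \<rho>))))"
              using N \<rho> by (intro mult_left_mono L1(2)) auto
            finally show "(4 * C / c) ^ k * \<mu> ^ k \<le> exp K * (exp (1 / (N * \<rho>)) * exp (phi_star \<omega> (L * \<rho> * real k) / (L * \<rho>)))"
              by (simp only: L_def mult.assoc)
          qed (use B h in auto)
          also have "\<dots> \<le> Bs k * h ^ k"
          proof (rule mult_right_mono)
            have "1 \<le> exp (\<omega> 1 / \<rho>)" using \<omega>1 \<rho> by simp
            then have "B * exp K * exp (1 / (N * \<rho>)) * 1 * exp (phi_star \<omega> (L * \<rho> * real k) / (L * \<rho>)) \<le> Bs k"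
              unfolding Bs_def using B by (intro mult_right_mono mult_left_mono) auto
            then show "B * (exp K * (exp (1 / (N * \<rho>)) * exp (phi_star \<omega> (L * \<rho> * real k) / (L * \<rho>)))) \<le> Bs k"
              by (simp add: mult.assoc)
          qed (use h in simp)
          finally show ?thesis .
        qed
        \<comment> \<open>Keeps the directions within the admissible length
          \<open>\<kappa> * \<delta>\<close> and the base points in the ball of radius
          \<open>3 * R / 4\<close>.\<close>
        define h0 where "h0 = min (\<kappa> * \<delta>) (R / 4) / real k"
        have h0: "h0 > 0" using C \<delta> R k by (simp add: h0_def)
        show ?thesis
        proof (intro exI[of _ h0] conjI h0 allI impI ballI)
          fix h and x :: "real^'n" assume h: "0 < h \<and> h < h0" and x: "x \<in> ball 0 r"
          have "real k * h < min (\<kappa> * \<delta>) (R / 4)" using h k by (simp add: h0_def pos_less_divide_eq mult.commute)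
          then have kh: "real k * h \<le> \<kappa> * \<delta>" "real k * h \<le> R / 4" by simp_all
          have "cmod (mixed_diff h is f x) \<le> 4 ^ length is * (B * (C * (real k * h) / \<delta>) ^ k)"
          proof (rule mixed_difference_bound[OF _ _ x])
            fix y a :: "real^'n" assume y: "y \<in> ball 0 (r + real (length is) * h)"
              and a: "0 < norm a" "norm a \<le> real (length is) * h"
            have "cmod (\<Sum>m\<le>k. of_real (dd_weight k m) * f (y + dd_node k m *\<^sub>R a)) \<le> B * (C * norm a / \<delta>) ^ k"
              using y a kh r unfolding mem_ball_0 k_def[symmetric] by (intro line) auto
            also have "\<dots> \<le> B * (C * (real k * h) / \<delta>) ^ k"
              using a B C \<delta> unfolding k_def[symmetric]
              by (intro mult_left_mono power_mono divide_right_mono) auto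
            finally show "cmod (\<Sum>m\<le>length is. of_real (dd_weight (length is) m) * f (y + dd_node (length is) m *\<^sub>R a))
              \<le> B * (C * (real k * h) / \<delta>) ^ k" by (simp only: k_def)
          qed (use k h B C \<delta> in \<open>auto simp: k_def\<close>)
          then show "cmod (mixed_diff h is f x) \<le> Bs (length is) * h ^ length is"
            using final[of h] h unfolding k_def by linarith
        qed
      qed
    qed
    note sm' = diff_bounded_smooth[OF this]
    have B1: "B * exp K * exp (1 / (N * \<rho>)) * exp (\<omega> 1 / \<rho>) \<ge> 1"
    proof -
      have "0 \<le> K + 1 / (N * \<rho>) + \<omega> 1 / \<rho>" using K(1) N \<rho> \<omega>1 by simp
      then have "1 \<le> exp (K + 1 / (N * \<rho>) + \<omega> 1 / \<rho>)" by simp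
      then have "1 * 1 \<le> B * exp (K + 1 / (N * \<rho>) + \<omega> 1 / \<rho>)" using B by (intro mult_mono) auto
      then show ?thesis by (simp add: exp_add mult.assoc)
    qed
    have len: "length (concat (map (\<lambda>i. replicate (\<alpha> i) i) (index_list :: 'n list))) = mi_len \<alpha>" for \<alpha>
    proof -
      have il: "set (index_list :: 'n list) = UNIV" "distinct (index_list :: 'n list)"
        using someI_ex[OF finite_distinct_list[OF finite[of "UNIV :: 'n set"]]] unfolding index_list_def by blast+
      have "length (concat (map (\<lambda>i. replicate (\<alpha> i) i) (index_list :: 'n list))) = (\<Sum>i\<leftarrow>index_list. \<alpha> i)"
        by (simp add: length_concat o_def)
      also have "\<dots> = (\<Sum>i\<in>set (index_list :: 'n list). \<alpha> i)" using il(2) by (rule sum_list_distinct_conv_sum_set)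
      finally show ?thesis by (simp add: il mi_len_def)
    qed
    show "B_class \<omega> (L * \<rho>) (ball 0 (R / 2)) f"
      unfolding B_class_iff
    proof (intro conjI exI[of _ "B * exp K * exp (1 / (N * \<rho>)) * exp (\<omega> 1 / \<rho>)"] ballI allI sm'(1) B1)
      fix x \<alpha> assume x: "x \<in> ball (0 :: real^'n) (R / 2)"
      show "cmod (dpartial \<alpha> f x) \<le> B * exp K * exp (1 / (N * \<rho>)) * exp (\<omega> 1 / \<rho>) * exp (phi_star \<omega> (L * \<rho> * real (mi_len \<alpha>)) / (L * \<rho>))"
        using sm'(2)[OF x, of "concat (map (\<lambda>i. replicate (\<alpha> i) i) index_list)"]
        unfolding len dpartial_def Bs_def .
    qed
  qed
qed

section \<open>Passage to germs\<close>

lemma common_ball: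
  fixes U1 U2 :: "(real^'n::finite) set"
  assumes "open U1" "0 \<in> U1" "open U2" "0 \<in> U2"
  obtains R where "R > 0" "rel_compact_in (ball 0 R) U1" "rel_compact_in (ball 0 R) U2"
proof -
  have "open (U1 \<inter> U2)" "0 \<in> U1 \<inter> U2" using assms by auto
  then obtain R where R: "R > 0" "cball 0 R \<subseteq> U1 \<inter> U2" using open_contains_cball by blast
  then show ?thesis using that[of R] by (auto simp: rel_compact_in_def closure_ball)
qed

theorem property_D_weight_function:
  fixes \<omega> :: "real \<Rightarrow> real"
  assumes \<omega>: "weight_function \<omega>"
  shows "property_D (germ_Roumieu \<omega> :: (real^'n::finite \<Rightarrow> complex) \<Rightarrow> bool)"
    and "property_D (germ_Beurling \<omega> :: (real^'n \<Rightarrow> complex) \<Rightarrow> bool)"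
proof -
  show "property_D (germ_Roumieu \<omega> :: (real^'n \<Rightarrow> complex) \<Rightarrow> bool)"
    unfolding property_D_def
  proof (intro allI impI, elim conjE)
    fix f :: "real^'n \<Rightarrow> complex" and j :: nat
    assume j: "j \<ge> 1" and "germ_Roumieu \<omega> (\<lambda>x. f x ^ j)" "germ_Roumieu \<omega> (\<lambda>x. f x ^ (j + 1))"
    then obtain U1 U2 where U: "open U1" "0 \<in> U1" "E_Roumieu \<omega> U1 (\<lambda>x. f x ^ j)"
      "open U2" "0 \<in> U2" "E_Roumieu \<omega> U2 (\<lambda>x. f x ^ (j + 1))"
      unfolding germ_Roumieu_def by blast
    obtain R where R: "R > 0" "rel_compact_in (ball 0 R) U1" "rel_compact_in (ball 0 R) U2"
      using common_ball U(1,2,4,5) by blast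
    obtain n1 n2 :: nat where n: "n1 \<ge> 1" "B_class \<omega> n1 (ball 0 R) (\<lambda>x. f x ^ j)"
      "n2 \<ge> 1" "B_class \<omega> n2 (ball 0 R) (\<lambda>x. f x ^ (j + 1))"
      using U(3,6) R(2,3) unfolding E_Roumieu_def by blast
    define \<rho> where "\<rho> = real (max n1 n2)"
    have g: "B_class \<omega> \<rho> (ball 0 R) (\<lambda>x. f x ^ j)" "B_class \<omega> \<rho> (ball 0 R) (\<lambda>x. f x ^ (j + 1))"
      using B_class_mono[OF \<omega> _ _ n(2), of \<rho>] B_class_mono[OF \<omega> _ _ n(4), of \<rho>] n by (auto simp: \<rho>_def)
    have \<rho>: "\<rho> > 0" using n by (simp add: \<rho>_def)
    obtain L where L: "L \<ge> 1" "B_class \<omega> (L * \<rho>) (ball 0 (R / 2)) f"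
      using power_root_B_class[OF \<omega> j R(1), where 'n = 'n] g \<rho> by blast
    define n where "n = nat \<lceil>L * \<rho>\<rceil>"
    have L\<rho>: "L * \<rho> > 0" using L \<rho> by simp
    then have nn: "n \<ge> 1" "L * \<rho> \<le> real n" unfolding n_def by linarith+
    have "B_class \<omega> (real n) (ball 0 (R / 2)) f" by (rule B_class_mono[OF \<omega> L\<rho> nn(2) L(2)])
    then have "E_Roumieu \<omega> (ball 0 (R / 2)) f"
      unfolding E_Roumieu_def
    proof (intro conjI allI impI)
      assume *: "B_class \<omega> (real n) (ball 0 (R / 2)) f"
      then show "smooth_on (ball 0 (R / 2)) f" by (simp add: B_class_iff)
      fix V :: "(real^'n) set" assume "rel_compact_in V (ball 0 (R / 2))"
      then have "V \<subseteq> ball 0 (R / 2)" using closure_subset unfolding rel_compact_in_def by blast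
      then show "\<exists>n::nat. n \<ge> 1 \<and> B_class \<omega> (real n) V f" using B_class_subset[OF *] nn(1) by blast
    qed
    then show "germ_Roumieu \<omega> f" unfolding germ_Roumieu_def using R(1) by (intro exI[of _ "ball 0 (R / 2)"]) auto
  qed
  show "property_D (germ_Beurling \<omega> :: (real^'n \<Rightarrow> complex) \<Rightarrow> bool)"
    unfolding property_D_def
  proof (intro allI impI, elim conjE)
    fix f :: "real^'n \<Rightarrow> complex" and j :: nat
    assume j: "j \<ge> 1" and "germ_Beurling \<omega> (\<lambda>x. f x ^ j)" "germ_Beurling \<omega> (\<lambda>x. f x ^ (j + 1))"
    then obtain U1 U2 where U: "open U1" "0 \<in> U1" "E_Beurling \<omega> U1 (\<lambda>x. f x ^ j)"
      "open U2" "0 \<in> U2" "E_Beurling \<omega> U2 (\<lambda>x. f x ^ (j + 1))"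
      unfolding germ_Beurling_def by blast
    obtain R where R: "R > 0" "rel_compact_in (ball 0 R) U1" "rel_compact_in (ball 0 R) U2"
      using common_ball U(1,2,4,5) by blast
    have g: "B_class \<omega> (1 / real n) (ball 0 R) (\<lambda>x. f x ^ j)" "B_class \<omega> (1 / real n) (ball 0 R) (\<lambda>x. f x ^ (j + 1))"
      if "n \<ge> 1" for n :: nat
      using U(3,6) R(2,3) that unfolding E_Beurling_def by blast+
    obtain L where L: "L \<ge> 1" "\<And>\<rho>. \<rho> > 0 \<Longrightarrow> B_class \<omega> \<rho> (ball 0 R) (\<lambda>x. f x ^ j) \<Longrightarrow>
       B_class \<omega> \<rho> (ball 0 R) (\<lambda>x. f x ^ (j + 1)) \<Longrightarrow> B_class \<omega> (L * \<rho>) (ball 0 (R / 2)) f"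
      using power_root_B_class[OF \<omega> j R(1), where 'n = 'n] by blast
    have fB: "B_class \<omega> (1 / real n) (ball 0 (R / 2)) f" if n: "n \<ge> 1" for n :: nat
    proof -
      \<comment> \<open>To reach the parameter \<open>1 / n\<close> the hypothesis is used at
        \<open>1 / m\<close> with \<open>L / m \<le> 1 / n\<close>; such an \<open>m\<close> exists
        because \<open>L\<close> does not depend on it.\<close>
      define m where "m = nat \<lceil>L * real n\<rceil>"
      have "L * real n > 0" using L n by simp
      then have m: "m \<ge> 1" "L * real n \<le> real m" unfolding m_def by linarith+
      have "B_class \<omega> (L * (1 / real m)) (ball 0 (R / 2)) f" using m g[OF m(1)] by (intro L(2)) auto
      moreover have "L * (1 / real m) \<le> 1 / real n" using m n by (simp add: field_simps)
      moreover have "L * (1 / real m) > 0" using m L by simp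
      ultimately show ?thesis using B_class_mono[OF \<omega>, of "L * (1 / real m)" "1 / real n"] by blast
    qed
    have "E_Beurling \<omega> (ball 0 (R / 2)) f"
      unfolding E_Beurling_def
    proof (intro conjI allI impI)
      show "smooth_on (ball 0 (R / 2)) f" using fB[of 1] by (simp add: B_class_iff)
      fix V :: "(real^'n) set" and n :: nat assume "rel_compact_in V (ball 0 (R / 2))" and n: "n \<ge> 1"
      then have "V \<subseteq> ball 0 (R / 2)" using closure_subset unfolding rel_compact_in_def by blast
      then show "B_class \<omega> (1 / real n) V f" using B_class_subset[OF fB[OF n]] by blast
    qed
    then show "germ_Beurling \<omega> f" unfolding germ_Beurling_def using R(1) by (intro exI[of _ "ball 0 (R / 2)"]) auto
  qed
qed

theorem theorem3p2:
  fixes \<omega> :: "real \<Rightarrow> real"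
  assumes "weight_function \<omega>"
    and "non_quasianalytic \<omega>"
    and "concave_on {0..} \<omega>"
  shows "property_D (germ_Roumieu \<omega> :: (real^'n::finite \<Rightarrow> complex) \<Rightarrow> bool)
       \<and> property_D (germ_Beurling \<omega> :: (real^'n \<Rightarrow> complex) \<Rightarrow> bool)"
  using property_D_weight_function[OF assms(1)] by blast

end
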